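(* The metaplectic group $\widetilde{\mathrm{Sp}}_{\psi,S}^R(W)$ is the fibre product, in the category of topological groups, of the continuous group morphisms $\sigma_S:\mathrm{Sp}(W)\to\mathrm{PGL}_R(S)$ and $\mathrm{red}:\mathrm{GL}_R(S)\to\mathrm{PGL}_R(S)$. As such, it is a topological subgroup of $\mathrm{Sp}(W)\times\mathrm{GL}_R(S)$ which is a topological central extension of $\mathrm{Sp}(W)$ by $R^\times$. Moreover, for two models $S,S'$ of $\rho_\psi$, the isomorphism $\Phi_{S,S'}:\widetilde{\mathrm{Sp}}_{\psi,S}^R(W)\to\widetilde{\mathrm{Sp}}_{\psi,S'}^R(W)$ is an isomorphism of topological central extensions.
   Context: $F$ is a field which is either finite of characteristic $p$ or non-archimedean local of residual characteristic $p$, of characteristic different from $2$; $(W,\langle\,,\rangle)$ is a finite-dimensional symplectic space over $F$; $R$ is a field with a fixed non-trivial smooth character $\psi:F\to R^\times$ (so $\mathrm{char}\,R\neq p$). Heisenberg group: $H=W\times F$ with $(w,t)(w',t')=(w+w',t+t'+\tfrac12\langle w,w'\rangle)$, centre $F=\{(0,t)\}$. $\rho_\psi$ is the unique (up to isomorphism) irreducible smooth $R$-representation of $H$ with central character $\psi$; a model of it is a representation $(\rho_\psi,S)$ in this isomorphism class. For $g\in\mathrm{Sp}(W)$ there is $M_g\in\mathrm{GL}_R(S)$, unique up to $R^\times$, with $M_g\rho_\psi(w,t)M_g^{-1}=\rho_\psi(g^{-1}w,t)$ for all $(w,t)\in H$; $\sigma_S(g)=\mathrm{red}(M_g)$, where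 $\mathrm{red}:\mathrm{GL}_R(S)\to\mathrm{PGL}_R(S)$ is the quotient morphism. $\widetilde{\mathrm{Sp}}_{\psi,S}^R(W)=\{(g,M):\sigma_S(g)=\mathrm{red}(M)\}$ is the fibre product; $p_S$ is the projection to $\mathrm{Sp}(W)$ and $i_S(\lambda)=(\mathrm{Id}_W,\lambda\,\mathrm{Id}_S)$ for $\lambda\in R^\times$. $\Phi_{S,S'}(g,M)=(g,\phi M\phi^{-1})$ for any isomorphism of $H$-representations $\phi:S\to S'$ (it is independent of $\phi$). Topologies: $R$ and $S$ are discrete; $\mathrm{GL}_R(S)$ has the compact-open topology, generated by the sets $\{g: gs=s'\}$, $s,s'\in S$; $\mathrm{PGL}_R(S)$ has the quotient topology; $\mathrm{Sp}(W)$ has its usual topology; the product has the product topology.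
   Formalization: Sp(W) carries the opposite composition law (gh means g followed by h): with M_g ρ(w,t) M_g^{-1} = ρ(g^{-1}w,t), σ_S is an anti-morphism for the usual law, so the claim fails for W ≠ 0. Inversion identifies the two laws. *)

theory Defs
  imports "HOL-Analysis.Analysis" "HOL-Algebra.Coset"
begin

section \<open>Topological groups, fibre products and central extensions\<close>

text \<open>A topological group is a group structure \<open>G\<close> together with a topology \<open>T\<close> on its carrier;
  no separation axiom is imposed.\<close>

definition topological_group :: "'a monoid \<Rightarrow> 'a topology \<Rightarrow> bool" where
  "topological_group G T \<longleftrightarrow>
     group G \<and> topspace T = carrier G \<and>
     continuous_map (prod_topology T T) T (\<lambda>(x, y). x \<otimes>\<^bsub>G\<^esub> y) \<and>
     continuous_map T T (\<lambda>x. inv\<^bsub>G\<^esub> x)"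

definition continuous_hom ::
    "'a monoid \<Rightarrow> 'a topology \<Rightarrow> 'b monoid \<Rightarrow> 'b topology \<Rightarrow> ('a \<Rightarrow> 'b) \<Rightarrow> bool" where
  "continuous_hom G TG H TH f \<longleftrightarrow> f \<in> hom G H \<and> continuous_map TG TH f"

definition topological_subgroup ::
    "'a monoid \<Rightarrow> 'a topology \<Rightarrow> 'a monoid \<Rightarrow> 'a topology \<Rightarrow> bool" where
  "topological_subgroup H TH G TG \<longleftrightarrow>
     topological_group H TH \<and> topological_group G TG \<and>
     subgroup (carrier H) G \<and> H = G\<lparr>carrier := carrier H\<rparr> \<and>
     TH = subtopology TG (carrier H)"

text \<open>The square \<open>P \<rightarrow> G\<^sub>1, G\<^sub>2 \<rightarrow> G\<^sub>0\<close> with legs \<open>q\<^sub>1, q\<^sub>2, f\<^sub>1, f\<^sub>2\<close> is cartesian in the category of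
  topological groups. A definition cannot quantify over types, so the test objects \<open>K\<close> live on a
  type \<open>'k\<close> given by the first argument; leaving \<open>'k\<close> as a type variable in a theorem gives the
  full universal property.\<close>

definition is_fibre_product ::
    "'k itself \<Rightarrow> 'p monoid \<Rightarrow> 'p topology \<Rightarrow> ('p \<Rightarrow> 'a) \<Rightarrow> ('p \<Rightarrow> 'b) \<Rightarrow>
     'a monoid \<Rightarrow> 'a topology \<Rightarrow> 'b monoid \<Rightarrow> 'b topology \<Rightarrow> 'c monoid \<Rightarrow> 'c topology \<Rightarrow>
     ('a \<Rightarrow> 'c) \<Rightarrow> ('b \<Rightarrow> 'c) \<Rightarrow> bool" where
  "is_fibre_product _ P TP q\<^sub>1 q\<^sub>2 G\<^sub>1 T\<^sub>1 G\<^sub>2 T\<^sub>2 G\<^sub>0 T\<^sub>0 f\<^sub>1 f\<^sub>2 \<longleftrightarrow>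
     topological_group G\<^sub>1 T\<^sub>1 \<and> topological_group G\<^sub>2 T\<^sub>2 \<and> topological_group G\<^sub>0 T\<^sub>0 \<and>
     continuous_hom G\<^sub>1 T\<^sub>1 G\<^sub>0 T\<^sub>0 f\<^sub>1 \<and> continuous_hom G\<^sub>2 T\<^sub>2 G\<^sub>0 T\<^sub>0 f\<^sub>2 \<and>
     topological_group P TP \<and>
     continuous_hom P TP G\<^sub>1 T\<^sub>1 q\<^sub>1 \<and> continuous_hom P TP G\<^sub>2 T\<^sub>2 q\<^sub>2 \<and>
     (\<forall>x\<in>carrier P. f\<^sub>1 (q\<^sub>1 x) = f\<^sub>2 (q\<^sub>2 x)) \<and>
     (\<forall>(K :: 'k monoid) TK a b.
        topological_group K TK \<and>
        continuous_hom K TK G\<^sub>1 T\<^sub>1 a \<and> continuous_hom K TK G\<^sub>2 T\<^sub>2 b \<and>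
        (\<forall>x\<in>carrier K. f\<^sub>1 (a x) = f\<^sub>2 (b x)) \<longrightarrow>
        (\<exists>u. continuous_hom K TK P TP u \<and>
             (\<forall>x\<in>carrier K. q\<^sub>1 (u x) = a x \<and> q\<^sub>2 (u x) = b x) \<and>
             (\<forall>u'. continuous_hom K TK P TP u' \<and>
                   (\<forall>x\<in>carrier K. q\<^sub>1 (u' x) = a x \<and> q\<^sub>2 (u' x) = b x) \<longrightarrow>
                   (\<forall>x\<in>carrier K. u' x = u x))))"

text \<open>\<open>1 \<rightarrow> A \<rightarrow> E \<rightarrow> G \<rightarrow> 1\<close> is a central extension of groups which is strict for the topologies:
  \<open>A\<close> carries the topology induced from \<open>E\<close>, and \<open>G\<close> carries the quotient topology.\<close>

definition topological_central_extension ::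
    "'a monoid \<Rightarrow> 'a topology \<Rightarrow> ('a \<Rightarrow> 'e) \<Rightarrow> 'e monoid \<Rightarrow> 'e topology \<Rightarrow> ('e \<Rightarrow> 'g) \<Rightarrow>
     'g monoid \<Rightarrow> 'g topology \<Rightarrow> bool" where
  "topological_central_extension A TA i E TE p G TG \<longleftrightarrow>
     topological_group A TA \<and> topological_group E TE \<and> topological_group G TG \<and>
     continuous_hom A TA E TE i \<and> continuous_hom E TE G TG p \<and>
     embedding_map TA TE i \<and> quotient_map TE TG p \<and>
     i ` carrier A = {x \<in> carrier E. p x = \<one>\<^bsub>G\<^esub>} \<and>
     (\<forall>a\<in>carrier A. \<forall>x\<in>carrier E. i a \<otimes>\<^bsub>E\<^esub> x = x \<otimes>\<^bsub>E\<^esub> i a)"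

definition topological_extension_iso ::
    "'a monoid \<Rightarrow> ('a \<Rightarrow> 'e) \<Rightarrow> 'e monoid \<Rightarrow> 'e topology \<Rightarrow> ('e \<Rightarrow> 'g) \<Rightarrow>
     ('a \<Rightarrow> 'd) \<Rightarrow> 'd monoid \<Rightarrow> 'd topology \<Rightarrow> ('d \<Rightarrow> 'g) \<Rightarrow> ('e \<Rightarrow> 'd) \<Rightarrow> bool" where
  "topological_extension_iso A i E TE p i' E' TE' p' \<Phi> \<longleftrightarrow>
     \<Phi> \<in> iso E E' \<and> homeomorphic_map TE TE' \<Phi> \<and>
     (\<forall>x\<in>carrier E. p' (\<Phi> x) = p x) \<and> (\<forall>a\<in>carrier A. \<Phi> (i a) = i' a)"


section \<open>The base field\<close>

definition nonarch_absolute_value :: "('f::field \<Rightarrow> real) \<Rightarrow> bool" where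
  "nonarch_absolute_value v \<longleftrightarrow>
     (\<forall>x. 0 \<le> v x) \<and> (\<forall>x. v x = 0 \<longleftrightarrow> x = 0) \<and>
     (\<forall>x y. v (x * y) = v x * v y) \<and> (\<forall>x y. v (x + y) \<le> max (v x) (v y)) \<and>
     (\<exists>x. x \<noteq> 0 \<and> v x \<noteq> 1)"

definition absolute_value_topology :: "('f::field \<Rightarrow> real) \<Rightarrow> 'f topology" where
  "absolute_value_topology v = Metric_space.mtopology UNIV (\<lambda>x y. v (x - y))"

text \<open>The residue field of \<open>v\<close> is \<open>{x. v x \<le> 1}\<close> modulo \<open>{x. v x < 1}\<close>; the last conjunct of the
  local case is the definition of \<open>CHAR\<close> for this quotient.\<close>

definition finite_or_nonarch_local_field :: "'f::field topology \<Rightarrow> nat \<Rightarrow> bool" where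
  "finite_or_nonarch_local_field TF p \<longleftrightarrow>
     (finite (UNIV :: 'f set) \<and> CHAR('f) = p \<and> TF = discrete_topology UNIV) \<or>
     (\<exists>v :: 'f \<Rightarrow> real. nonarch_absolute_value v \<and> TF = absolute_value_topology v \<and>
        locally_compact_space TF \<and> Gcd {n. v (of_nat n) < 1} = p)"

definition smooth_character :: "'f::field topology \<Rightarrow> ('f \<Rightarrow> 'r::field) \<Rightarrow> bool" where
  "smooth_character TF \<psi> \<longleftrightarrow>
     (\<forall>x. \<psi> x \<noteq> 0) \<and> (\<forall>x y. \<psi> (x + y) = \<psi> x * \<psi> y) \<and> openin TF {x. \<psi> x = 1}"


section \<open>Symplectic spaces and their isometry groups\<close>

definition symplectic_space ::
    "('f::field \<Rightarrow> 'w::ab_group_add \<Rightarrow> 'w) \<Rightarrow> ('w \<Rightarrow> 'w \<Rightarrow> 'f) \<Rightarrow> bool" where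
  "symplectic_space scW \<omega> \<longleftrightarrow>
     vector_space scW \<and> (\<exists>B. finite B \<and> module.span scW B = UNIV) \<and>
     (\<forall>w. Vector_Spaces.linear scW (*) (\<lambda>x. \<omega> x w)) \<and>
     (\<forall>w. Vector_Spaces.linear scW (*) (\<lambda>x. \<omega> w x)) \<and>
     (\<forall>w. \<omega> w w = 0) \<and> (\<forall>w. (\<forall>x. \<omega> w x = 0) \<longrightarrow> w = 0)"

text \<open>The topology of a finite-dimensional space is the initial one for its linear forms, i.e. the
  product topology of \<open>F\<^sup>n\<close> in any basis.\<close>

definition vector_topology ::
    "'f::field topology \<Rightarrow> ('f \<Rightarrow> 'w::ab_group_add \<Rightarrow> 'w) \<Rightarrow> 'w topology" where
  "vector_topology TF scW =
     topology_generated_by {l -` U |l U. Vector_Spaces.linear scW (*) l \<and> openin TF U}"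

text \<open>The group law of \<open>Sp(W)\<close> is that of a group acting on \<open>W\<close> from the right: the product
  \<open>g \<otimes> h\<close> is \<open>g\<close> followed by \<open>h\<close>. This convention is forced by the normalisation
  \<open>M\<^sub>g \<rho>(w,t) M\<^sub>g\<^sup>-\<^sup>1 = \<rho>(g\<^sup>-\<^sup>1w,t)\<close>, under which \<open>M\<^sub>g \<circ> M\<^sub>h\<close> is attached to \<open>h \<circ> g\<close> (lemma
  \<open>intertwines_comp\<close> below): for the opposite law \<open>g \<mapsto> M\<^sub>g\<close> would be an anti-homomorphism.
  The two laws are exchanged by inversion (lemma \<open>inverse_iso_Sp\<close>).\<close>

definition Sp :: "('f::field \<Rightarrow> 'w::ab_group_add \<Rightarrow> 'w) \<Rightarrow> ('w \<Rightarrow> 'w \<Rightarrow> 'f) \<Rightarrow> ('w \<Rightarrow> 'w) monoid" where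
  "Sp scW \<omega> =
     \<lparr>carrier = {g. Vector_Spaces.linear scW scW g \<and> bij g \<and> (\<forall>x y. \<omega> (g x) (g y) = \<omega> x y)},
      mult = (\<lambda>g h. h \<circ> g), one = id\<rparr>"

text \<open>Pointwise convergence on \<open>W\<close>, i.e. convergence of all matrix coefficients.\<close>

definition Sp_topology ::
    "'f::field topology \<Rightarrow> ('f \<Rightarrow> 'w::ab_group_add \<Rightarrow> 'w) \<Rightarrow> ('w \<Rightarrow> 'w \<Rightarrow> 'f) \<Rightarrow> ('w \<Rightarrow> 'w) topology" where
  "Sp_topology TF scW \<omega> =
     subtopology (product_topology (\<lambda>_. vector_topology TF scW) UNIV) (carrier (Sp scW \<omega>))"


section \<open>The groups GL(S), PGL(S) and the scalars\<close>

definition GL :: "('r::field \<Rightarrow> 's::ab_group_add \<Rightarrow> 's) \<Rightarrow> ('s \<Rightarrow> 's) monoid" where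
  "GL scS = \<lparr>carrier = {M. Vector_Spaces.linear scS scS M \<and> bij M}, mult = (\<circ>), one = id\<rparr>"

definition GL_topology :: "('r::field \<Rightarrow> 's::ab_group_add \<Rightarrow> 's) \<Rightarrow> ('s \<Rightarrow> 's) topology" where
  "GL_topology scS = topology_generated_by {{M \<in> carrier (GL scS). M s = s'} |s s'. True}"

definition scalars :: "('r::field \<Rightarrow> 's::ab_group_add \<Rightarrow> 's) \<Rightarrow> ('s \<Rightarrow> 's) set" where
  "scalars scS = {scS c |c. c \<noteq> 0}"

definition PGL :: "('r::field \<Rightarrow> 's::ab_group_add \<Rightarrow> 's) \<Rightarrow> ('s \<Rightarrow> 's) set monoid" where
  "PGL scS = GL scS Mod scalars scS"

definition red :: "('r::field \<Rightarrow> 's::ab_group_add \<Rightarrow> 's) \<Rightarrow> ('s \<Rightarrow> 's) \<Rightarrow> ('s \<Rightarrow> 's) set" where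
  "red scS M = scalars scS #>\<^bsub>GL scS\<^esub> M"

definition PGL_topology :: "('r::field \<Rightarrow> 's::ab_group_add \<Rightarrow> 's) \<Rightarrow> ('s \<Rightarrow> 's) set topology" where
  "PGL_topology scS =
     topology (\<lambda>U. U \<subseteq> carrier (PGL scS) \<and>
                   openin (GL_topology scS) {M \<in> carrier (GL scS). red scS M \<in> U})"

definition multiplicative_group :: "'r::field monoid" where
  "multiplicative_group = \<lparr>carrier = {c. c \<noteq> 0}, mult = (*), one = 1\<rparr>"


section \<open>The Heisenberg group and its representations\<close>

definition Heisenberg :: "('w::ab_group_add \<Rightarrow> 'w \<Rightarrow> 'f::field) \<Rightarrow> ('w \<times> 'f) monoid" where
  "Heisenberg \<omega> =
     \<lparr>carrier = UNIV,
      mult = (\<lambda>(w, t) (w', t'). (w + w', t + t' + \<omega> w w' / 2)),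
      one = (0, 0)\<rparr>"

definition Heisenberg_topology ::
    "'f::field topology \<Rightarrow> ('f \<Rightarrow> 'w::ab_group_add \<Rightarrow> 'w) \<Rightarrow> ('w \<times> 'f) topology" where
  "Heisenberg_topology TF scW = prod_topology (vector_topology TF scW) TF"

text \<open>Representations of \<open>H\<close> on the \<open>R\<close>-vector space \<open>S\<close> with scalar multiplication \<open>scS\<close>, whose
  underlying set is the whole type \<open>'s\<close>.\<close>

definition smooth_rep ::
    "'f::field topology \<Rightarrow> ('f \<Rightarrow> 'w::ab_group_add \<Rightarrow> 'w) \<Rightarrow> ('w \<Rightarrow> 'w \<Rightarrow> 'f) \<Rightarrow>
     ('r::field \<Rightarrow> 's::ab_group_add \<Rightarrow> 's) \<Rightarrow> ('w \<times> 'f \<Rightarrow> 's \<Rightarrow> 's) \<Rightarrow> bool" where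
  "smooth_rep TF scW \<omega> scS \<rho> \<longleftrightarrow>
     vector_space scS \<and> \<rho> \<in> hom (Heisenberg \<omega>) (GL scS) \<and>
     (\<forall>s. openin (Heisenberg_topology TF scW) {h. \<rho> h s = s})"

definition irreducible_rep ::
    "('r::field \<Rightarrow> 's::ab_group_add \<Rightarrow> 's) \<Rightarrow> ('h \<Rightarrow> 's \<Rightarrow> 's) \<Rightarrow> bool" where
  "irreducible_rep scS \<rho> \<longleftrightarrow>
     (UNIV :: 's set) \<noteq> {0} \<and>
     (\<forall>V. module.subspace scS V \<and> (\<forall>h. \<rho> h ` V \<subseteq> V) \<longrightarrow> V = {0} \<or> V = UNIV)"

text \<open>\<open>(\<rho>, S)\<close> is a model of \<open>\<rho>\<^sub>\<psi>\<close>. By the Stone--von Neumann theorem any two models are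
  isomorphic.\<close>

definition Heisenberg_model ::
    "'f::field topology \<Rightarrow> ('f \<Rightarrow> 'w::ab_group_add \<Rightarrow> 'w) \<Rightarrow> ('w \<Rightarrow> 'w \<Rightarrow> 'f) \<Rightarrow> ('f \<Rightarrow> 'r) \<Rightarrow>
     ('r::field \<Rightarrow> 's::ab_group_add \<Rightarrow> 's) \<Rightarrow> ('w \<times> 'f \<Rightarrow> 's \<Rightarrow> 's) \<Rightarrow> bool" where
  "Heisenberg_model TF scW \<omega> \<psi> scS \<rho> \<longleftrightarrow>
     smooth_rep TF scW \<omega> scS \<rho> \<and> irreducible_rep scS \<rho> \<and>
     (\<forall>t. \<rho> (0, t) = scS (\<psi> t))"

definition rep_iso ::
    "('r::field \<Rightarrow> 's::ab_group_add \<Rightarrow> 's) \<Rightarrow> ('h \<Rightarrow> 's \<Rightarrow> 's) \<Rightarrow>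
     ('r \<Rightarrow> 'u::ab_group_add \<Rightarrow> 'u) \<Rightarrow> ('h \<Rightarrow> 'u \<Rightarrow> 'u) \<Rightarrow> ('s \<Rightarrow> 'u) \<Rightarrow> bool" where
  "rep_iso scS \<rho> scS' \<rho>' \<phi> \<longleftrightarrow>
     Vector_Spaces.linear scS scS' \<phi> \<and> bij \<phi> \<and> (\<forall>h. \<phi> \<circ> \<rho> h = \<rho>' h \<circ> \<phi>)"


section \<open>The metaplectic group\<close>

definition intertwines :: "('w \<times> 'f \<Rightarrow> 's \<Rightarrow> 's) \<Rightarrow> ('w \<Rightarrow> 'w) \<Rightarrow> ('s \<Rightarrow> 's) \<Rightarrow> bool" where
  "intertwines \<rho> g M \<longleftrightarrow>
     (\<forall>w t. M \<circ> \<rho> (w, t) \<circ> inv_into UNIV M = \<rho> (inv_into UNIV g w, t))"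

text \<open>\<open>M\<^sub>g\<close> exists by the Stone--von Neumann theorem and is unique up to scalars by Schur's lemma,
  so \<open>sigma_S\<close> does not depend on the choice.\<close>

definition sigma_S ::
    "('r::field \<Rightarrow> 's::ab_group_add \<Rightarrow> 's) \<Rightarrow> ('w \<times> 'f \<Rightarrow> 's \<Rightarrow> 's) \<Rightarrow> ('w \<Rightarrow> 'w) \<Rightarrow> ('s \<Rightarrow> 's) set" where
  "sigma_S scS \<rho> g = red scS (SOME M. M \<in> carrier (GL scS) \<and> intertwines \<rho> g M)"

definition Mp ::
    "('f::field \<Rightarrow> 'w::ab_group_add \<Rightarrow> 'w) \<Rightarrow> ('w \<Rightarrow> 'w \<Rightarrow> 'f) \<Rightarrow>
     ('r::field \<Rightarrow> 's::ab_group_add \<Rightarrow> 's) \<Rightarrow> ('w \<times> 'f \<Rightarrow> 's \<Rightarrow> 's) \<Rightarrow>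
     (('w \<Rightarrow> 'w) \<times> ('s \<Rightarrow> 's)) monoid" where
  "Mp scW \<omega> scS \<rho> =
     (Sp scW \<omega> \<times>\<times> GL scS)
       \<lparr>carrier := {(g, M). g \<in> carrier (Sp scW \<omega>) \<and> M \<in> carrier (GL scS) \<and>
                           sigma_S scS \<rho> g = red scS M}\<rparr>"

definition Mp_topology ::
    "'f::field topology \<Rightarrow> ('f \<Rightarrow> 'w::ab_group_add \<Rightarrow> 'w) \<Rightarrow> ('w \<Rightarrow> 'w \<Rightarrow> 'f) \<Rightarrow>
     ('r::field \<Rightarrow> 's::ab_group_add \<Rightarrow> 's) \<Rightarrow> ('w \<times> 'f \<Rightarrow> 's \<Rightarrow> 's) \<Rightarrow>
     (('w \<Rightarrow> 'w) \<times> ('s \<Rightarrow> 's)) topology" where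
  "Mp_topology TF scW \<omega> scS \<rho> =
     subtopology (prod_topology (Sp_topology TF scW \<omega>) (GL_topology scS))
       (carrier (Mp scW \<omega> scS \<rho>))"

definition Mp_proj :: "('w \<Rightarrow> 'w) \<times> ('s \<Rightarrow> 's) \<Rightarrow> 'w \<Rightarrow> 'w" where
  "Mp_proj = fst"

definition Mp_incl ::
    "('r::field \<Rightarrow> 's::ab_group_add \<Rightarrow> 's) \<Rightarrow> 'r \<Rightarrow> ('w \<Rightarrow> 'w) \<times> ('s \<Rightarrow> 's)" where
  "Mp_incl scS c = (id, scS c)"

definition conj_by ::
    "('s \<Rightarrow> 'u) \<Rightarrow> ('w \<Rightarrow> 'w) \<times> ('s \<Rightarrow> 's) \<Rightarrow> ('w \<Rightarrow> 'w) \<times> ('u \<Rightarrow> 'u)" where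
  "conj_by \<phi> = (\<lambda>(g, M). (g, \<phi> \<circ> M \<circ> inv_into UNIV \<phi>))"

definition Mp_change_model ::
    "('r::field \<Rightarrow> 's::ab_group_add \<Rightarrow> 's) \<Rightarrow> ('w \<times> 'f \<Rightarrow> 's \<Rightarrow> 's) \<Rightarrow>
     ('r \<Rightarrow> 'u::ab_group_add \<Rightarrow> 'u) \<Rightarrow> ('w \<times> 'f \<Rightarrow> 'u \<Rightarrow> 'u) \<Rightarrow>
     ('w \<Rightarrow> 'w) \<times> ('s \<Rightarrow> 's) \<Rightarrow> ('w \<Rightarrow> 'w) \<times> ('u \<Rightarrow> 'u)" where
  "Mp_change_model scS \<rho> scS' \<rho>' = conj_by (SOME \<phi>. rep_iso scS \<rho> scS' \<rho>' \<phi>)"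


section \<open>The group law on Sp(W)\<close>

lemma intertwines_comp:
  assumes "bij g" "bij h" "bij M" "bij N" "intertwines \<rho> g M" "intertwines \<rho> h N"
  shows "intertwines \<rho> (h \<circ> g) (M \<circ> N)"
  unfolding intertwines_def
proof (intro allI)
  fix w t
  have N: "N \<circ> \<rho> (w, t) \<circ> inv_into UNIV N = \<rho> (inv_into UNIV h w, t)"
    and M: "M \<circ> \<rho> (inv_into UNIV h w, t) \<circ> inv_into UNIV M
              = \<rho> (inv_into UNIV g (inv_into UNIV h w), t)"
    using assms(5,6) by (simp_all add: intertwines_def)
  have "M \<circ> N \<circ> \<rho> (w, t) \<circ> inv_into UNIV (M \<circ> N)
          = M \<circ> (N \<circ> \<rho> (w, t) \<circ> inv_into UNIV N) \<circ> inv_into UNIV M"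
    using assms(3,4) by (simp add: o_inv_distrib comp_assoc)
  also have "\<dots> = \<rho> (inv_into UNIV (h \<circ> g) w, t)"
    using assms(1,2) by (simp add: N M o_inv_distrib)
  finally show "M \<circ> N \<circ> \<rho> (w, t) \<circ> inv_into UNIV (M \<circ> N) = \<rho> (inv_into UNIV (h \<circ> g) w, t)" .
qed

lemma inverse_iso_Sp:
  assumes "vector_space scW"
  shows "inv_into UNIV \<in> iso (Sp scW \<omega>) (Sp scW \<omega>\<lparr>mult := (\<circ>)\<rparr>)"
proof -
  have linear_iff: "Vector_Spaces.linear scW scW g \<longleftrightarrow>
      (\<forall>x y. g (x + y) = g x + g y) \<and> (\<forall>c x. g (scW c x) = scW c (g x))" for g
    using assms
    by (auto simp: Vector_Spaces.linear_def module_hom_def module_hom_axioms_def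
        vector_space_def module_def)
  have lin: "Vector_Spaces.linear scW scW (inv_into UNIV g)"
    if g: "Vector_Spaces.linear scW scW g" and "bij g" for g
  proof (rule linear_iff[THEN iffD2], intro conjI allI)
    have inj: "inj g" and surj: "surj g"
      using that(2) by (auto simp: bij_def)
    fix x y c
    have "g (inv_into UNIV g x + inv_into UNIV g y) = x + y"
      using linear_iff[THEN iffD1, OF g] by (simp add: surj_f_inv_f[OF surj])
    then show "inv_into UNIV g (x + y) = inv_into UNIV g x + inv_into UNIV g y"
      by (rule inv_f_eq[OF inj])
    have "g (scW c (inv_into UNIV g x)) = scW c x"
      using linear_iff[THEN iffD1, OF g] by (simp add: surj_f_inv_f[OF surj])
    then show "inv_into UNIV g (scW c x) = scW c (inv_into UNIV g x)"
      by (rule inv_f_eq[OF inj])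
  qed
  have cl: "inv_into UNIV g \<in> carrier (Sp scW \<omega>)" if g: "g \<in> carrier (Sp scW \<omega>)" for g
  proof -
    have surj: "surj g" and iso: "\<omega> (g x) (g y) = \<omega> x y" for x y
      using g by (auto simp: Sp_def bij_def)
    have "\<omega> (inv_into UNIV g x) (inv_into UNIV g y) = \<omega> x y" for x y
      using iso[of "inv_into UNIV g x" "inv_into UNIV g y"] by (simp add: surj_f_inv_f[OF surj])
    then show ?thesis
      using g lin[of g] by (simp add: Sp_def bij_imp_bij_inv)
  qed
  have inv2: "inv_into UNIV (inv_into UNIV g) = g" if "g \<in> carrier (Sp scW \<omega>)" for g
    using that by (simp add: Sp_def inv_inv_eq)
  have "bij_betw (inv_into UNIV) (carrier (Sp scW \<omega>)) (carrier (Sp scW \<omega>))"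
    by (rule bij_betwI[where g = "inv_into UNIV"]) (use cl inv2 in auto)
  moreover have "inv_into UNIV (h \<circ> g) = inv_into UNIV g \<circ> inv_into UNIV h"
    if "g \<in> carrier (Sp scW \<omega>)" "h \<in> carrier (Sp scW \<omega>)" for g h
    using that by (simp add: Sp_def o_inv_distrib)
  ultimately show ?thesis
    using cl by (simp add: iso_def hom_def Pi_def) (simp add: Sp_def)
qed

end

theory Submission
  imports Defs
begin

text \<open>Choose a symplectic basis of \<open>W\<close> and an element \<open>a\<close> of \<open>F\<close> of minimal absolute value with
  \<open>\<psi>(a) \<noteq> 1\<close>. The elements of \<open>W\<close> with coordinates \<open>|x\<^sub>i| < |a|\<close> and \<open>|y\<^sub>i| \<le> 1\<close> form an open
  compact subgroup \<open>J\<close> which is its own orthogonal for \<open>\<psi> \<circ> \<omega>\<close>, and \<open>\<psi>(\<Sum> x\<^sub>i y\<^sub>i / 2)\<close> extends \<open>\<psi>\<close>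
  to a character \<open>eta\<close> of \<open>J \<times> F\<close>. Every model contains an \<open>eta\<close>-eigenvector \<open>s\<^sub>0\<close> of \<open>J\<close> (a vacuum
  vector), and the translates of \<open>s\<^sub>0\<close> by representatives of \<open>W/J\<close> are eigenvectors of \<open>J\<close> for distinct
  characters, hence a basis. This proves the Stone--von Neumann theorem and Schur's lemma over an
  arbitrary \<open>R\<close>, without averaging and without roots of unity other than the values of \<open>\<psi>\<close>.

  An element of \<open>Sp(W)\<close> close to the identity preserves \<open>(J, eta)\<close>, so it has an intertwiner fixing
  \<open>s\<^sub>0\<close> and any prescribed finite set of its translates; this is the continuity of \<open>\<sigma>\<^sub>S\<close>. The
  remaining assertions are formal properties of fibre products of topological groups, using that
  \<open>red\<close> is open.\<close>

section \<open>Vacuum vectors of projective representations\<close>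

text \<open>Two obstacles shape the argument. \<open>R\<close> need not be algebraically closed and
  \<open>S\<close> may be infinite-dimensional, so irreducibility does not by itself make the
  commutant scalar; the line of vacuum vectors, cut out by a character with values in
  \<open>R\<close>, does. Moreover the residue characteristic may be 2. Then \<open>1/2\<close> is
  not integral and the cocycle \<open>\<psi>(\<omega>/2)\<close> need not be trivial on
  \<open>J\<close>; only its square \<open>\<psi> \<circ> \<omega>\<close>, which governs the
  commutators, is. This is why self-duality is stated for the square, and why \<open>eta\<close> has
  to correct the cocycle on \<open>J\<close>.

  The bounds in \<open>J\<close> come from duality: \<open>\<psi>(x y) = 1\<close> for all
  \<open>|y| \<le> 1\<close> holds exactly when \<open>|x| < |a|\<close>, since otherwise
  \<open>a / x\<close> is integral and \<open>\<psi>(x (a / x)) = \<psi>(a) \<noteq> 1\<close>. For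
  a finite field with the trivial absolute value \<open>|a| = 1\<close>, so that \<open>J\<close> is
  the Lagrangian spanned by the second half of the basis, and the finite and local cases become one
  proof.\<close>

lemma (in vector_space) eigenvectors_distinct:
  assumes "finite A" and "\<And>a. a \<in> A \<Longrightarrow> u a \<noteq> 0"
    and lin: "\<And>i. i \<in> I \<Longrightarrow> Vector_Spaces.linear scale scale (T i)"
    and eig: "\<And>i a. i \<in> I \<Longrightarrow> a \<in> A \<Longrightarrow> T i (u a) = scale (l i a) (u a)"
    and "\<And>a b. a \<in> A \<Longrightarrow> b \<in> A \<Longrightarrow> a \<noteq> b \<Longrightarrow> \<exists>i\<in>I. l i a \<noteq> l i b"
    and "(\<Sum>a\<in>A. scale (c a) (u a)) = 0" and "a \<in> A"
  shows "c a = 0"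
  using assms(1,2,4-)
proof (induction A arbitrary: c a rule: finite_induct)
  case (insert b A)
  \<comment> \<open>Apply \<open>T i\<close> to the relation and subtract \<open>l i b\<close> times
    it: the term of \<open>b\<close> disappears and \<open>c x\<close> gains the factor
    \<open>l i x - l i b\<close>. The index \<open>i\<close> may depend on the pair to be separated,
    so no single operator has to separate all the vectors.\<close>
  have sep: "c x * (l i x - l i b) = 0" if "x \<in> A" and i: "i \<in> I" for x i
  proof (rule insert.IH[of "\<lambda>a. c a * (l i a - l i b)" x])
    interpret T: Vector_Spaces.linear scale scale "T i"
      using lin i .
    have "T i (\<Sum>a\<in>insert b A. scale (c a) (u a)) = (\<Sum>a\<in>insert b A. scale (c a * l i a) (u a))"
      by (simp add: T.sum T.scale insert.prems(2) i)
    then have "(\<Sum>a\<in>insert b A. scale (c a * l i a) (u a)) = 0"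
      by (simp add: insert.prems(4) T.zero)
    moreover have "(\<Sum>a\<in>insert b A. scale (c a * l i b) (u a)) = 0"
      using arg_cong[OF insert.prems(4), of "scale (l i b)"]
      by (simp add: scale_sum_right mult.commute)
    ultimately have "(\<Sum>a\<in>insert b A. scale (c a * (l i a - l i b)) (u a)) = 0"
      by (simp add: right_diff_distrib scale_left_diff_distrib sum_subtractf del: sum.insert)
    then show "(\<Sum>a\<in>A. scale (c a * (l i a - l i b)) (u a)) = 0"
      using insert.hyps by simp
  qed (use insert.prems that in auto)
  have zero: "c x = 0" if x: "x \<in> A" for x
  proof -
    have "x \<noteq> b" using x insert.hyps by auto
    then obtain i where "i \<in> I" "l i x \<noteq> l i b"
      using insert.prems(3)[of x b] x by blast
    then show ?thesis using sep[OF x] by auto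
  qed
  then have "scale (c b) (u b) = 0"
    using insert.prems(4) insert.hyps by simp
  then have "c b = 0"
    using insert.prems(1)[of b] by simp
  then show ?case using zero insert.prems(5) by auto
qed auto

text \<open>What the argument needs of \<open>W\<close> and \<open>J\<close>, freed from fields and
  topologies. The model for \<open>\<beta>\<close> is \<open>\<psi>(\<omega>/2)\<close>. By
  \<open>eta_mult\<close>, \<open>\<eta>\<close> splits the cocycle over \<open>J\<close>: if the
  operators \<open>P w\<close> multiply with cocycle \<open>\<beta>\<close>, then
  \<open>inverse (\<eta> j)\<close> times \<open>P j\<close> is a genuine action of
  \<open>J\<close>.\<close>

locale polarised_cocycle =
  fixes \<beta> :: "'w::ab_group_add \<Rightarrow> 'w \<Rightarrow> 'r::field" and J :: "'w set" and \<eta> :: "'w \<Rightarrow> 'r"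
  assumes beta_nonzero: "\<beta> x y \<noteq> 0"
    and beta_add_left: "\<beta> (x + x') y = \<beta> x y * \<beta> x' y"
    and beta_add_right: "\<beta> x (y + y') = \<beta> x y * \<beta> x y'"
    and beta_alt: "\<beta> x x = 1"
    and J_zero: "0 \<in> J" and J_add: "j \<in> J \<Longrightarrow> k \<in> J \<Longrightarrow> j + k \<in> J"
    and J_uminus: "j \<in> J \<Longrightarrow> - j \<in> J"
    and eta_nonzero: "\<eta> j \<noteq> 0"
    and eta_mult: "j \<in> J \<Longrightarrow> k \<in> J \<Longrightarrow> \<eta> j * \<eta> k = \<beta> j k * \<eta> (j + k)"
    and J_self_dual: "w \<in> J \<longleftrightarrow> (\<forall>j\<in>J. (\<beta> w j)\<^sup>2 = 1)"
begin

lemma J_diff: "j \<in> J \<Longrightarrow> k \<in> J \<Longrightarrow> j - k \<in> J"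
  using J_add[of j "- k"] J_uminus by simp

lemma beta_zero_left: "\<beta> 0 y = 1"
  using beta_add_left[of 0 0 y] beta_nonzero[of 0 y] by simp

lemma beta_zero_right: "\<beta> y 0 = 1"
  using beta_add_right[of y 0 0] beta_nonzero[of y 0] by simp

lemma beta_uminus_left: "\<beta> (- x) y = inverse (\<beta> x y)"
  using beta_add_left[of x "- x" y] beta_zero_left beta_nonzero[of x y]
  by (simp add: inverse_unique)

lemma beta_uminus_right: "\<beta> x (- y) = inverse (\<beta> x y)"
  using beta_add_right[of x y "- y"] beta_zero_right beta_nonzero[of x y]
  by (simp add: inverse_unique)

lemma beta_swap: "\<beta> y x = inverse (\<beta> x y)"
proof -
  have "\<beta> (x + y) (x + y) = \<beta> x y * \<beta> y x"
    unfolding beta_add_left beta_add_right by (simp add: beta_alt)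
  then show ?thesis by (simp add: beta_alt inverse_unique)
qed

definition rep :: "'w \<Rightarrow> 'w" where "rep w = (SOME z. w - z \<in> J)"

lemma diff_rep: "w - rep w \<in> J"
  unfolding rep_def by (rule someI[of _ w]) (simp add: J_zero)

text \<open>Congruent arguments hand the same predicate to \<open>SOME\<close>, so their
  representatives are equal and not merely congruent.\<close>

lemma rep_eqI:
  assumes "w - w' \<in> J"
  shows "rep w = rep w'"
proof -
  have "w - z \<in> J \<longleftrightarrow> w' - z \<in> J" for z
  proof -
    have eq: "w - z - (w - w') = w' - z" "w' - z + (w - w') = w - z"
      by (simp_all add: algebra_simps)
    show ?thesis
      using J_diff[of "w - z" "w - w'", unfolded eq] J_add[of "w' - z" "w - w'", unfolded eq] assms
      by blast
  qed
  then show ?thesis by (simp add: rep_def)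
qed

lemma rep_rep: "rep (rep w) = rep w"
  using rep_eqI[of w "rep w"] diff_rep by simp

text \<open>Self-duality read backwards: an element outside \<open>J\<close> fails to be orthogonal
  to some \<open>j\<close>. Hence distinct cosets of \<open>J\<close> give distinct characters of
  \<open>J\<close>.\<close>

lemma separates_reps:
  assumes "w - w' \<notin> J"
  shows "\<exists>j\<in>J. (\<beta> j w)\<^sup>2 \<noteq> (\<beta> j w')\<^sup>2"
proof -
  obtain j where j: "j \<in> J" "(\<beta> (w - w') j)\<^sup>2 \<noteq> 1"
    using assms J_self_dual by blast
  have eq: "\<beta> (w - w') j = \<beta> w j * inverse (\<beta> w' j)"
    using beta_add_left[of w "- w'" j] by (simp add: beta_uminus_left)
  have "(\<beta> w j)\<^sup>2 \<noteq> (\<beta> w' j)\<^sup>2"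
    using j(2) unfolding eq by (auto simp: power_mult_distrib power_inverse beta_nonzero)
  then show ?thesis
    using j(1) by (intro bexI[of _ j]) (auto simp: beta_swap[of j] power_inverse)
qed

end

locale projective_rep = polarised_cocycle \<beta> J \<eta> + vector_space scS
  for \<beta> :: "'w::ab_group_add \<Rightarrow> 'w \<Rightarrow> 'r::field" and J \<eta>
    and scS :: "'r \<Rightarrow> 's::ab_group_add \<Rightarrow> 's" +
  fixes P :: "'w \<Rightarrow> 's \<Rightarrow> 's"
  assumes linear_P: "Vector_Spaces.linear scS scS (P w)"
    and P_P: "P w (P w' s) = scS (\<beta> w w') (P (w + w') s)"
    and P_zero: "P 0 s = s"
    and irreducible: "subspace V \<Longrightarrow> (\<And>w. P w ` V \<subseteq> V) \<Longrightarrow> V = {0} \<or> V = UNIV"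
begin

lemma P_scale: "P w (scS c s) = scS c (P w s)"
  and P_sum: "P w (\<Sum>a\<in>A. f a) = (\<Sum>a\<in>A. P w (f a))"
  and P_0: "P w 0 = 0"
proof -
  interpret Vector_Spaces.linear scS scS "P w" by (rule linear_P)
  show "P w (scS c s) = scS c (P w s)" "P w (\<Sum>a\<in>A. f a) = (\<Sum>a\<in>A. P w (f a))"
      "P w 0 = 0"
    by (rule scale sum zero)+
qed

lemma P_plus_arg: "P (w + w') s = scS (inverse (\<beta> w w')) (P w (P w' s))"
  by (simp add: P_P beta_nonzero)

text \<open>The commutator is the quotient of \<open>\<beta> w w'\<close> by
  \<open>\<beta> w' w\<close>, which is a square because \<open>\<beta>\<close> is
  alternating.\<close>

lemma P_swap: "P w (P w' s) = scS ((\<beta> w w')\<^sup>2) (P w' (P w s))"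
  by (simp add: P_P beta_swap[of w' w] beta_nonzero power2_eq_square add.commute)

lemma P_eq_0_iff: "P w s = 0 \<longleftrightarrow> s = 0"
proof
  assume "P w s = 0"
  then have "P (- w) (P w s) = 0" by (simp add: P_0)
  then show "s = 0"
    by (simp add: P_P P_zero beta_nonzero)
qed (simp add: P_0)

lemma span_orbit:
  assumes "s \<noteq> 0"
  shows "span (range (\<lambda>w. P w s)) = UNIV"
proof -
  let ?V = "span (range (\<lambda>w. P w s))"
  have "P w ` ?V \<subseteq> ?V" for w
  proof
    fix y assume "y \<in> P w ` ?V"
    then obtain x where x: "x \<in> ?V" "y = P w x" by auto
    interpret Vector_Spaces.linear scS scS "P w" by (rule linear_P)
    have "P w x \<in> span (P w ` range (\<lambda>w. P w s))"
      using x(1) span_image by blast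
    also have "\<dots> \<subseteq> ?V"
      by (rule span_minimal) (auto simp: P_P intro!: span_scale[OF span_base])
    finally show "y \<in> ?V" using x by simp
  qed
  then have "?V = {0} \<or> ?V = UNIV"
    by (intro irreducible) auto
  moreover have "P 0 s \<in> ?V" by (rule span_base) auto
  ultimately show ?thesis using assms by (auto simp: P_zero)
qed

end

locale vacuum_rep = projective_rep \<beta> J \<eta> scS P
  for \<beta> :: "'w::ab_group_add \<Rightarrow> 'w \<Rightarrow> 'r::field" and J \<eta>
    and scS :: "'r \<Rightarrow> 's::ab_group_add \<Rightarrow> 's" and P +
  fixes s\<^sub>0 :: 's
  assumes s0_nonzero: "s\<^sub>0 \<noteq> 0" and P_s0: "j \<in> J \<Longrightarrow> P j s\<^sub>0 = scS (\<eta> j) s\<^sub>0"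
begin

text \<open>Moving \<open>P j\<close> past \<open>P w\<close> twists the character by
  \<open>(\<beta> j w)\<^sup>2\<close>. By self-duality this twist remembers exactly the coset of
  \<open>w\<close> modulo \<open>J\<close>, which makes the translates of the vacuum vector
  independent.\<close>

lemma P_eigen: "j \<in> J \<Longrightarrow> P j (P w s\<^sub>0) = scS (\<eta> j * (\<beta> j w)\<^sup>2) (P w s\<^sub>0)"
  by (simp add: P_swap[of j w] P_s0 P_scale mult.commute)

lemma P_translate: "j \<in> J \<Longrightarrow> P (w + j) s\<^sub>0 = scS (inverse (\<beta> w j) * \<eta> j) (P w s\<^sub>0)"
  by (simp add: P_plus_arg P_s0 P_scale)

lemma P_rep: "P w s\<^sub>0 = scS (inverse (\<beta> (rep w) (w - rep w)) * \<eta> (w - rep w)) (P (rep w) s\<^sub>0)"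
  using P_translate[OF diff_rep, of "rep w" w] by simp

lemma coeff_zero:
  assumes "finite A" "A \<subseteq> range rep" "(\<Sum>w\<in>A. scS (c w) (P w s\<^sub>0)) = 0" "w \<in> A"
  shows "c w = 0"
proof (rule eigenvectors_distinct[where I = J and T = P and A = A and u = "\<lambda>w. P w s\<^sub>0"
        and l = "\<lambda>j w. \<eta> j * (\<beta> j w)\<^sup>2"])
  fix a b assume ab: "a \<in> A" "b \<in> A" "a \<noteq> b"
  have "rep a = a" "rep b = b"
    using ab assms(2) rep_rep by auto
  then have "a - b \<notin> J"
    using rep_eqI ab(3) by force
  then show "\<exists>j\<in>J. \<eta> j * (\<beta> j a)\<^sup>2 \<noteq> \<eta> j * (\<beta> j b)\<^sup>2"
    using separates_reps[of a b] eta_nonzero by auto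
qed (use assms P_eq_0_iff s0_nonzero linear_P P_eigen in auto)

lemma inj_on_reps: "inj_on (\<lambda>w. P w s\<^sub>0) (range rep)"
proof (rule inj_onI, rule ccontr)
  fix x y assume xy: "x \<in> range rep" "y \<in> range rep" "P x s\<^sub>0 = P y s\<^sub>0" "x \<noteq> y"
  \<comment> \<open>Equality of the two translates is a linear relation with coefficients 1 at
    \<open>x\<close> and -1 at \<open>y\<close>.\<close>
  have "(if x = x then 1 else - 1 :: 'r) = 0"
    by (rule coeff_zero[of "{x, y}" "\<lambda>z. if z = x then 1 else - 1"]) (use xy in auto)
  then show False by simp
qed

lemma independent_reps: "independent ((\<lambda>w. P w s\<^sub>0) ` range rep)"
proof -
  have "u v = 0" if B: "finite B" "B \<subseteq> (\<lambda>w. P w s\<^sub>0) ` range rep" "(\<Sum>v\<in>B. scS (u v) v) = 0" "v \<in> B"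
    for B u v
  proof -
  obtain A where A: "A \<subseteq> range rep" "B = (\<lambda>w. P w s\<^sub>0) ` A"
    using B(2) subset_imageE by meson
  have inj: "inj_on (\<lambda>w. P w s\<^sub>0) A"
    using inj_on_reps A(1) inj_on_subset by blast
  have fin: "finite A" using B(1) A(2) inj finite_imageD by blast
  obtain w where w: "w \<in> A" "v = P w s\<^sub>0" using B(4) A(2) by auto
  have "u (P w s\<^sub>0) = 0"
    by (rule coeff_zero[of A "\<lambda>w. u (P w s\<^sub>0)"])
      (use fin A B(3) w(1) in \<open>auto simp: sum.reindex[OF inj]\<close>)
    then show ?thesis using w(2) by simp
  qed
  then show ?thesis by (auto simp: dependent_explicit)
qed

lemma span_reps: "span ((\<lambda>w. P w s\<^sub>0) ` range rep) = UNIV"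
proof -
  have "range (\<lambda>w. P w s\<^sub>0) \<subseteq> span ((\<lambda>w. P w s\<^sub>0) ` range rep)"
    by (auto, subst P_rep) (auto intro!: span_scale[OF span_base])
  then show ?thesis
    using span_orbit[OF s0_nonzero] span_minimal[OF _ subspace_span] by blast
qed

text \<open>Since \<open>\<phi>\<close> commutes with \<open>J\<close>, the image of the vacuum
  vector is again an \<open>\<eta>\<close>-eigenvector. Its expansion in the eigenbasis therefore
  involves only the coset on which the twist is trivial, namely \<open>J\<close> itself, so it is a
  multiple of the vacuum vector. The orbit of that vector spans, so \<open>\<phi>\<close> is this
  scalar everywhere.\<close>

lemma commutant_scalar:
  assumes lin: "Vector_Spaces.linear scS scS \<phi>" and comm: "\<And>w s. \<phi> (P w s) = P w (\<phi> s)"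
  shows "\<exists>c. \<phi> = scS c"
proof -
  obtain B r where B: "finite B" "B \<subseteq> (\<lambda>w. P w s\<^sub>0) ` range rep" "\<phi> s\<^sub>0 = (\<Sum>a\<in>B. scS (r a) a)"
  proof -
    have "\<phi> s\<^sub>0 \<in> span ((\<lambda>w. P w s\<^sub>0) ` range rep)" by (simp add: span_reps)
    then show ?thesis unfolding span_explicit using that by blast
  qed
  obtain A where A: "A \<subseteq> range rep" "B = (\<lambda>w. P w s\<^sub>0) ` A"
    using B(2) subset_imageE by meson
  have inj: "inj_on (\<lambda>w. P w s\<^sub>0) A"
    using inj_on_reps A(1) inj_on_subset by blast
  have fin: "finite A" using B(1) A(2) inj finite_imageD by blast
  define c where "c w = r (P w s\<^sub>0)" for w
  have phi: "\<phi> s\<^sub>0 = (\<Sum>w\<in>A. scS (c w) (P w s\<^sub>0))"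
    using B(3) by (simp add: A(2) sum.reindex[OF inj] c_def)
  interpret phi: Vector_Spaces.linear scS scS \<phi> by (rule lin)
  have c0: "c w = 0" if wA: "w \<in> A" and wJ: "w \<notin> J" for w
  proof -
    obtain j where j: "j \<in> J" "(\<beta> j w)\<^sup>2 \<noteq> (\<beta> j 0)\<^sup>2"
      using separates_reps[of w 0] wJ by auto
    have "P j (\<phi> s\<^sub>0) = scS (\<eta> j) (\<phi> s\<^sub>0)"
      using j(1) by (simp add: comm[symmetric] P_s0 phi.scale)
    then have "(\<Sum>w\<in>A. scS (c w * \<eta> j * (\<beta> j w)\<^sup>2) (P w s\<^sub>0)) = (\<Sum>w\<in>A. scS (c w * \<eta> j) (P w s\<^sub>0))"
      using j(1) by (simp add: phi P_sum P_scale P_eigen scale_sum_right mult_ac)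
    then have "(\<Sum>w\<in>A. scS (c w * \<eta> j * (\<beta> j w)\<^sup>2 - c w * \<eta> j) (P w s\<^sub>0)) = 0"
      by (simp add: scale_left_diff_distrib sum_subtractf)
    then have "c w * \<eta> j * (\<beta> j w)\<^sup>2 - c w * \<eta> j = 0"
      using coeff_zero[OF fin A(1), of "\<lambda>w. c w * \<eta> j * (\<beta> j w)\<^sup>2 - c w * \<eta> j"] wA by simp
    then have "c w * \<eta> j * ((\<beta> j w)\<^sup>2 - 1) = 0" by (simp add: algebra_simps)
    then show ?thesis using j(2) eta_nonzero[of j] by (simp add: beta_zero_right)
  qed
  \<comment> \<open>The representative of the coset \<open>J\<close> need not be 0, whence the
    factor \<open>\<eta> w\<close>. For \<open>w\<close> outside \<open>J\<close> the coefficient is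
    already known to vanish, so both sides are 0 there.\<close>
  have "\<phi> s\<^sub>0 = (\<Sum>w\<in>A. scS (c w * \<eta> w) s\<^sub>0)"
    unfolding phi
  proof (rule sum.cong[OF refl])
    fix w assume "w \<in> A"
    then show "scS (c w) (P w s\<^sub>0) = scS (c w * \<eta> w) s\<^sub>0"
      by (cases "w \<in> J") (auto simp: c0 P_s0)
  qed
  then have s0: "\<phi> s\<^sub>0 = scS (\<Sum>w\<in>A. c w * \<eta> w) s\<^sub>0" (is "_ = scS ?k _")
    by (simp add: scale_sum_left)
  interpret pair: vector_space_pair scS scS ..
  have "\<phi> s = scS ?k s" for s
  proof (rule pair.linear_eq_on[OF lin linear_scale_self, where B = "range (\<lambda>w. P w s\<^sub>0)"])
    fix b assume "b \<in> range (\<lambda>w. P w s\<^sub>0)"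
    then show "\<phi> b = scS ?k b" using comm s0 by (auto simp: P_scale)
  qed (simp add: span_orbit s0_nonzero)
  then show ?thesis by blast
qed

end

section \<open>Uniqueness of a representation with a vacuum vector\<close>

lemma vacuum_rep_hom:
  assumes 1: "vacuum_rep \<beta> J \<eta> scS P s\<^sub>0" and 2: "vacuum_rep \<beta> J \<eta> scS' P' s\<^sub>0'"
  shows "\<exists>\<phi>. Vector_Spaces.linear scS scS' \<phi> \<and> (\<forall>w. \<phi> (P w s\<^sub>0) = P' w s\<^sub>0')"
proof -
  interpret A: vacuum_rep \<beta> J \<eta> scS P s\<^sub>0 by (rule 1)
  interpret B: vacuum_rep \<beta> J \<eta> scS' P' s\<^sub>0' by (rule 2)
  interpret pair: vector_space_pair scS scS' ..
  let ?B = "(\<lambda>w. P w s\<^sub>0) ` range A.rep"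
  obtain \<phi> where phi: "Vector_Spaces.linear scS scS' \<phi>"
    "\<And>b. b \<in> ?B \<Longrightarrow> \<phi> b = P' (the_inv_into (range A.rep) (\<lambda>w. P w s\<^sub>0) b) s\<^sub>0'"
    using pair.linear_independent_extend[OF A.independent_reps,
        of "\<lambda>b. P' (the_inv_into (range A.rep) (\<lambda>w. P w s\<^sub>0) b) s\<^sub>0'"] by blast
  \<comment> \<open>\<open>rep\<close> depends on \<open>J\<close> alone, so both bases are indexed
    by the same set. The scalar in \<open>P_rep\<close> involves only \<open>\<beta>\<close> and
    \<open>\<eta>\<close>, so a map that matches the bases matches the whole orbits.\<close>
  have "\<phi> (P w s\<^sub>0) = P' w s\<^sub>0'" for w
  proof -
    interpret Vector_Spaces.linear scS scS' \<phi> by (rule phi(1))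
    have "\<phi> (P (A.rep w) s\<^sub>0) = P' (A.rep w) s\<^sub>0'"
      by (subst phi(2)) (auto simp: the_inv_into_f_f[OF A.inj_on_reps])
    then show ?thesis
      by (subst A.P_rep, subst B.P_rep) (simp add: scale)
  qed
  then show ?thesis using phi(1) by blast
qed

text \<open>The maps in the two directions are inverse to each other on the orbits, which span. That
  the isomorphism takes one vacuum vector to the other is needed later, to compare two vacuum
  vectors of the same representation.\<close>

lemma vacuum_rep_iso:
  assumes 1: "vacuum_rep \<beta> J \<eta> scS P s\<^sub>0" and 2: "vacuum_rep \<beta> J \<eta> scS' P' s\<^sub>0'"
  shows "\<exists>\<phi>. Vector_Spaces.linear scS scS' \<phi> \<and> bij \<phi> \<and> \<phi> s\<^sub>0 = s\<^sub>0' \<and> (\<forall>w. \<phi> \<circ> P w = P' w \<circ> \<phi>)"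
proof -
  interpret A: vacuum_rep \<beta> J \<eta> scS P s\<^sub>0 by (rule 1)
  interpret B: vacuum_rep \<beta> J \<eta> scS' P' s\<^sub>0' by (rule 2)
  obtain \<phi> where phi: "Vector_Spaces.linear scS scS' \<phi>" "\<And>w. \<phi> (P w s\<^sub>0) = P' w s\<^sub>0'"
    using vacuum_rep_hom[OF 1 2] by blast
  obtain \<theta> where theta: "Vector_Spaces.linear scS' scS \<theta>" "\<And>w. \<theta> (P' w s\<^sub>0') = P w s\<^sub>0"
    using vacuum_rep_hom[OF 2 1] by blast
  interpret AB: vector_space_pair scS scS' ..
  interpret AA: vector_space_pair scS scS ..
  interpret BB: vector_space_pair scS' scS' ..
  interpret phi: Vector_Spaces.linear scS scS' \<phi> by (rule phi(1))
  have "(\<theta> \<circ> \<phi>) s = id s" for s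
    by (rule AA.linear_eq_on[OF Vector_Spaces.linear_compose[OF phi(1) theta(1)] A.linear_id,
          where B = "range (\<lambda>w. P w s\<^sub>0)"]) (auto simp: A.span_orbit A.s0_nonzero phi(2) theta(2))
  moreover have "(\<phi> \<circ> \<theta>) s = id s" for s
    by (rule BB.linear_eq_on[OF Vector_Spaces.linear_compose[OF theta(1) phi(1)] B.linear_id,
          where B = "range (\<lambda>w. P' w s\<^sub>0')"]) (auto simp: B.span_orbit B.s0_nonzero phi(2) theta(2))
  ultimately have "bij \<phi>"
    by (intro o_bij[of \<theta> \<phi>]) (auto simp: fun_eq_iff)
  moreover have "(\<phi> \<circ> P w) s = (P' w \<circ> \<phi>) s" for w s
    by (rule AB.linear_eq_on[OF Vector_Spaces.linear_compose[OF A.linear_P phi(1)]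
            Vector_Spaces.linear_compose[OF phi(1) B.linear_P],
          where B = "range (\<lambda>w. P w s\<^sub>0)"])
      (auto simp: A.span_orbit A.s0_nonzero phi(2) A.P_P B.P_P phi.scale)
  moreover have "\<phi> s\<^sub>0 = s\<^sub>0'" using phi(2)[of 0] by (simp add: A.P_zero B.P_zero)
  ultimately show ?thesis using phi(1) by (auto simp: fun_eq_iff)
qed

section \<open>Existence of vacuum vectors\<close>

context projective_rep
begin

text \<open>The twisted sums over \<open>J/L\<close> of the orbit of an \<open>L\<close>-fixed vector \<open>v\<close> are eigenvectors of \<open>J\<close>.
  They cannot all vanish: the characters \<open>\<beta>(w,-)\<^sup>2\<close> separate the points of \<open>J/L\<close>, so a combination
  of the sums isolates the term of the trivial coset, which is \<open>v\<close>.\<close>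

lemma vacuum_exists:
  assumes L_J: "L \<subseteq> J" and L0: "0 \<in> L" and L_add: "\<And>x y. x \<in> L \<Longrightarrow> y \<in> L \<Longrightarrow> x + y \<in> L"
    and L_uminus: "\<And>x. x \<in> L \<Longrightarrow> - x \<in> L"
    and fin: "finite K" and cover: "\<And>j. j \<in> J \<Longrightarrow> \<exists>k\<in>K. j - k \<in> L"
    and eta_L: "\<And>l. l \<in> L \<Longrightarrow> \<eta> l = 1"
    and sep: "\<And>j. j \<in> J \<Longrightarrow> j \<notin> L \<Longrightarrow> \<exists>w. (\<forall>l\<in>L. (\<beta> w l)\<^sup>2 = 1) \<and> (\<beta> w j)\<^sup>2 \<noteq> 1"
    and v: "v \<noteq> 0" and P_v: "\<And>l. l \<in> L \<Longrightarrow> P l v = v"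
  shows "\<exists>s\<^sub>0. vacuum_rep \<beta> J \<eta> scS P s\<^sub>0"
proof -
  have L_diff: "x - y \<in> L" if "x \<in> L" "y \<in> L" for x y
    using L_add[of x "- y"] L_uminus that by simp
  define r where "r x = (SOME z. z \<in> J \<and> z - x \<in> L)" for x
  have r: "r x \<in> J" "r x - x \<in> L" if "x \<in> J" for x
    using someI[of "\<lambda>z. z \<in> J \<and> z - x \<in> L" x] that L0 unfolding r_def by auto
  have r_cong: "r x = r y" if "x - y \<in> L" for x y
  proof -
    have "z - x \<in> L \<longleftrightarrow> z - y \<in> L" for z
    proof -
      have eq: "z - y - (x - y) = z - x" "z - x + (x - y) = z - y"
        by (simp_all add: algebra_simps)
      show ?thesis
        using L_diff[of "z - y" "x - y", unfolded eq] L_add[of "z - x" "x - y", unfolded eq] that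
        by blast
    qed
    then show ?thesis by (simp add: r_def)
  qed
  define T where "T = r ` J"
  have T_J: "T \<subseteq> J" using r(1) by (auto simp: T_def)
  have r_T: "r t = t" if t: "t \<in> T" for t
  proof -
    obtain x where x: "x \<in> J" "t = r x" using t by (auto simp: T_def)
    then show ?thesis using r_cong[of t x] r(2) by simp
  qed
  have T_eq: "t = t'" if "t \<in> T" "t' \<in> T" "t - t' \<in> L" for t t'
    using r_cong[OF that(3)] r_T that by simp
  \<comment> \<open>The covering set \<open>K\<close> need not lie in \<open>J\<close>, so each
    \<open>k\<close> is first replaced by some element of \<open>J\<close> congruent to it modulo
    \<open>L\<close>.\<close>
  have finT: "finite T"
  proof -
    have "T \<subseteq> (\<lambda>k. r (SOME j. j \<in> J \<and> j - k \<in> L)) ` K"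
    proof
      fix t assume "t \<in> T"
      then have tJ: "t \<in> J" using T_J by auto
      then obtain k where k: "k \<in> K" "t - k \<in> L" using cover by blast
      let ?j = "SOME j. j \<in> J \<and> j - k \<in> L"
      have j: "?j \<in> J \<and> ?j - k \<in> L" by (rule someI[of _ t]) (use k tJ in auto)
      have eq: "t - k - (?j - k) = t - ?j" by simp
      have "t - ?j \<in> L" using L_diff[of "t - k" "?j - k", unfolded eq] j k(2) by blast
      then have "t = r ?j" using r_cong[of t ?j] r_T[OF \<open>t \<in> T\<close>] by simp
      then show "t \<in> (\<lambda>k. r (SOME j. j \<in> J \<and> j - k \<in> L)) ` K" using k(1) by blast
    qed
    then show ?thesis using fin finite_surj by blast
  qed
  \<comment> \<open>The orthogonal of \<open>L\<close>: for \<open>w\<close> in it, the twist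
    \<open>(\<beta> w t)\<^sup>2\<close> depends only on the coset of \<open>t\<close> modulo
    \<open>L\<close>.\<close>
  define Lp where "Lp = {w. \<forall>l\<in>L. (\<beta> w l)\<^sup>2 = 1}"
  have Lp_add: "w + w' \<in> Lp" if "w \<in> Lp" "w' \<in> Lp" for w w'
    using that by (auto simp: Lp_def beta_add_left power_mult_distrib)
  \<comment> \<open>\<open>inverse (\<eta> t)\<close> times \<open>P t\<close> is the genuine action
    of \<open>J\<close>; the remaining factor inserts the character attached to \<open>w\<close>. By
    \<open>f_inv\<close> the terms are constant on cosets of \<open>L\<close>, so the sum over
    representatives is a sum over \<open>J/L\<close>.\<close>
  define f where "f w t = scS (inverse (\<eta> t) * (\<beta> w t)\<^sup>2) (P t v)" for w t
  define E where "E w = (\<Sum>t\<in>T. f w t)" for w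
  have f_inv: "f w (j + l) = f w j" if "w \<in> Lp" "j \<in> J" "l \<in> L" for w j l
  proof -
    have "\<eta> j = \<beta> j l * \<eta> (j + l)"
      using eta_mult[of j l] that L_J eta_L by auto
    then have "inverse (\<eta> (j + l)) = \<beta> j l * inverse (\<eta> j)"
      using eta_nonzero[of "j + l"] eta_nonzero[of j] beta_nonzero[of j l] by (simp add: field_simps)
    moreover have "(\<beta> w l)\<^sup>2 = 1" using that by (auto simp: Lp_def)
    ultimately show ?thesis
      using that by (simp add: f_def P_plus_arg P_v beta_add_right power_mult_distrib beta_nonzero)
  qed
  have P_f: "P j (f w k) = scS (\<eta> j * inverse ((\<beta> w j)\<^sup>2)) (f w (k + j))" if "j \<in> J" "k \<in> J" for j k w
  proof -
    have "inverse (\<eta> k) * \<beta> j k = \<eta> j * inverse (\<eta> (k + j))"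
      using eta_mult[OF that] eta_nonzero[of k] eta_nonzero[of "k + j"]
      by (simp add: field_simps add.commute)
    then have "inverse (\<eta> k) * (\<beta> w k)\<^sup>2 * \<beta> j k = (\<beta> w k)\<^sup>2 * (\<eta> j * inverse (\<eta> (k + j)))"
      by (simp add: mult_ac)
    moreover have "(\<beta> w k)\<^sup>2 = inverse ((\<beta> w j)\<^sup>2) * (\<beta> w (k + j))\<^sup>2"
      using beta_nonzero[of w j] by (simp add: beta_add_right power_mult_distrib)
    ultimately show ?thesis
      by (simp add: f_def P_scale P_P add.commute mult_ac)
  qed
  \<comment> \<open>\<open>P j\<close> permutes the cosets \<open>J/L\<close>, so it reproduces the
    sum up to the scalar in \<open>P_f\<close>. Passing from \<open>t + j\<close> to its
    representative is where \<open>f_inv\<close> enters.\<close>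
  have P_E: "P j (E w) = scS (\<eta> j * inverse ((\<beta> w j)\<^sup>2)) (E w)" if "w \<in> Lp" "j \<in> J" for w j
  proof -
    have inj: "inj_on (\<lambda>t. r (t + j)) T"
    proof (rule inj_onI)
      fix t t' assume t: "t \<in> T" "t' \<in> T" "r (t + j) = r (t' + j)"
      have "t + j \<in> J" "t' + j \<in> J" using t T_J that(2) J_add by auto
      then have "(r (t' + j) - (t' + j)) - (r (t + j) - (t + j)) \<in> L"
        using r(2) L_diff by blast
      then have "t - t' \<in> L" using t(3) by simp
      then show "t = t'" using T_eq t by blast
    qed
    have maps: "(\<lambda>t. r (t + j)) ` T \<subseteq> T"
      using T_J J_add that(2) by (auto simp: T_def)
    then have bij: "bij_betw (\<lambda>t. r (t + j)) T T"
      using inj endo_inj_surj[OF finT maps inj] by (auto simp: bij_betw_def)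
    have "P j (E w) = scS (\<eta> j * inverse ((\<beta> w j)\<^sup>2)) (\<Sum>t\<in>T. f w (t + j))"
      unfolding E_def P_sum scale_sum_right
      by (rule sum.cong) (use P_f that T_J in auto)
    also have "(\<Sum>t\<in>T. f w (t + j)) = (\<Sum>t\<in>T. f w (r (t + j)))"
    proof (rule sum.cong[OF refl])
      fix t assume "t \<in> T"
      then have tj: "t + j \<in> J" using T_J J_add that(2) by auto
      show "f w (t + j) = f w (r (t + j))"
        using f_inv[OF that(1) tj r(2)[OF tj]] by simp
    qed
    also have "\<dots> = E w"
      unfolding E_def by (rule sum.reindex_bij_betw[OF bij])
    finally show ?thesis .
  qed
  have "\<exists>w\<in>Lp. E w \<noteq> 0"
  proof (rule ccontr)
    assume "\<not> ?thesis"
    then have E0: "E w = 0" if "w \<in> Lp" for w using that by auto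
    \<comment> \<open>The points of \<open>B\<close> are killed one at a time while the coefficients
      on \<open>L\<close> stay nonzero. The relation is kept for all \<open>w\<close> in
      \<open>Lp\<close> at once because each step uses it at \<open>w\<close> and at
      \<open>u + w\<close>.\<close>
    have "\<exists>d. (\<forall>a\<in>B. d a = 0) \<and> (\<forall>t\<in>L. d t \<noteq> 0) \<and>
        (\<forall>w\<in>Lp. (\<Sum>t\<in>T. scS (d t) (f w t)) = 0)" if "finite B" "B \<subseteq> J - L" for B
      using that
    proof (induction B rule: finite_induct)
      case empty
      show ?case by (rule exI[of _ "\<lambda>_. 1"]) (use E0 in \<open>auto simp: E_def\<close>)
    next
      case (insert b B)
      then obtain d where d: "\<forall>a\<in>B. d a = 0" "\<forall>t\<in>L. d t \<noteq> 0"
        "\<And>w. w \<in> Lp \<Longrightarrow> (\<Sum>t\<in>T. scS (d t) (f w t)) = 0"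
        by auto
      obtain u where u: "u \<in> Lp" "(\<beta> u b)\<^sup>2 \<noteq> 1"
        using sep[of b] insert.prems by (auto simp: Lp_def)
      have "(\<Sum>t\<in>T. scS (d t * ((\<beta> u t)\<^sup>2 - (\<beta> u b)\<^sup>2)) (f w t)) = 0" if "w \<in> Lp" for w
      proof -
        \<comment> \<open>Multiplying the coefficients by \<open>(\<beta> u t)\<^sup>2\<close>
          amounts to shifting \<open>w\<close> by \<open>u\<close>, which preserves the relation.
          Subtracting \<open>(\<beta> u b)\<^sup>2\<close> times the relation yields a factor that
          vanishes at \<open>b\<close> and equals \<open>1 - (\<beta> u b)\<^sup>2\<close> on
          \<open>L\<close>.\<close>
        have "scS (d t * (\<beta> u t)\<^sup>2) (f w t) = scS (d t) (f (u + w) t)" for t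
          by (simp add: f_def beta_add_left power_mult_distrib mult_ac)
        then have "(\<Sum>t\<in>T. scS (d t * (\<beta> u t)\<^sup>2) (f w t)) = 0"
          using d(3)[of "u + w"] Lp_add[OF u(1) that] by simp
        moreover have "(\<Sum>t\<in>T. scS (d t * (\<beta> u b)\<^sup>2) (f w t)) = scS ((\<beta> u b)\<^sup>2) (\<Sum>t\<in>T. scS (d t) (f w t))"
          by (simp add: scale_sum_right mult.commute)
        ultimately show ?thesis
          using d(3)[OF that] by (simp add: right_diff_distrib scale_left_diff_distrib sum_subtractf)
      qed
      moreover have "d t * ((\<beta> u t)\<^sup>2 - (\<beta> u b)\<^sup>2) \<noteq> 0" if "t \<in> L" for t
        using d(2) u that by (auto simp: Lp_def)
      ultimately show ?case
        using d(1) by (intro exI[of _ "\<lambda>t. d t * ((\<beta> u t)\<^sup>2 - (\<beta> u b)\<^sup>2)"]) auto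
    qed
    from this[of "T - L"] obtain d where d: "\<forall>a\<in>T - L. d a = 0" "\<forall>t\<in>L. d t \<noteq> 0"
      "\<forall>w\<in>Lp. (\<Sum>t\<in>T. scS (d t) (f w t)) = 0"
      using finT T_J by (metis Diff_mono finite_Diff subset_refl)
    define t\<^sub>0 where "t\<^sub>0 = r 0"
    \<comment> \<open>The representative of the trivial coset need not be 0, but it lies in
      \<open>L\<close>, where \<open>\<eta>\<close> is 1 and \<open>v\<close> is fixed.\<close>
    have t0: "t\<^sub>0 \<in> T" "t\<^sub>0 \<in> L" using r(2)[OF J_zero] J_zero by (auto simp: t\<^sub>0_def T_def)
    have "(\<Sum>t\<in>T. scS (d t) (f 0 t)) = (\<Sum>t\<in>{t\<^sub>0}. scS (d t) (f 0 t))"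
    proof (rule sum.mono_neutral_right[OF finT])
      show "\<forall>t\<in>T - {t\<^sub>0}. scS (d t) (f 0 t) = 0"
      proof
        fix t assume t: "t \<in> T - {t\<^sub>0}"
        then have "t \<notin> L" using T_eq[of t t\<^sub>0] t0 L_diff by blast
        then show "scS (d t) (f 0 t) = 0" using d(1) t by simp
      qed
    qed (use t0 in auto)
    moreover have "0 \<in> Lp" by (auto simp: Lp_def beta_zero_left)
    ultimately have "scS (d t\<^sub>0) (f 0 t\<^sub>0) = 0" using d(3) by simp
    moreover have "f 0 t\<^sub>0 = v"
      using t0 by (simp add: f_def beta_zero_left eta_L P_v)
    ultimately show False using d(2) t0 v by simp
  qed
  then obtain w where w: "w \<in> Lp" "E w \<noteq> 0" by auto
  \<comment> \<open>\<open>E w\<close> is an eigenvector for \<open>\<eta>\<close> divided by the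
    twist of \<open>w\<close>; translating by \<open>- w\<close> undoes the twist.\<close>
  have "vacuum_rep \<beta> J \<eta> scS P (P (- w) (E w))"
  proof
    show "P (- w) (E w) \<noteq> 0" using w by (simp add: P_eq_0_iff)
    fix j assume j: "j \<in> J"
    have "(\<beta> j (- w))\<^sup>2 = (\<beta> w j)\<^sup>2"
      by (simp add: beta_swap[of j w] beta_uminus_right)
    then show "P j (P (- w) (E w)) = scS (\<eta> j) (P (- w) (E w))"
      using w j by (simp add: P_swap[of j "- w"] P_E P_scale beta_nonzero)
  qed
  then show ?thesis ..
qed

end

section \<open>Ultrametric fields and symplectic bases\<close>

text \<open>Local compactness enters only in the form of totally bounded balls. This gives the
  finiteness of \<open>J/L\<close> and the existence of the element \<open>a\<close>.\<close>

locale ultrametric_field =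
  fixes v :: "'f::field \<Rightarrow> real"
  assumes v_nonneg: "0 \<le> v x" and v_eq_0_iff: "v x = 0 \<longleftrightarrow> x = 0"
    and v_mult: "v (x * y) = v x * v y" and v_add: "v (x + y) \<le> max (v x) (v y)"
    and totally_bounded: "r > 0 \<Longrightarrow> \<exists>K. finite K \<and> (\<forall>x. v x \<le> R \<longrightarrow> (\<exists>k\<in>K. v (x - k) < r))"
begin

lemma v_zero: "v 0 = 0" by (simp add: v_eq_0_iff)

lemma v_pos: "x \<noteq> 0 \<Longrightarrow> v x > 0"
  using v_nonneg[of x] v_eq_0_iff[of x] by simp

lemma v_one: "v 1 = 1"
  using v_mult[of 1 1] v_eq_0_iff[of 1] by simp

lemma v_uminus: "v (- x) = v x"
proof -
  have "v (- 1) * v (- 1) = 1" by (simp add: v_mult[symmetric] v_one)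
  then have "v (- 1) = 1"
    using v_nonneg[of "- 1"] by (simp add: square_eq_1_iff)
  then show ?thesis using v_mult[of "- 1" x] by simp
qed

lemma v_diff: "v (x - y) \<le> max (v x) (v y)"
  using v_add[of x "- y"] by (simp add: v_uminus)

lemma v_swap: "v (x - y) = v (y - x)"
  using v_uminus[of "x - y"] by simp

lemma v_divide: "v (x / y) = v x / v y"
proof (cases "y = 0")
  case False
  then have "v (x / y) * v y = v x" by (simp add: v_mult[symmetric])
  then show ?thesis using v_pos[OF False] by (simp add: field_simps)
qed (simp add: v_zero)

lemma v_add_less: "v x < r \<Longrightarrow> v y < r \<Longrightarrow> v (x + y) < r"
  using v_add[of x y] by simp

lemma v_diff_less: "v x < r \<Longrightarrow> v y < r \<Longrightarrow> v (x - y) < r"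
  using v_diff[of x y] by simp

lemma v_sum_less: "r > 0 \<Longrightarrow> (\<And>i. i \<in> I \<Longrightarrow> v (g i) < r) \<Longrightarrow> v (\<Sum>i\<in>I. g i) < r"
  by (induction I rule: infinite_finite_induct) (auto simp: v_zero intro: v_add_less)

lemma v_mult_less:
  assumes "v x \<le> r" "v y < s"  "r > 0"
  shows "v (x * y) < r * s"
proof -
  have "v x * v y \<le> r * v y" using assms v_nonneg by (simp add: mult_right_mono)
  also have "\<dots> < r * s" using assms by simp
  finally show ?thesis by (simp add: v_mult)
qed

sublocale metric: Metric_space UNIV "\<lambda>x y. v (x - y)"
proof
  fix x y z :: 'f
  show "v (x - z) \<le> v (x - y) + v (y - z)"
    using v_add[of "x - y" "y - z"] v_nonneg[of "x - y"] v_nonneg[of "y - z"] by simp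
qed (auto simp: v_nonneg v_eq_0_iff v_swap)

lemma openin_v: "openin (absolute_value_topology v) U \<longleftrightarrow> (\<forall>x\<in>U. \<exists>r>0. \<forall>y. v (y - x) < r \<longrightarrow> y \<in> U)"
  by (force simp: absolute_value_topology_def metric.openin_mtopology metric.mball_def v_swap subset_iff)

lemma topspace_v [simp]: "topspace (absolute_value_topology v) = UNIV"
  by (simp add: absolute_value_topology_def)

lemma continuous_map_v:
  "continuous_map X (absolute_value_topology v) g \<longleftrightarrow>
    (\<forall>x\<in>topspace X. \<forall>r>0. \<exists>U. openin X U \<and> x \<in> U \<and> (\<forall>y\<in>U. v (g y - g x) < r))"
  by (simp add: absolute_value_topology_def metric.continuous_map_to_metric v_swap)

lemma continuous_map_v_add:
  assumes "continuous_map X (absolute_value_topology v) g" "continuous_map X (absolute_value_topology v) h"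
  shows "continuous_map X (absolute_value_topology v) (\<lambda>x. g x + h x)"
  unfolding continuous_map_v
proof (intro ballI allI impI)
  fix x r assume "x \<in> topspace X" "(r::real) > 0"
  then obtain U V where "openin X U" "x \<in> U" "\<forall>y\<in>U. v (g y - g x) < r"
      "openin X V" "x \<in> V" "\<forall>y\<in>V. v (h y - h x) < r"
    using assms unfolding continuous_map_v by metis
  then show "\<exists>U. openin X U \<and> x \<in> U \<and> (\<forall>y\<in>U. v (g y + h y - (g x + h x)) < r)"
    by (intro exI[of _ "U \<inter> V"]) (auto simp: add_diff_add intro: v_add_less)
qed

lemma continuous_map_v_mult:
  assumes "continuous_map X (absolute_value_topology v) g" "continuous_map X (absolute_value_topology v) h"
  shows "continuous_map X (absolute_value_topology v) (\<lambda>x. g x * h x)"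
  unfolding continuous_map_v
proof (intro ballI allI impI)
  fix x r assume x: "x \<in> topspace X" "(r::real) > 0"
  \<comment> \<open>The increment of the product is the product of the increments plus two mixed
    terms. \<open>s \<le> 1\<close> bounds the first, and the denominator absorbs the factors
    \<open>g x\<close> and \<open>h x\<close> of the other two.\<close>
  define s where "s = min 1 r / (1 + v (g x) + v (h x))"
  have c: "1 + v (g x) + v (h x) \<ge> 1" using v_nonneg[of "g x"] v_nonneg[of "h x"] by simp
  have s: "s > 0" "s * (1 + v (g x) + v (h x)) \<le> r" "s \<le> 1"
    using x(2) c by (auto simp: s_def divide_le_eq)
  obtain U V where UV: "openin X U" "x \<in> U" "\<forall>y\<in>U. v (g y - g x) < s"
      "openin X V" "x \<in> V" "\<forall>y\<in>V. v (h y - h x) < s"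
    using assms x(1) s(1) unfolding continuous_map_v by metis
  have "v (g y * h y - g x * h x) < r" if y: "y \<in> U" "y \<in> V" for y
  proof -
    have "0 \<le> s * v (g x)" "0 \<le> s * v (h x)" "s + s * v (g x) + s * v (h x) \<le> r"
      using s v_nonneg[of "g x"] v_nonneg[of "h x"] by (simp_all add: distrib_left)
    then have "s * (1 + v (g x)) \<le> r" "s * (1 + v (h x)) \<le> r" "s * 1 \<le> r"
      by (simp_all add: distrib_left)
    moreover have "v ((g y - g x) * (h y - h x)) < 1 * s"
      by (rule v_mult_less) (use UV y s in force)+
    moreover have "v (g x * (h y - h x)) < (1 + v (g x)) * s"
      by (rule v_mult_less) (use UV y s v_nonneg[of "g x"] in auto)
    moreover have "v (h x * (g y - g x)) < (1 + v (h x)) * s"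
      by (rule v_mult_less) (use UV y s v_nonneg[of "h x"] in auto)
    ultimately have "v ((g y - g x) * (h y - h x)) < r" "v (g x * (h y - h x)) < r"
        "v (h x * (g y - g x)) < r"
      by (simp_all add: mult.commute)
    then have "v ((g y - g x) * (h y - h x) + (g x * (h y - h x) + h x * (g y - g x))) < r"
      by (intro v_add_less)
    then show ?thesis by (simp add: algebra_simps)
  qed
  then show "\<exists>U. openin X U \<and> x \<in> U \<and> (\<forall>y\<in>U. v (g y * h y - g x * h x) < r)"
    using UV by (intro exI[of _ "U \<inter> V"]) auto
qed

lemma continuous_map_v_const [simp]: "continuous_map X (absolute_value_topology v) (\<lambda>x. c)"
  by simp

lemma continuous_map_v_sum:
  "(\<And>i. i \<in> I \<Longrightarrow> continuous_map X (absolute_value_topology v) (g i)) \<Longrightarrow>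
    continuous_map X (absolute_value_topology v) (\<lambda>x. \<Sum>i\<in>I. g i x)"
  by (induction I rule: infinite_finite_induct) (auto intro: continuous_map_v_add)

text \<open>A minimum exists because only finitely many absolute values compete. An \<open>x\<close>
  with \<open>\<psi> x \<noteq> 1\<close> has \<open>v x \<ge> r\<close>, with \<open>r\<close> the
  radius of a ball on which \<open>\<psi>\<close> is 1, so any \<open>k\<close> closer to
  \<open>x\<close> than \<open>r\<close> has the same absolute value; finitely many such
  \<open>k\<close> suffice in the ball of radius \<open>v t\<close>.\<close>

lemma conductor:
  assumes add: "\<And>x y. \<psi> (x + y) = \<psi> x * (\<psi> y :: 'r::field)" and nz: "\<And>x. \<psi> x \<noteq> 0"
    and smooth: "openin (absolute_value_topology v) {x. \<psi> x = 1}" and nontriv: "\<psi> t \<noteq> 1"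
  obtains a where "\<psi> a \<noteq> 1" "\<And>x. v x < v a \<Longrightarrow> \<psi> x = 1"
proof -
  have "\<psi> 0 = 1" using add[of 0 0] nz[of 0] by simp
  then obtain r where r: "r > 0" "\<And>y. v y < r \<Longrightarrow> \<psi> y = 1"
    using smooth unfolding openin_v by force
  obtain K where K: "finite K" "\<And>x. v x \<le> v t \<Longrightarrow> \<exists>k\<in>K. v (x - k) < r"
    using totally_bounded[OF r(1), of "v t"] by blast
  define A where "A = {v x |x. \<psi> x \<noteq> 1 \<and> v x \<le> v t}"
  have "A \<subseteq> v ` K"
  proof
    fix y assume "y \<in> A"
    then obtain x where x: "y = v x" "\<psi> x \<noteq> 1" "v x \<le> v t" by (auto simp: A_def)
    obtain k where k: "k \<in> K" "v (x - k) < r" using K(2)[OF x(3)] by auto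
    have "v x \<ge> r" using r(2)[of x] x(2) by force
    moreover have "v x \<le> max (v (x - k)) (v k)" using v_add[of "x - k" k] by simp
    moreover have "v k \<le> max (v (x - k)) (v x)" using v_diff[of x "x - k"] by simp
    ultimately have "v k = v x" using k(2) by (simp add: max_def split: if_splits)
    then have "y = v k" using x(1) by simp
    then show "y \<in> v ` K" using k(1) by blast
  qed
  then have "finite A" using K(1) finite_surj by blast
  moreover have "v t \<in> A" using nontriv by (auto simp: A_def)
  ultimately have M: "Min A \<in> A" "\<And>y. y \<in> A \<Longrightarrow> Min A \<le> y"
    by (auto intro: Min_in)
  obtain a where a: "Min A = v a" "\<psi> a \<noteq> 1" "v a \<le> v t" using M(1) by (auto simp: A_def)
  have "\<psi> x = 1" if "v x < v a" for x
  proof (rule ccontr)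
    assume "\<psi> x \<noteq> 1"
    then have "v x \<in> A" using that a(3) by (auto simp: A_def)
    then show False using M(2) a(1) that by force
  qed
  then show ?thesis using that a by blast
qed

end

text \<open>A finite field is treated as a local field with the trivial absolute value.\<close>

lemma finite_or_nonarch_local_field_ultrametric:
  fixes TF :: "'f::field topology"
  assumes "finite_or_nonarch_local_field TF p"
  obtains v where "ultrametric_field v" "TF = absolute_value_topology v"
proof -
  consider "finite (UNIV :: 'f set)" "TF = discrete_topology UNIV"
    | v where "nonarch_absolute_value v" "TF = absolute_value_topology v" "locally_compact_space TF"
    using assms unfolding finite_or_nonarch_local_field_def by blast
  then show ?thesis
  proof cases
    case 1
    define v :: "'f \<Rightarrow> real" where "v x = (if x = 0 then 0 else 1)" for x
    have u: "ultrametric_field v"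
    proof
      fix r R :: real assume "r > 0"
      then show "\<exists>K. finite K \<and> (\<forall>x. v x \<le> R \<longrightarrow> (\<exists>k\<in>K. v (x - k) < r))"
        using 1(1) by (intro exI[of _ UNIV] conjI allI impI) (auto simp: v_def intro!: exI)
    qed (auto simp: v_def)
    interpret ultrametric_field v by (rule u)
    have "openin (absolute_value_topology v) U" for U
      unfolding openin_v by (intro ballI exI[of _ 1]) (auto simp: v_def)
    then have "TF = absolute_value_topology v"
      using 1(2) by (auto simp: topology_eq)
    then show ?thesis using that u by blast
  next
    case (2 v)
    have v: "0 \<le> v x" "v x = 0 \<longleftrightarrow> x = 0" "v (x * y) = v x * v y" "v (x + y) \<le> max (v x) (v y)" for x y
      using 2(1) by (auto simp: nonarch_absolute_value_def)
    obtain u where u: "u \<noteq> 0" "v u \<noteq> 1" using 2(1) by (auto simp: nonarch_absolute_value_def)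
    have v1: "v 1 = 1" using v(3)[of 1 1] v(2)[of 1] by simp
    have vm: "v (- x) = v x" for x
    proof -
      have "v (- 1) * v (- 1) = 1" by (simp add: v(3)[symmetric] v1)
      then have "v (- 1) = 1" using v(1)[of "- 1"] by (simp add: square_eq_1_iff)
      then show ?thesis using v(3)[of "- 1" x] by simp
    qed
    interpret M: Metric_space UNIV "\<lambda>x y. v (x - y)"
    proof
      fix x y z :: 'f
      show "v (x - y) = v (y - x)" using vm[of "x - y"] by simp
      show "v (x - z) \<le> v (x - y) + v (y - z)"
        using v(4)[of "x - y" "y - z"] v(1)[of "x - y"] v(1)[of "y - z"] by simp
    qed (auto simp: v(1,2))
    have TF: "TF = M.mtopology" by (simp add: 2(2) absolute_value_topology_def)
    \<comment> \<open>Since \<open>v u \<noteq> 1\<close>, either \<open>u\<close> or its inverse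
      has absolute value above 1, and its powers are unbounded.\<close>
    have large: "\<exists>c. v c > N" for N
    proof -
      obtain w where w: "v w > 1"
      proof (cases "v u > 1")
        case False
        have "v u * v (1 / u) = 1" using u(1) by (simp add: v(3)[symmetric] v1)
        moreover have "v u < 1" "v u \<ge> 0" using False u v(1)[of u] by auto
        ultimately have "v (1 / u) > 1" using mult_left_le[of "v (1 / u)" "v u"] by linarith
        then show ?thesis using that by blast
      qed (use that in auto)
      have "v (w ^ k) = v w ^ k" for k by (induction k) (auto simp: v v1)
      then show ?thesis using real_arch_pow[OF w, of N] by metis
    qed
    obtain U C where UC: "openin TF U" "compactin TF C" "0 \<in> U" "U \<subseteq> C"
    proof -
      have "0 \<in> topspace TF" by (simp add: TF)
      then show ?thesis using 2(3) that unfolding locally_compact_space_def by blast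
    qed
    obtain \<epsilon> where eps: "\<epsilon> > 0" "\<And>x. v x < \<epsilon> \<Longrightarrow> x \<in> C"
      using UC unfolding TF M.openin_mtopology M.mball_def by (auto simp: vm subset_iff)
    have "ultrametric_field v"
    proof
      fix r R :: real assume r: "r > 0"
      \<comment> \<open>Division by \<open>c\<close> carries the ball of radius \<open>R\<close>
        into the compact neighbourhood of 0. A finite net there, of mesh \<open>r / v c\<close>, is
        then multiplied by \<open>c\<close>.\<close>
      obtain c where c: "v c > R / \<epsilon>" "c \<noteq> 0"
      proof -
        obtain c where "v c > max 0 (R / \<epsilon>)" using large by blast
        then show ?thesis using that[of c] v(2)[of c] by auto
      qed
      have vc: "v c > 0" using c(2) v(1)[of c] v(2)[of c] by simp
      obtain K where K: "finite K" "K \<subseteq> C" "C \<subseteq> (\<Union>x\<in>K. M.mball x (r / v c))"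
        using UC(2) r vc unfolding TF
        by (metis M.compactin_imp_mtotally_bounded M.mtotally_bounded_def divide_pos_pos)
      show "\<exists>K. finite K \<and> (\<forall>x. v x \<le> R \<longrightarrow> (\<exists>k\<in>K. v (x - k) < r))"
      proof (intro exI[of _ "(*) c ` K"] conjI allI impI)
        fix x assume x: "v x \<le> R"
        have xc: "x = c * (x / c)" using c(2) by simp
        have vx: "v x = v c * v (x / c)" by (metis xc v(3))
        have "R < v c * \<epsilon>" using c(1) eps(1) by (simp add: field_simps)
        then have "v c * v (x / c) < v c * \<epsilon>" using x vx by simp
        then have "x / c \<in> C" using vc eps(2) by simp
        then obtain k where k: "k \<in> K" "v (k - x / c) < r / v c" using K(3) by (auto simp: M.mball_def)
        have "v (x - c * k) = v (c * (k - x / c))"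
          using vm[of "x - c * k"] c(2) by (simp add: algebra_simps)
        also have "\<dots> < r" using k(2) vc unfolding v(3) by (simp add: pos_less_divide_eq mult.commute)
        finally show "\<exists>k\<in>(*) c ` K. v (x - k) < r" using k(1) by blast
      qed (use K in auto)
    qed (use v in auto)
    then show ?thesis using that 2(2) by blast
  qed
qed

section \<open>Symplectic bases\<close>

locale symplectic = vector_space scW
  for scW :: "'f::field \<Rightarrow> 'w::ab_group_add \<Rightarrow> 'w" +
  fixes \<omega> :: "'w \<Rightarrow> 'w \<Rightarrow> 'f"
  assumes linear_left: "Vector_Spaces.linear scW (*) (\<lambda>x. \<omega> x w)"
    and linear_right: "Vector_Spaces.linear scW (*) (\<lambda>x. \<omega> w x)"
    and alt: "\<omega> w w = 0"
begin

lemma omega_add_left: "\<omega> (x + y) w = \<omega> x w + \<omega> y w"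
  and omega_scale_left: "\<omega> (scW c x) w = c * \<omega> x w"
  and omega_diff_left: "\<omega> (x - y) w = \<omega> x w - \<omega> y w"
  and omega_uminus_left: "\<omega> (- x) w = - \<omega> x w"
  and omega_zero_left: "\<omega> 0 w = 0"
  and omega_sum_left: "\<omega> (\<Sum>i\<in>I. g i) w = (\<Sum>i\<in>I. \<omega> (g i) w)"
proof -
  interpret Vector_Spaces.linear scW "(*)" "\<lambda>x. \<omega> x w" by (rule linear_left)
  show "\<omega> (x + y) w = \<omega> x w + \<omega> y w" "\<omega> (scW c x) w = c * \<omega> x w"
    "\<omega> (x - y) w = \<omega> x w - \<omega> y w" "\<omega> (- x) w = - \<omega> x w" "\<omega> 0 w = 0"
    "\<omega> (\<Sum>i\<in>I. g i) w = (\<Sum>i\<in>I. \<omega> (g i) w)"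
    by (rule add scale diff neg zero sum)+
qed

lemma omega_add_right: "\<omega> w (x + y) = \<omega> w x + \<omega> w y"
  and omega_scale_right: "\<omega> w (scW c x) = c * \<omega> w x"
  and omega_diff_right: "\<omega> w (x - y) = \<omega> w x - \<omega> w y"
  and omega_sum_right: "\<omega> w (\<Sum>i\<in>I. g i) = (\<Sum>i\<in>I. \<omega> w (g i))"
proof -
  interpret Vector_Spaces.linear scW "(*)" "\<lambda>x. \<omega> w x" by (rule linear_right)
  show "\<omega> w (x + y) = \<omega> w x + \<omega> w y" "\<omega> w (scW c x) = c * \<omega> w x"
    "\<omega> w (x - y) = \<omega> w x - \<omega> w y" "\<omega> w (\<Sum>i\<in>I. g i) = (\<Sum>i\<in>I. \<omega> w (g i))"
    by (rule add scale diff sum)+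
qed

lemma omega_swap: "\<omega> y x = - \<omega> x y"
proof -
  have "\<omega> y x + \<omega> x y = 0"
  proof -
    have "\<omega> (x + y) (x + y) = \<omega> y x + \<omega> x y"
      unfolding omega_add_left omega_add_right by (simp add: alt)
    then show ?thesis by (simp add: alt)
  qed
  then show ?thesis by (simp add: eq_neg_iff_add_eq_0)
qed

definition symplectic_family :: "nat \<Rightarrow> (nat \<Rightarrow> 'w) \<Rightarrow> (nat \<Rightarrow> 'w) \<Rightarrow> bool" where
  "symplectic_family n e f \<longleftrightarrow> (\<forall>i<n. \<forall>j<n. \<omega> (e i) (f j) = (if i = j then 1 else 0) \<and>
     \<omega> (e i) (e j) = 0 \<and> \<omega> (f i) (f j) = 0)"

text \<open>For a symplectic family this is the projection onto its span along the orthogonal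
  complement of that span.\<close>

definition family_proj :: "nat \<Rightarrow> (nat \<Rightarrow> 'w) \<Rightarrow> (nat \<Rightarrow> 'w) \<Rightarrow> 'w \<Rightarrow> 'w" where
  "family_proj n e f w = (\<Sum>i<n. scW (\<omega> w (f i)) (e i) + scW (\<omega> (e i) w) (f i))"

lemma family_proj_omega:
  assumes "symplectic_family n e f" "j < n"
  shows "\<omega> (family_proj n e f w) (f j) = \<omega> w (f j)" "\<omega> (e j) (family_proj n e f w) = \<omega> (e j) w"
proof -
  have "\<omega> (family_proj n e f w) (f j) = (\<Sum>i<n. if i = j then \<omega> w (f j) else 0)"
    unfolding family_proj_def omega_sum_left omega_add_left omega_scale_left
    by (rule sum.cong) (use assms in \<open>auto simp: symplectic_family_def\<close>)
  then show "\<omega> (family_proj n e f w) (f j) = \<omega> w (f j)" using assms(2) by simp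
  have "\<omega> (e j) (family_proj n e f w) = (\<Sum>i<n. if i = j then \<omega> (e j) w else 0)"
    unfolding family_proj_def omega_sum_right omega_add_right omega_scale_right
    by (rule sum.cong) (use assms in \<open>auto simp: symplectic_family_def\<close>)
  then show "\<omega> (e j) (family_proj n e f w) = \<omega> (e j) w" using assms(2) by simp
qed

lemma family_proj_orthogonal:
  assumes "\<And>i. i < n \<Longrightarrow> \<omega> (e i) u = 0" "\<And>i. i < n \<Longrightarrow> \<omega> u (f i) = 0"
  shows "\<omega> u (family_proj n e f w) = 0" "\<omega> (family_proj n e f w) u = 0"
proof -
  have "\<omega> u (e i) = 0" if "i < n" for i
    using assms(1)[OF that] omega_swap[of u "e i"] by simp
  then show "\<omega> u (family_proj n e f w) = 0"
    using assms(2) by (simp add: family_proj_def omega_sum_right omega_add_right omega_scale_right)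
  then show "\<omega> (family_proj n e f w) u = 0"
    using omega_swap[of "family_proj n e f w" u] by simp
qed

text \<open>Symplectic Gram-Schmidt along a finite set. If the projection misses \<open>b\<close>,
  the residue of \<open>b\<close> and a suitable partner are adjoined as a new hyperbolic pair. This
  pair is orthogonal to the old span, so vectors already fixed by the projection remain
  fixed.\<close>

lemma symplectic_family_extend:
  assumes nondeg: "\<And>w. (\<And>x. \<omega> w x = 0) \<Longrightarrow> w = 0" and "finite B"
  shows "\<exists>n e f. symplectic_family n e f \<and> (\<forall>b\<in>B. family_proj n e f b = b)"
  using assms(2)
proof (induction B rule: finite_induct)
  case empty
  show ?case by (rule exI[of _ 0]) (simp add: symplectic_family_def)
next
  case (insert b B)
  then obtain n e f where F: "symplectic_family n e f" and B: "\<And>b. b \<in> B \<Longrightarrow> family_proj n e f b = b"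
    by auto
  let ?p = "family_proj n e f"
  define w\<^sub>0 where "w\<^sub>0 = b - ?p b"
  show ?case
  proof (cases "w\<^sub>0 = 0")
    case True
    then have "\<forall>b\<in>insert b B. ?p b = b" using B by (auto simp: w\<^sub>0_def)
    then show ?thesis using F by blast
  next
    case False
    \<comment> \<open>Nondegeneracy supplies a partner. Scaling makes its pairing with
      \<open>w\<^sub>0\<close> equal to 1, and removing its projection does not change the pairing
      because \<open>w\<^sub>0\<close> is orthogonal to the family.\<close>
    then obtain x where x: "\<omega> w\<^sub>0 x \<noteq> 0" using nondeg by blast
    define x\<^sub>1 where "x\<^sub>1 = scW (1 / \<omega> w\<^sub>0 x) x"
    define w\<^sub>1 where "w\<^sub>1 = x\<^sub>1 - ?p x\<^sub>1"
    have o0: "\<omega> (e i) w\<^sub>0 = 0" "\<omega> w\<^sub>0 (f i) = 0" if "i < n" for i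
      using family_proj_omega[OF F that] by (simp_all add: w\<^sub>0_def omega_diff_left omega_diff_right)
    have o1: "\<omega> (e i) w\<^sub>1 = 0" "\<omega> w\<^sub>1 (f i) = 0" if "i < n" for i
      using family_proj_omega[OF F that] by (simp_all add: w\<^sub>1_def omega_diff_left omega_diff_right)
    have o0': "\<omega> w\<^sub>0 (e i) = 0" "\<omega> (f i) w\<^sub>0 = 0" if "i < n" for i
      using o0[OF that] omega_swap[of w\<^sub>0 "e i"] omega_swap[of "f i" w\<^sub>0] by auto
    have o1': "\<omega> w\<^sub>1 (e i) = 0" "\<omega> (f i) w\<^sub>1 = 0" if "i < n" for i
      using o1[OF that] omega_swap[of w\<^sub>1 "e i"] omega_swap[of "f i" w\<^sub>1] by auto
    note p0 = family_proj_orthogonal[of n e w\<^sub>0 f, OF o0]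
    note p1 = family_proj_orthogonal[of n e w\<^sub>1 f, OF o1]
    have w01: "\<omega> w\<^sub>0 w\<^sub>1 = 1"
      using x p0 by (simp add: w\<^sub>1_def omega_diff_right x\<^sub>1_def omega_scale_right)
    let ?e = "e(n := w\<^sub>0)" and ?f = "f(n := w\<^sub>1)"
    have "symplectic_family (Suc n) ?e ?f"
      using F o0 o1 o0' o1' w01 by (auto simp: symplectic_family_def less_Suc_eq alt)
    moreover have p': "family_proj (Suc n) ?e ?f w = ?p w + (scW (\<omega> w w\<^sub>1) w\<^sub>0 + scW (\<omega> w\<^sub>0 w) w\<^sub>1)" for w
      by (simp add: family_proj_def)
    have "family_proj (Suc n) ?e ?f b = b"
    proof -
      have "b = ?p b + w\<^sub>0" by (simp add: w\<^sub>0_def)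
      then have "\<omega> b w\<^sub>1 = \<omega> (?p b + w\<^sub>0) w\<^sub>1" "\<omega> w\<^sub>0 b = \<omega> w\<^sub>0 (?p b + w\<^sub>0)"
        by simp_all
      then have "\<omega> b w\<^sub>1 = 1" "\<omega> w\<^sub>0 b = 0"
        using p0 p1 w01 by (simp_all add: omega_add_left omega_add_right alt)
      then show ?thesis unfolding p' by (simp add: w\<^sub>0_def)
    qed
    moreover have "family_proj (Suc n) ?e ?f w = w" if "w \<in> B" for w
    proof -
      have "\<omega> w w\<^sub>1 = 0" "\<omega> w\<^sub>0 w = 0" using B[OF that] p0 p1 by metis+
      then show ?thesis unfolding p' using B[OF that] by simp
    qed
    ultimately show ?thesis by blast
  qed
qed

end

lemma symplectic_space_basis:
  assumes "symplectic_space scW \<omega>"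
  obtains n e f where "symplectic scW \<omega>" "symplectic.symplectic_family \<omega> n e f"
    "\<forall>w. w = (\<Sum>i<n. scW (\<omega> w (f i)) (e i) + scW (\<omega> (e i) w) (f i))"
proof -
  interpret vector_space scW using assms by (simp add: symplectic_space_def)
  have s: "symplectic scW \<omega>"
    using assms by (simp add: symplectic_space_def symplectic_def symplectic_axioms_def)
  interpret symplectic scW \<omega> by (rule s)
  obtain B where B: "finite B" "span B = UNIV" using assms by (auto simp: symplectic_space_def)
  obtain n e f where F: "symplectic_family n e f" "\<And>b. b \<in> B \<Longrightarrow> family_proj n e f b = b"
    using symplectic_family_extend[OF _ B(1)] assms by (auto simp: symplectic_space_def)
  have "subspace {w. family_proj n e f w = w}"
  proof (rule subspaceI)
    show "0 \<in> {w. family_proj n e f w = w}"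
      using omega_swap[of 0] by (simp add: family_proj_def omega_zero_left)
    fix x y c assume "x \<in> {w. family_proj n e f w = w}" "y \<in> {w. family_proj n e f w = w}"
    moreover have "family_proj n e f (x + y) = family_proj n e f x + family_proj n e f y"
      by (simp add: family_proj_def omega_add_left omega_add_right scale_left_distrib sum.distrib)
    moreover have "family_proj n e f (scW c x) = scW c (family_proj n e f x)"
      by (simp add: family_proj_def omega_scale_left omega_scale_right scale_sum_right scale_right_distrib)
    ultimately show "x + y \<in> {w. family_proj n e f w = w}" "scW c x \<in> {w. family_proj n e f w = w}"
      by auto
  qed
  then have "span B \<subseteq> {w. family_proj n e f w = w}"
    by (intro span_minimal) (use F in auto)
  then have "family_proj n e f w = w" for w using B(2) by blast
  then show ?thesis using that[OF s F(1)] by (simp add: family_proj_def)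
qed

section \<open>The self-dual lattice\<close>

locale symplectic_coordinates = ultrametric_field v + symplectic scW \<omega>
  for v :: "'f::field \<Rightarrow> real" and scW :: "'f \<Rightarrow> 'w::ab_group_add \<Rightarrow> 'w" and \<omega> +
  fixes n :: nat and e f :: "nat \<Rightarrow> 'w"
  assumes family: "symplectic_family n e f"
    and expansion: "w = (\<Sum>i<n. scW (\<omega> w (f i)) (e i) + scW (\<omega> (e i) w) (f i))"
begin

abbreviation TF where "TF \<equiv> absolute_value_topology v"
abbreviation TW where "TW \<equiv> vector_topology TF scW"

lemma omega_basis:
  assumes "i < n" "j < n"
  shows "\<omega> (e i) (f j) = (if i = j then 1 else 0)" "\<omega> (f i) (e j) = (if i = j then - 1 else 0)"
    "\<omega> (e i) (e j) = 0" "\<omega> (f i) (f j) = 0"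
  using family assms omega_swap[of "f i" "e j"] by (auto simp: symplectic_family_def)

lemma linear_form_expansion:
  assumes "Vector_Spaces.linear scW (*) l"
  shows "l w = (\<Sum>i<n. \<omega> w (f i) * l (e i) + \<omega> (e i) w * l (f i))"
proof -
  interpret Vector_Spaces.linear scW "(*)" l by (rule assms)
  show ?thesis by (subst expansion[of w]) (simp add: sum add scale)
qed

lemma omega_expansion: "\<omega> w w' = (\<Sum>i<n. \<omega> w (f i) * \<omega> (e i) w' - \<omega> (e i) w * \<omega> w' (f i))"
  using linear_form_expansion[OF linear_left[of w'], of w] omega_swap[of "f _" w'] by simp

text \<open>The box of radius \<open>r\<close>: the pairings with \<open>f i\<close> and
  \<open>e i\<close> are the coordinates along \<open>e i\<close> and \<open>f i\<close>. Strict
  bounds in an ultrametric field make it an open subgroup for \<open>r > 0\<close>, and these boxes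
  form a neighbourhood basis of 0.\<close>

definition lattice :: "real \<Rightarrow> 'w set" where
  "lattice r = {w. \<forall>i<n. v (\<omega> w (f i)) < r \<and> v (\<omega> (e i) w) < r}"

lemma lattice_zero: "r > 0 \<Longrightarrow> 0 \<in> lattice r"
  using omega_swap[of _ 0] by (auto simp: lattice_def omega_zero_left v_zero)

lemma lattice_add: "x \<in> lattice r \<Longrightarrow> y \<in> lattice r \<Longrightarrow> x + y \<in> lattice r"
  by (auto simp: lattice_def omega_add_left omega_add_right intro!: v_add_less)

lemma lattice_uminus: "x \<in> lattice r \<Longrightarrow> - x \<in> lattice r"
  using omega_swap[of _ x] omega_swap[of _ "- x"]
  by (auto simp: lattice_def omega_uminus_left v_uminus)

lemma lattice_mono: "r \<le> s \<Longrightarrow> lattice r \<subseteq> lattice s"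
  by (force simp: lattice_def)

lemma linear_form_small:
  assumes "Vector_Spaces.linear scW (*) l" "R > 0"
  shows "\<exists>r>0. \<forall>w\<in>lattice r. v (l w) < R"
proof -
  \<comment> \<open>The summand 1 keeps \<open>C\<close> positive even when \<open>l\<close>
    vanishes on the whole basis, so that \<open>R / C\<close> is a usable radius.\<close>
  define C where "C = 1 + (\<Sum>i<n. v (l (e i)) + v (l (f i)))"
  have C: "C > 0" "\<And>i. i < n \<Longrightarrow> v (l (e i)) \<le> C" "\<And>i. i < n \<Longrightarrow> v (l (f i)) \<le> C"
  proof -
    have nn: "0 \<le> v (l (e i)) + v (l (f i))" for i using v_nonneg by simp
    then show "C > 0" by (simp add: C_def add_pos_nonneg sum_nonneg)
    have "v (l (e i)) + v (l (f i)) \<le> C" if "i < n" for i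
      using member_le_sum[of i "{..<n}" "\<lambda>i. v (l (e i)) + v (l (f i))"] nn that by (simp add: C_def)
    then show "v (l (e i)) \<le> C" "v (l (f i)) \<le> C" if "i < n" for i
      using that v_nonneg[of "l (e i)"] v_nonneg[of "l (f i)"] by fastforce+
  qed
  have "v (l w) < R" if w: "w \<in> lattice (R / C)" for w
    unfolding linear_form_expansion[OF assms(1), of w]
  proof (rule v_sum_less[OF assms(2)], rule v_add_less)
    fix i assume "i \<in> {..<n}"
    then have "v (l (e i) * \<omega> w (f i)) < C * (R / C)" "v (l (f i) * \<omega> (e i) w) < C * (R / C)"
      by (intro v_mult_less; use C w in \<open>auto simp: lattice_def\<close>)+
    then show "v (\<omega> w (f i) * l (e i)) < R" "v (\<omega> (e i) w * l (f i)) < R"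
      using C(1) by (simp_all add: mult.commute)
  qed
  moreover have "R / C > 0" using assms(2) C(1) by simp
  ultimately show ?thesis by blast
qed

text \<open>A generated topology lives on the union of its generators, so some linear form has to be
  exhibited; pairing with 0 is one.\<close>

lemma topspace_TW [simp]: "topspace TW = UNIV"
proof -
  have "Vector_Spaces.linear scW (*) (\<lambda>x. \<omega> x 0)" by (rule linear_left)
  then have "UNIV \<in> {l -` U |l U. Vector_Spaces.linear scW (*) l \<and> openin TF U}"
    using openin_topspace[of TF] by (intro CollectI exI[of _ "\<lambda>x. \<omega> x 0"] exI[of _ UNIV]) auto
  then show ?thesis unfolding vector_topology_def topology_generated_by_topspace by blast
qed

lemma continuous_linear_form:
  assumes "Vector_Spaces.linear scW (*) l"
  shows "continuous_map TW TF l"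
  unfolding continuous_map_alt
proof (intro conjI allI impI)
  fix U assume "openin TF U"
  then have "openin TW (l -` U)"
    unfolding vector_topology_def using assms by (intro topology_generated_by_Basis) blast
  then show "openin TW (l -` U \<inter> topspace TW)" by simp
qed auto

lemma continuous_map_TW:
  assumes "\<And>l. Vector_Spaces.linear scW (*) l \<Longrightarrow> continuous_map X TF (\<lambda>x. l (g x))"
  shows "continuous_map X TW g"
proof -
  have "openin X (g -` V \<inter> topspace X)"
    if "V \<in> {l -` U |l U. Vector_Spaces.linear scW (*) l \<and> openin TF U}" for V
  proof -
    obtain l U where lU: "V = l -` U" "Vector_Spaces.linear scW (*) l" "openin TF U"
      using \<open>V \<in> _\<close> by blast
    have "openin X ((\<lambda>x. l (g x)) -` U \<inter> topspace X)"
      using assms[OF lU(2)] lU(3) by (auto simp: continuous_map_alt)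
    moreover have "(\<lambda>x. l (g x)) -` U = g -` V" by (auto simp: lU(1))
    ultimately show ?thesis by simp
  qed
  moreover have "g ` topspace X \<subseteq> \<Union> {l -` U |l U. Vector_Spaces.linear scW (*) l \<and> openin TF U}"
    using topspace_TW unfolding vector_topology_def topology_generated_by_topspace by simp
  ultimately show ?thesis
    unfolding vector_topology_def by (rule continuous_on_generated_topo)
qed

lemma openin_translate_lattice: "openin TW {w. w - u \<in> lattice r}"
proof -
  have ball: "openin TF {x. v (x - y) < r}" for y
    unfolding openin_v
  proof
    fix x assume x: "x \<in> {x. v (x - y) < r}"
    then have "r > 0" using le_less_trans[OF v_nonneg[of "x - y"], of r] by simp
    moreover have "v (z - y) < r" if "v (z - x) < r" for z
      using v_add_less[of "z - x" r "x - y"] x that by simp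
    ultimately show "\<exists>r'>0. \<forall>z. v (z - x) < r' \<longrightarrow> z \<in> {x. v (x - y) < r}" by auto
  qed
  have pre: "openin TW {w. v (l w - y) < r}" if "Vector_Spaces.linear scW (*) l" for l y
    using openin_continuous_map_preimage[OF continuous_linear_form[OF that] ball] by simp
  let ?B = "\<lambda>i. {w. v (\<omega> w (f i) - \<omega> u (f i)) < r} \<inter> {w. v (\<omega> (e i) w - \<omega> (e i) u) < r}"
  have "openin TW ((\<Inter>i\<in>{..<n}. ?B i) \<inter> topspace TW)"
    by (rule openin_INT) (auto intro!: openin_Int pre linear_left linear_right)
  moreover have "(\<Inter>i\<in>{..<n}. ?B i) \<inter> topspace TW = {w. w - u \<in> lattice r}"
    by (auto simp: lattice_def omega_diff_left omega_diff_right)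
  ultimately show ?thesis by simp
qed

text \<open>Induction over the generation of open sets. A generator is the preimage of an open set
  under a linear form, and \<open>linear_form_small\<close> controls the form on a small
  box.\<close>

lemma openin_TW_lattice:
  assumes "openin TW U" "u \<in> U"
  shows "\<exists>r>0. \<forall>w. w - u \<in> lattice r \<longrightarrow> w \<in> U"
proof -
  have "generate_topology_on {l -` U |l U. Vector_Spaces.linear scW (*) l \<and> openin TF U} U"
    using assms(1) unfolding vector_topology_def by (rule openin_topology_generated_by)
  then show ?thesis using assms(2)
  proof induction
    case (Int a b)
    then obtain r s where "r > 0" "s > 0" "\<And>w. w - u \<in> lattice r \<Longrightarrow> w \<in> a"
      "\<And>w. w - u \<in> lattice s \<Longrightarrow> w \<in> b" by auto
    then show ?case
      using lattice_mono[of "min r s" r] lattice_mono[of "min r s" s]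
      by (intro exI[of _ "min r s"]) auto
  next
    case (UN K)
    then show ?case by blast
  next
    case (Basis s)
    then obtain l U where l: "s = l -` U" "Vector_Spaces.linear scW (*) l" "openin TF U" by blast
    then obtain R where R: "R > 0" "\<And>y. v (y - l u) < R \<Longrightarrow> y \<in> U"
      using Basis unfolding openin_v by force
    obtain r where r: "r > 0" "\<And>w. w \<in> lattice r \<Longrightarrow> v (l w) < R"
      using linear_form_small[OF l(2) R(1)] by blast
    interpret l: Vector_Spaces.linear scW "(*)" l by (rule l(2))
    have "l w \<in> U" if "w - u \<in> lattice r" for w
      using R(2)[of "l w"] r(2)[OF that] by (simp add: l.diff)
    then show ?case
      using r(1) by (auto simp: l(1))
  qed auto
qed

lemma lattice_finite_index:
  assumes "r > 0"
  shows "\<exists>K. finite K \<and> (\<forall>w\<in>lattice R. \<exists>k\<in>K. w - k \<in> lattice r)"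
proof -
  obtain K where K: "finite K" "\<And>x. v x \<le> R \<Longrightarrow> \<exists>k\<in>K. v (x - k) < r"
    using totally_bounded[OF assms, of R] by blast
  \<comment> \<open>\<open>c\<close> assembles a vector from its coordinates, each of which is
    approximated separately within \<open>K\<close>. Extensional functions keep the set of
    coordinate tuples finite.\<close>
  define c where "c p = (\<Sum>i<n. scW (fst p i) (e i) + scW (snd p i) (f i))" for p :: "(nat \<Rightarrow> 'f) \<times> (nat \<Rightarrow> 'f)"
  have c: "\<omega> (c p) (f j) = fst p j" "\<omega> (e j) (c p) = snd p j" if "j < n" for p j
  proof -
    have "\<omega> (c p) (f j) = (\<Sum>i<n. if i = j then fst p j else 0)"
      unfolding c_def omega_sum_left omega_add_left omega_scale_left
      by (rule sum.cong) (use that in \<open>auto simp: omega_basis\<close>)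
    then show "\<omega> (c p) (f j) = fst p j" using that by simp
    have "\<omega> (e j) (c p) = (\<Sum>i<n. if i = j then snd p j else 0)"
      unfolding c_def omega_sum_right omega_add_right omega_scale_right
      by (rule sum.cong) (use that in \<open>auto simp: omega_basis\<close>)
    then show "\<omega> (e j) (c p) = snd p j" using that by simp
  qed
  let ?K = "c ` (({..<n} \<rightarrow>\<^sub>E K) \<times> ({..<n} \<rightarrow>\<^sub>E K))"
  have "\<exists>k\<in>?K. w - k \<in> lattice r" if w: "w \<in> lattice R" for w
  proof -
    have "\<exists>k\<in>K. v (\<omega> w (f i) - k) < r" "\<exists>k\<in>K. v (\<omega> (e i) w - k) < r" if "i < n" for i
      using w that by (auto simp: lattice_def intro!: K(2))
    then obtain p q where pq: "\<And>i. i < n \<Longrightarrow> p i \<in> K \<and> v (\<omega> w (f i) - p i) < r"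
      "\<And>i. i < n \<Longrightarrow> q i \<in> K \<and> v (\<omega> (e i) w - q i) < r" by metis
    let ?pq = "(restrict p {..<n}, restrict q {..<n})"
    have "w - c ?pq \<in> lattice r"
      using pq by (auto simp: lattice_def omega_diff_left omega_diff_right c)
    moreover have "?pq \<in> ({..<n} \<rightarrow>\<^sub>E K) \<times> ({..<n} \<rightarrow>\<^sub>E K)" using pq by auto
    ultimately show ?thesis by blast
  qed
  moreover have "finite ?K" using K(1) by (intro finite_imageI finite_cartesian_product finite_PiE) auto
  ultimately show ?thesis by blast
qed

end

section \<open>The cocycle of the Heisenberg group and the group \<open>J\<close>\<close>

locale heisenberg_data = symplectic_coordinates v scW \<omega> n e f
  for v :: "'f::field \<Rightarrow> real" and scW :: "'f \<Rightarrow> 'w::ab_group_add \<Rightarrow> 'w" and \<omega> n e f +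
  fixes \<psi> :: "'f \<Rightarrow> 'r::field" and a :: 'f
  assumes two_nonzero: "(2::'f) \<noteq> 0"
    and psi_nonzero: "\<psi> x \<noteq> 0" and psi_add: "\<psi> (x + y) = \<psi> x * \<psi> y"
    and psi_a: "\<psi> a \<noteq> 1" and psi_small: "v x < v a \<Longrightarrow> \<psi> x = 1"
begin

lemma psi_zero: "\<psi> 0 = 1"
  using psi_add[of 0 0] psi_nonzero[of 0] by simp

lemma psi_uminus: "\<psi> (- x) = inverse (\<psi> x)"
  using psi_add[of x "- x"] psi_zero by (simp add: inverse_unique)

lemma a_nonzero: "a \<noteq> 0" using psi_a psi_zero by auto

lemma va_pos: "v a > 0" using v_pos a_nonzero .
lemma v2_pos: "v 2 > 0" using v_pos two_nonzero .

definition beta :: "'w \<Rightarrow> 'w \<Rightarrow> 'r" where "beta w w' = \<psi> (\<omega> w w' / 2)"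

definition J :: "'w set" where
  "J = {w. \<forall>i<n. v (\<omega> w (f i)) < v a \<and> v (\<omega> (e i) w) \<le> 1}"

definition eta :: "'w \<Rightarrow> 'r" where "eta w = \<psi> ((\<Sum>i<n. \<omega> w (f i) * \<omega> (e i) w) / 2)"

lemma beta_sq: "(beta w w')\<^sup>2 = \<psi> (\<omega> w w')"
proof -
  have "\<omega> w w' / 2 + \<omega> w w' / 2 = \<omega> w w'"
    using two_nonzero by (simp add: field_simps)
  then show ?thesis by (simp add: beta_def power2_eq_square psi_add[symmetric])
qed

lemma psi_sum_small: "(\<And>i. i < n \<Longrightarrow> v (g i) < v a) \<Longrightarrow> \<psi> (\<Sum>i<n. g i) = 1"
  by (rule psi_small, rule v_sum_less[OF va_pos]) auto

lemma J_pairing_small: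
  assumes "w \<in> J" "w' \<in> J" "i < n"
  shows "v (\<omega> w (f i) * \<omega> (e i) w') < v a"
  using v_mult_less[of "\<omega> (e i) w'" 1 "\<omega> w (f i)" "v a"] assms by (auto simp: J_def mult.commute)

sublocale polarised_cocycle beta J eta
proof
  fix x x' y y' w :: 'w
  show "beta x y \<noteq> 0" by (simp add: beta_def psi_nonzero)
  show "beta (x + x') y = beta x y * beta x' y"
    by (simp add: beta_def omega_add_left add_divide_distrib psi_add)
  show "beta x (y + y') = beta x y * beta x y'"
    by (simp add: beta_def omega_add_right add_divide_distrib psi_add)
  show "beta x x = 1" by (simp add: beta_def alt psi_zero)
  show "eta x \<noteq> 0" by (simp add: eta_def psi_nonzero)
  show "0 \<in> J"
    using omega_swap[of _ 0] va_pos by (auto simp: J_def omega_zero_left v_zero)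
  show "x + y \<in> J" if "x \<in> J" "y \<in> J"
  proof -
    have "v (\<omega> (e i) x + \<omega> (e i) y) \<le> 1" if "i < n" for i
      using v_add[of "\<omega> (e i) x" "\<omega> (e i) y"] \<open>x \<in> J\<close> \<open>y \<in> J\<close> that by (force simp: J_def)
    then show ?thesis
      using that by (auto simp: J_def omega_add_left omega_add_right intro!: v_add_less)
  qed
  show "- x \<in> J" if "x \<in> J"
    using that omega_swap[of _ x] omega_swap[of _ "- x"]
    by (auto simp: J_def omega_uminus_left v_uminus)
  show "eta x * eta y = beta x y * eta (x + y)" if "x \<in> J" "y \<in> J"
  proof -
    let ?q = "\<lambda>x y. \<Sum>i<n. \<omega> x (f i) * \<omega> (e i) y"
    have w: "\<omega> x y = ?q x y - ?q y x"
      by (subst omega_expansion) (simp add: sum_subtractf mult.commute)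
    have q: "?q (x + y) (x + y) = ?q x x + ?q y y + ?q x y + ?q y x"
      by (simp add: omega_add_left omega_add_right algebra_simps sum.distrib)
    \<comment> \<open>The two halves of the mixed term \<open>?q x y\<close> combine to an integral
      multiple and those of \<open>?q y x\<close> cancel. What remains, \<open>?q x y\<close>
      without the factor \<open>1/2\<close>, is killed by \<open>\<psi>\<close> on \<open>J\<close>,
      whatever the size of 2.\<close>
    have "\<omega> x y / 2 + ?q (x + y) (x + y) / 2 = ?q x x / 2 + ?q y y / 2 + ?q x y"
    proof -
      have half: "z / 2 + z / 2 = z" for z :: 'f using two_nonzero by (simp add: field_simps)
      show ?thesis
        unfolding w q using half[of "?q x y"]
        by (simp add: add_divide_distrib diff_divide_distrib add_ac)
    qed
    then have "beta x y * eta (x + y) = eta x * eta y * \<psi> (?q x y)"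
      by (simp add: beta_def eta_def psi_add[symmetric])
    moreover have "\<psi> (?q x y) = 1"
      using that by (intro psi_sum_small J_pairing_small)
    ultimately show ?thesis by simp
  qed
  show "w \<in> J \<longleftrightarrow> (\<forall>j\<in>J. (beta w j)\<^sup>2 = 1)"
  proof
    assume w: "w \<in> J"
    show "\<forall>j\<in>J. (beta w j)\<^sup>2 = 1"
    proof
      fix j assume j: "j \<in> J"
      have "\<psi> (\<omega> w j) = 1"
        unfolding omega_expansion[of w j]
      proof (rule psi_sum_small, rule v_diff_less)
        fix i assume i: "i < n"
        show "v (\<omega> w (f i) * \<omega> (e i) j) < v a" by (rule J_pairing_small[OF w j i])
        show "v (\<omega> (e i) w * \<omega> j (f i)) < v a"
          using J_pairing_small[OF j w i] by (simp add: mult.commute)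
      qed
      then show "(beta w j)\<^sup>2 = 1" by (simp add: beta_sq)
    qed
  next
    assume "\<forall>j\<in>J. (beta w j)\<^sup>2 = 1"
    then have orth: "\<psi> (\<omega> w j) = 1" if "j \<in> J" for j using that by (simp add: beta_sq)
    \<comment> \<open>Test \<open>w\<close> against the multiple of \<open>f i\<close> with which it
      pairs to \<open>a\<close>: if the coordinate were too large, this multiple would lie in
      \<open>J\<close>.\<close>
    have "v (\<omega> w (f i)) < v a" if i: "i < n" for i
    proof (rule ccontr)
      let ?x = "\<omega> w (f i)"
      assume le: "\<not> v ?x < v a"
      then have x: "?x \<noteq> 0" using va_pos v_zero by auto
      then have "v (a / ?x) \<le> 1" using le v_pos[OF x] by (simp add: v_divide)
      then have "scW (a / ?x) (f i) \<in> J"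
        using i va_pos by (auto simp: J_def omega_scale_left omega_scale_right omega_basis v_zero)
      then have "\<psi> (\<omega> w (scW (a / ?x) (f i))) = 1" by (rule orth)
      then show False using x psi_a by (simp add: omega_scale_right)
    qed
    \<comment> \<open>The same test with a multiple of \<open>e i\<close>, whose pairing with
      \<open>w\<close> is \<open>- a\<close>. The strict bound on that half of \<open>J\<close> is
      what matches the weak bound here.\<close>
    moreover have "v (\<omega> (e i) w) \<le> 1" if i: "i < n" for i
    proof (rule ccontr)
      let ?y = "\<omega> (e i) w"
      assume le: "\<not> v ?y \<le> 1"
      then have y: "?y \<noteq> 0" using v_zero by auto
      then have "v (a / ?y) < v a" using le va_pos by (simp add: v_divide field_simps)
      then have "scW (a / ?y) (e i) \<in> J"
        using i va_pos by (auto simp: J_def omega_scale_left omega_scale_right omega_basis v_zero)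
      then have "\<psi> (\<omega> w (scW (a / ?y) (e i))) = 1" by (rule orth)
      then have "\<psi> (- a) = 1" using y omega_swap[of w "e i"] by (simp add: omega_scale_right)
      then show False using psi_a by (simp add: psi_uminus)
    qed
    ultimately show "w \<in> J" by (simp add: J_def)
  qed
qed

text \<open>The bounds 1 and \<open>v a\<close> place the box inside \<open>J\<close>. The bound
  \<open>v a * v 2\<close>, together with 1, brings half the quadratic form in \<open>eta\<close>
  below \<open>v a\<close>, where \<open>\<psi>\<close> is trivial; the factor \<open>v 2\<close>
  compensates the division by 2.\<close>

definition small_radius :: real where "small_radius = min (min 1 (v a)) (v a * v 2)"

lemma small_radius_pos: "small_radius > 0"
  using va_pos v2_pos by (simp add: small_radius_def)

lemma lattice_J: "r \<le> small_radius \<Longrightarrow> lattice r \<subseteq> J"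
  by (force simp: lattice_def J_def small_radius_def)

lemma eta_lattice:
  assumes "r \<le> small_radius" "w \<in> lattice r"
  shows "eta w = 1"
proof -
  have w: "w \<in> lattice small_radius" using assms lattice_mono by blast
  have "v (\<Sum>i<n. \<omega> w (f i) * \<omega> (e i) w) < v a * v 2"
  proof (rule v_sum_less)
    fix i assume "i \<in> {..<n}"
    then have "v (\<omega> w (f i)) < 1" "v (\<omega> (e i) w) < v a * v 2"
      using w by (auto simp: lattice_def small_radius_def)
    then show "v (\<omega> w (f i) * \<omega> (e i) w) < v a * v 2"
      using v_mult_less[of "\<omega> w (f i)" 1 "\<omega> (e i) w"] by simp
  qed (use va_pos v2_pos in simp)
  then have "v ((\<Sum>i<n. \<omega> w (f i) * \<omega> (e i) w) / 2) < v a"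
    using v2_pos by (simp add: v_divide field_simps)
  then show ?thesis unfolding eta_def by (rule psi_small)
qed

text \<open>Outside the box some coordinate has size at least \<open>r\<close>. The basis vector
  dual to it, scaled by \<open>a\<close> over that coordinate, pairs with \<open>j\<close> to
  \<open>a\<close> up to sign, and with the box to values smaller than \<open>a\<close>.\<close>

lemma lattice_separated:
  assumes "j \<notin> lattice r" "r > 0"
  shows "\<exists>w. (\<forall>l\<in>lattice r. (beta w l)\<^sup>2 = 1) \<and> (beta w j)\<^sup>2 \<noteq> 1"
proof -
  have small: "v (a / y * x) < v a" if "v x < r" "r \<le> v y" for x y
  proof -
    have "v y > 0" using assms(2) that by simp
    moreover have "v a * v x < v a * v y" using that va_pos by simp
    ultimately show ?thesis by (simp add: v_divide v_mult field_simps)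
  qed
  obtain i where i: "i < n" "r \<le> v (\<omega> j (f i)) \<or> r \<le> v (\<omega> (e i) j)"
    using assms(1) by (auto simp: lattice_def not_less)
  from i(2) show ?thesis
  proof
    assume r: "r \<le> v (\<omega> j (f i))"
    then have nz: "\<omega> j (f i) \<noteq> 0" using assms(2) v_zero by auto
    let ?w = "scW (a / \<omega> j (f i)) (f i)"
    have w: "\<omega> ?w x = - (a / \<omega> j (f i) * \<omega> x (f i))" for x
      using omega_swap[of "f i" x] by (simp add: omega_scale_left)
    have "\<psi> (\<omega> ?w l) = 1" if "l \<in> lattice r" for l
      unfolding w psi_uminus using small[OF _ r, of "\<omega> l (f i)"] that i(1)
      by (simp add: lattice_def psi_small)
    moreover have "\<psi> (\<omega> ?w j) \<noteq> 1" unfolding w psi_uminus using nz psi_a by simp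
    ultimately show ?thesis by (intro exI[of _ ?w]) (simp add: beta_sq)
  next
    assume r: "r \<le> v (\<omega> (e i) j)"
    then have nz: "\<omega> (e i) j \<noteq> 0" using assms(2) v_zero by auto
    let ?w = "scW (a / \<omega> (e i) j) (e i)"
    have w: "\<omega> ?w x = a / \<omega> (e i) j * \<omega> (e i) x" for x
      by (simp add: omega_scale_left)
    have "\<psi> (\<omega> ?w l) = 1" if "l \<in> lattice r" for l
      unfolding w using small[OF _ r, of "\<omega> (e i) l"] that i(1)
      by (simp add: lattice_def psi_small)
    moreover have "\<psi> (\<omega> ?w j) \<noteq> 1" unfolding w using nz psi_a by simp
    ultimately show ?thesis by (intro exI[of _ ?w]) (simp add: beta_sq)
  qed
qed

lemma J_finite_index:
  assumes "r > 0"
  shows "\<exists>K. finite K \<and> (\<forall>j\<in>J. \<exists>k\<in>K. j - k \<in> lattice r)"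
proof -
  \<comment> \<open>The radius 2 turns the weak bound 1 of \<open>J\<close> into the strict bound of
    a box.\<close>
  have "J \<subseteq> lattice (max (v a) 2)" by (force simp: J_def lattice_def)
  then show ?thesis using lattice_finite_index[OF assms, of "max (v a) 2"] by blast
qed

end

section \<open>Intertwiners\<close>

lemma linear_iff_additive:
  "Vector_Spaces.linear s1 s2 g \<longleftrightarrow> vector_space s1 \<and> vector_space s2 \<and>
     (\<forall>x y. g (x + y) = g x + g y) \<and> (\<forall>c x. g (s1 c x) = s2 c (g x))"
  by (auto simp: Vector_Spaces.linear_def module_hom_def module_hom_axioms_def
      vector_space_def module_def)

lemma linear_inv_into:
  assumes "Vector_Spaces.linear s1 s2 g" "bij g"
  shows "Vector_Spaces.linear s2 s1 (inv_into UNIV g)"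
proof -
  have inj: "inj g" and surj: "surj g" using assms(2) by (auto simp: bij_def)
  note g = assms(1)[unfolded linear_iff_additive]
  have "inv_into UNIV g (x + y) = inv_into UNIV g x + inv_into UNIV g y" for x y
    by (rule inv_f_eq[OF inj]) (use g in \<open>simp add: surj_f_inv_f[OF surj]\<close>)
  moreover have "inv_into UNIV g (s2 c x) = s1 c (inv_into UNIV g x)" for c x
    by (rule inv_f_eq[OF inj]) (use g in \<open>simp add: surj_f_inv_f[OF surj]\<close>)
  ultimately show ?thesis using g by (simp add: linear_iff_additive)
qed

lemma bij_comp_inv_into:
  assumes "bij g"
  shows "g \<circ> inv_into UNIV g = id" "inv_into UNIV g \<circ> g = id"
    "g (inv_into UNIV g x) = x" "inv_into UNIV g (g y) = y"
  using assms by (auto simp: bij_def surj_iff surj_f_inv_f)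

lemma GL_simps [simp]: "M \<otimes>\<^bsub>GL scS\<^esub> N = M \<circ> N" "\<one>\<^bsub>GL scS\<^esub> = id"
  by (simp_all add: GL_def)

lemma carrier_GL: "M \<in> carrier (GL scS) \<longleftrightarrow> Vector_Spaces.linear scS scS M \<and> bij M"
  by (simp add: GL_def)

lemma Sp_simps [simp]: "g \<otimes>\<^bsub>Sp scW \<omega>\<^esub> h = h \<circ> g" "\<one>\<^bsub>Sp scW \<omega>\<^esub> = id"
  by (simp_all add: Sp_def)

lemma carrier_Sp: "g \<in> carrier (Sp scW \<omega>) \<longleftrightarrow>
    Vector_Spaces.linear scW scW g \<and> bij g \<and> (\<forall>x y. \<omega> (g x) (g y) = \<omega> x y)"
  by (simp add: Sp_def)

context vector_space
begin

lemma group_GL: "group (GL scale)"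
proof (rule groupI)
  fix M assume M: "M \<in> carrier (GL scale)"
  then have "inv_into UNIV M \<in> carrier (GL scale)"
    by (auto simp: carrier_GL linear_inv_into bij_imp_bij_inv)
  then show "\<exists>N\<in>carrier (GL scale). N \<otimes>\<^bsub>GL scale\<^esub> M = \<one>\<^bsub>GL scale\<^esub>"
    using M by (intro bexI[of _ "inv_into UNIV M"]) (auto simp: carrier_GL bij_comp_inv_into)
qed (auto simp: carrier_GL linear_id id_def[symmetric] comp_assoc
    intro: Vector_Spaces.linear_compose bij_comp)

lemma inv_GL: "M \<in> carrier (GL scale) \<Longrightarrow> inv\<^bsub>GL scale\<^esub> M = inv_into UNIV M"
  by (rule group.inv_equality[OF group_GL])
    (auto simp: carrier_GL linear_inv_into bij_imp_bij_inv bij_comp_inv_into)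

lemma scale_GL: "c \<noteq> 0 \<Longrightarrow> scale c \<in> carrier (GL scale)"
  by (auto simp: carrier_GL linear_scale_self intro!: o_bij[of "scale (inverse c)"])

lemma GL_comp: "M \<in> carrier (GL scale) \<Longrightarrow> N \<in> carrier (GL scale) \<Longrightarrow> M \<circ> N \<in> carrier (GL scale)"
  using group.is_monoid[OF group_GL] monoid.m_closed by fastforce

lemma GL_inv: "M \<in> carrier (GL scale) \<Longrightarrow> inv_into UNIV M \<in> carrier (GL scale)"
  using group.inv_closed[OF group_GL] inv_GL by fastforce

lemma GL_scale: "M \<in> carrier (GL scale) \<Longrightarrow> M (scale c x) = scale c (M x)"
  by (simp add: carrier_GL linear_iff_additive)

lemma red_eq: "red scale M = {scale c \<circ> M |c. c \<noteq> 0}"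
  by (auto simp: red_def r_coset_def scalars_def)

lemma red_eq_iff:
  "red scale M = red scale N \<longleftrightarrow> (\<exists>c. c \<noteq> 0 \<and> M = scale c \<circ> N)"
proof
  assume "red scale M = red scale N"
  moreover have "M \<in> red scale M" by (auto simp: red_eq fun_eq_iff intro!: exI[of _ 1])
  ultimately show "\<exists>c. c \<noteq> 0 \<and> M = scale c \<circ> N" by (auto simp: red_eq)
next
  assume "\<exists>c. c \<noteq> 0 \<and> M = scale c \<circ> N"
  then obtain c where c: "c \<noteq> 0" "M = scale c \<circ> N" by blast
  have "scale d \<circ> M = scale (d * c) \<circ> N" "scale d \<circ> N = scale (d / c) \<circ> M" for d
    using c by (auto simp: fun_eq_iff)
  moreover have "d * c \<noteq> 0" "d / c \<noteq> 0" if "d \<noteq> 0" for d using that c(1) by auto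
  ultimately show "red scale M = red scale N" unfolding red_eq by blast
qed

end

context symplectic
begin

lemma group_Sp: "group (Sp scW \<omega>)"
proof (rule groupI)
  fix g assume g: "g \<in> carrier (Sp scW \<omega>)"
  have "\<omega> (inv_into UNIV g x) (inv_into UNIV g y) = \<omega> x y" for x y
    using g bij_comp_inv_into(3)[of g] by (metis carrier_Sp)
  then have "inv_into UNIV g \<in> carrier (Sp scW \<omega>)"
    using g by (auto simp: carrier_Sp linear_inv_into bij_imp_bij_inv)
  then show "\<exists>h\<in>carrier (Sp scW \<omega>). h \<otimes>\<^bsub>Sp scW \<omega>\<^esub> g = \<one>\<^bsub>Sp scW \<omega>\<^esub>"
    using g by (intro bexI[of _ "inv_into UNIV g"]) (auto simp: carrier_Sp bij_comp_inv_into)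
qed (auto simp: carrier_Sp linear_id id_def[symmetric] comp_assoc
    intro: Vector_Spaces.linear_compose bij_comp)

lemma Sp_inv: "g \<in> carrier (Sp scW \<omega>) \<Longrightarrow> inv_into UNIV g \<in> carrier (Sp scW \<omega>)"
  using inverse_iso_Sp[OF vector_space_axioms, of \<omega>] by (auto simp: iso_def hom_def)

lemma inv_Sp: "g \<in> carrier (Sp scW \<omega>) \<Longrightarrow> inv\<^bsub>Sp scW \<omega>\<^esub> g = inv_into UNIV g"
  by (rule group.inv_equality[OF group_Sp]) (simp_all add: Sp_inv, simp add: carrier_Sp bij_comp_inv_into)

end

lemma intertwines_iff:
  assumes "bij M"
  shows "intertwines \<rho> g M \<longleftrightarrow> (\<forall>w t x. M (\<rho> (w, t) x) = \<rho> (inv_into UNIV g w, t) (M x))"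
  unfolding intertwines_def fun_eq_iff using assms
  by (auto simp: bij_comp_inv_into) (metis bij_comp_inv_into(4))

lemma (in vector_space) span_finite_subset:
  assumes "x \<in> span S"
  shows "\<exists>T. finite T \<and> T \<subseteq> S \<and> x \<in> span T"
proof -
  obtain T r where "finite T" "T \<subseteq> S" "x = (\<Sum>a\<in>T. scale (r a) a)"
    using assms unfolding span_explicit by blast
  then show ?thesis by (intro exI[of _ T]) (simp add: span_sum span_scale span_base)
qed

section \<open>Stone--von Neumann, Schur, and the intertwiners of \<open>Sp(W)\<close>\<close>

context heisenberg_data
begin

abbreviation model where "model scS \<rho> \<equiv> Heisenberg_model TF scW \<omega> \<psi> scS \<rho>"

lemma modelD:
  fixes scS :: "'r \<Rightarrow> 's::ab_group_add \<Rightarrow> 's"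
  assumes "model scS \<rho>"
  shows "vector_space scS" "\<rho> h \<in> carrier (GL scS)"
    "\<rho> (w, t) (\<rho> (w', t') s) = \<rho> (w + w', t + t' + \<omega> w w' / 2) s"
    "\<rho> (0, t) = scS (\<psi> t)" "\<rho> (w, t) s = scS (\<psi> t) (\<rho> (w, 0) s)"
    "openin (prod_topology TW TF) {h. \<rho> h s = s}"
    "(UNIV :: 's set) \<noteq> {0}"
    "module.subspace scS V \<Longrightarrow> (\<And>h. \<rho> h ` V \<subseteq> V) \<Longrightarrow> V = {0} \<or> V = UNIV"
proof -
  have hom: "\<rho> \<in> hom (Heisenberg \<omega>) (GL scS)"
    using assms by (simp add: Heisenberg_model_def smooth_rep_def)
  show "vector_space scS" "\<rho> (0, t) = scS (\<psi> t)" for t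
    using assms by (simp_all add: Heisenberg_model_def smooth_rep_def)
  show "\<rho> h \<in> carrier (GL scS)" using hom by (auto simp: hom_def Heisenberg_def)
  have mult: "\<rho> (w, t) (\<rho> (w', t') s) = \<rho> (w + w', t + t' + \<omega> w w' / 2) s" for w t w' t' s
    using hom by (auto simp: hom_def Heisenberg_def fun_eq_iff)
  show "\<rho> (w, t) (\<rho> (w', t') s) = \<rho> (w + w', t + t' + \<omega> w w' / 2) s" by (rule mult)
  show "\<rho> (w, t) s = scS (\<psi> t) (\<rho> (w, 0) s)"
    using mult[of 0 t w 0 s] assms by (simp add: Heisenberg_model_def omega_zero_left)
  show "openin (prod_topology TW TF) {h. \<rho> h s = s}"
    using assms by (simp add: Heisenberg_model_def smooth_rep_def Heisenberg_topology_def)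
  show "(UNIV :: 's set) \<noteq> {0}"
    "module.subspace scS V \<Longrightarrow> (\<And>h. \<rho> h ` V \<subseteq> V) \<Longrightarrow> V = {0} \<or> V = UNIV"
    using assms by (auto simp: Heisenberg_model_def irreducible_rep_def)
qed

text \<open>The central variable acts by scalars, which preserve every subspace. Irreducibility
  therefore passes to the operators with \<open>t = 0\<close>, and these multiply with cocycle
  \<open>beta\<close>.\<close>

lemma model_projective_rep:
  assumes "model scS \<rho>"
  shows "projective_rep beta J eta scS (\<lambda>w. \<rho> (w, 0))"
proof -
  note m = modelD[OF assms]
  interpret S: vector_space scS by (rule m(1))
  show ?thesis
  proof (intro projective_rep.intro projective_rep_axioms.intro polarised_cocycle_axioms m(1))
    fix w w' s
    show "Vector_Spaces.linear scS scS (\<rho> (w, 0))" using m(2) by (simp add: carrier_GL)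
    show "\<rho> (w, 0) (\<rho> (w', 0) s) = scS (beta w w') (\<rho> (w + w', 0) s)"
      using m(3)[of w 0 w' 0 s] m(5)[of "w + w'" "\<omega> w w' / 2" s] by (simp add: beta_def)
    show "\<rho> (0, 0) s = s" by (simp add: m(4) psi_zero)
    fix V assume V: "S.subspace V" "\<And>w. \<rho> (w, 0) ` V \<subseteq> V"
    have "\<rho> h ` V \<subseteq> V" for h
    proof -
      obtain w t where h: "h = (w, t)" by force
      have "\<rho> h s \<in> V" if "s \<in> V" for s
        using V(2)[of w] that S.subspace_scale[OF V(1)] by (auto simp: h m(5)[of w t])
      then show ?thesis by blast
    qed
    then show "V = {0} \<or> V = UNIV" using m(8) V(1) by blast
  qed
qed

text \<open>By smoothness a nonzero vector is fixed by a small box; shrinking the box below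
  \<open>small_radius\<close> puts it inside \<open>J\<close> and makes \<open>eta\<close> trivial
  on it.\<close>

lemma model_vacuum:
  fixes scS :: "'r \<Rightarrow> 's::ab_group_add \<Rightarrow> 's"
  assumes "model scS \<rho>"
  shows "\<exists>s\<^sub>0. vacuum_rep beta J eta scS (\<lambda>w. \<rho> (w, 0)) s\<^sub>0"
proof -
  note m = modelD[OF assms]
  interpret P: projective_rep beta J eta scS "\<lambda>w. \<rho> (w, 0)"
    by (rule model_projective_rep[OF assms])
  obtain s :: 's where s: "s \<noteq> 0" using m(7) by blast
  have "(0, 0) \<in> {h. \<rho> h s = s}" by (simp add: P.P_zero)
  then obtain U V where UV: "openin TW U" "0 \<in> U" "0 \<in> V" "U \<times> V \<subseteq> {h. \<rho> h s = s}"
    using m(6)[of s] unfolding openin_prod_topology_alt by blast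
  obtain r' where r': "r' > 0" "\<And>w. w \<in> lattice r' \<Longrightarrow> w \<in> U"
    using openin_TW_lattice[OF UV(1,2)] by auto
  define r where "r = min r' small_radius"
  have r: "r > 0" "r \<le> small_radius" "r \<le> r'" using r' small_radius_pos by (auto simp: r_def)
  obtain K where K: "finite K" "\<And>j. j \<in> J \<Longrightarrow> \<exists>k\<in>K. j - k \<in> lattice r"
    using J_finite_index[OF r(1)] by blast
  have stab: "\<rho> (l, 0) s = s" if "l \<in> lattice r" for l
    using r'(2) lattice_mono[OF r(3)] that UV by blast
  show ?thesis
    by (rule P.vacuum_exists[of "lattice r" K s])
      (use lattice_J r lattice_zero lattice_add lattice_uminus K eta_lattice lattice_separated s stab in auto)
qed

lemma model_iso:
  assumes "model scS \<rho>" "model scS' \<rho>'"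
  shows "\<exists>\<phi>. rep_iso scS \<rho> scS' \<rho>' \<phi>"
proof -
  obtain s s' where "vacuum_rep beta J eta scS (\<lambda>w. \<rho> (w, 0)) s"
    "vacuum_rep beta J eta scS' (\<lambda>w. \<rho>' (w, 0)) s'"
    using model_vacuum[OF assms(1)] model_vacuum[OF assms(2)] by blast
  then obtain \<phi> where phi: "Vector_Spaces.linear scS scS' \<phi>" "bij \<phi>"
    "\<And>w. \<phi> \<circ> \<rho> (w, 0) = \<rho>' (w, 0) \<circ> \<phi>"
    using vacuum_rep_iso by blast
  have "\<phi> (\<rho> (w, t) s) = \<rho>' (w, t) (\<phi> s)" for w t s
    using phi(1,3) modelD(5)[OF assms(1), of w t] modelD(5)[OF assms(2), of w t]
    by (simp add: linear_iff_additive fun_eq_iff)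
  then have "rep_iso scS \<rho> scS' \<rho>' \<phi>"
    using phi by (auto simp: rep_iso_def fun_eq_iff)
  then show ?thesis by blast
qed

lemma model_schur:
  assumes "model scS \<rho>" "Vector_Spaces.linear scS scS \<phi>" "\<And>h s. \<phi> (\<rho> h s) = \<rho> h (\<phi> s)"
  shows "\<exists>c. \<phi> = scS c"
  using model_vacuum[OF assms(1)] vacuum_rep.commutant_scalar assms by metis

lemma continuous_linear_map:
  assumes "Vector_Spaces.linear scW scW g"
  shows "continuous_map TW TW g"
proof (rule continuous_map_TW)
  fix l assume "Vector_Spaces.linear scW (*) l"
  from Vector_Spaces.linear_compose[OF assms this]
  show "continuous_map TW TF (\<lambda>x. l (g x))"
    by (intro continuous_linear_form) (simp add: comp_def)
qed

text \<open>Precomposition with a symplectic automorphism leaves the central character unchanged.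
  Comparing \<open>\<rho>\<close> with its twist by the inverse of \<open>g\<close> is what produces
  the intertwiner of \<open>g\<close>.\<close>

lemma model_twist:
  assumes "model scS \<rho>" "g \<in> carrier (Sp scW \<omega>)"
  shows "model scS (\<lambda>(w, t). \<rho> (g w, t))"
proof -
  note m = modelD[OF assms(1)]
  have g: "Vector_Spaces.linear scW scW g" "bij g" "\<omega> (g x) (g y) = \<omega> x y"
    "g (x + y) = g x + g y" "g 0 = 0" for x y
    using assms(2) linear_iff_additive[of scW scW g]
    by (auto simp: carrier_Sp) (metis add_cancel_right_right)
  have "(\<lambda>(w, t). \<rho> (g w, t)) \<in> hom (Heisenberg \<omega>) (GL scS)"
    using m(2) m(3) by (auto simp: hom_def Heisenberg_def g fun_eq_iff)
  moreover have "openin (prod_topology TW TF) {h. (\<lambda>(w, t). \<rho> (g w, t)) h s = s}" for s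
  proof -
    have "continuous_map (prod_topology TW TF) (prod_topology TW TF) (\<lambda>h. (g (fst h), snd h))"
      by (intro continuous_map_pairedI continuous_map_compose[OF continuous_map_fst continuous_linear_map[OF g(1)], unfolded comp_def]
          continuous_map_snd)
    from openin_continuous_map_preimage[OF this m(6)[of s]]
    show ?thesis by (simp add: case_prod_unfold)
  qed
  moreover have "irreducible_rep scS (\<lambda>(w, t). \<rho> (g w, t))"
    unfolding irreducible_rep_def
  proof (intro conjI allI impI m(7))
    fix V assume V: "module.subspace scS V \<and> (\<forall>h. (\<lambda>(w, t). \<rho> (g w, t)) h ` V \<subseteq> V)"
    have "\<rho> (w, t) ` V \<subseteq> V" for w t
      using V bij_comp_inv_into(3)[OF g(2), of w] by (metis case_prod_conv)
    then have "\<rho> h ` V \<subseteq> V" for h by (cases h) simp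
    then show "V = {0} \<or> V = UNIV" using m(8) V by blast
  qed
  ultimately show ?thesis
    using m(1,4) by (simp add: Heisenberg_model_def smooth_rep_def Heisenberg_topology_def g)
qed

lemma intertwiner_exists:
  assumes "model scS \<rho>" "g \<in> carrier (Sp scW \<omega>)"
  shows "\<exists>M\<in>carrier (GL scS). intertwines \<rho> g M"
proof -
  obtain \<phi> where phi: "rep_iso scS \<rho> scS (\<lambda>(w, t). \<rho> (inv_into UNIV g w, t)) \<phi>"
    using model_iso[OF assms(1) model_twist[OF assms(1) Sp_inv[OF assms(2)]]] by blast
  then have "bij \<phi>" by (simp add: rep_iso_def)
  then show ?thesis
    using phi by (intro bexI[of _ \<phi>]) (auto simp: rep_iso_def carrier_GL intertwines_iff fun_eq_iff)
qed

lemma intertwines_scale: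
  assumes "model scS \<rho>" "M \<in> carrier (GL scS)" "intertwines \<rho> g M" "c \<noteq> 0"
  shows "intertwines \<rho> g (scS c \<circ> M)"
proof -
  interpret S: vector_space scS by (rule modelD(1)[OF assms(1)])
  have "bij (scS c \<circ> M)" "bij M"
    using S.GL_comp[OF S.scale_GL[OF assms(4)] assms(2)] assms(2) by (simp_all add: carrier_GL)
  then show ?thesis
    using assms(3) S.GL_scale[OF modelD(2)[OF assms(1)]] by (simp add: intertwines_iff)
qed

text \<open>The quotient of two intertwiners commutes with the Heisenberg group, hence is a scalar
  by Schur. It is nonzero because \<open>M\<close> is injective on a nonzero space.\<close>

lemma intertwiner_unique:
  fixes scS :: "'r \<Rightarrow> 's::ab_group_add \<Rightarrow> 's"
  assumes "model scS \<rho>" and M: "M \<in> carrier (GL scS)" and N: "N \<in> carrier (GL scS)"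
    and iM: "intertwines \<rho> g M" and iN: "intertwines \<rho> g N"
  shows "red scS M = red scS N"
proof -
  interpret S: vector_space scS by (rule modelD(1)[OF assms(1)])
  have bij: "bij M" "bij N" using M N by (simp_all add: carrier_GL)
  let ?\<phi> = "inv_into UNIV N \<circ> M"
  have phi: "?\<phi> \<in> carrier (GL scS)" using M N S.GL_comp S.GL_inv by blast
  have "?\<phi> (\<rho> (w, t) s) = \<rho> (w, t) (?\<phi> s)" for w t s
  proof -
    have "N (\<rho> (w, t) (?\<phi> s)) = \<rho> (inv_into UNIV g w, t) (M s)"
      using iN bij by (simp add: intertwines_iff bij_comp_inv_into)
    also have "\<dots> = M (\<rho> (w, t) s)" using iM bij by (simp add: intertwines_iff)
    finally show ?thesis using bij_comp_inv_into(4)[OF bij(2)] by (metis comp_apply)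
  qed
  then have "?\<phi> (\<rho> h s) = \<rho> h (?\<phi> s)" for h s by (cases h) simp
  then obtain c where c: "?\<phi> = scS c"
    using model_schur[OF assms(1), of ?\<phi>] phi by (auto simp: carrier_GL)
  have "M x = scS c (N x)" for x
  proof -
    have "M x = N (?\<phi> x)" using bij by (simp add: bij_comp_inv_into)
    then show ?thesis unfolding c using S.GL_scale[OF N] by simp
  qed
  then have M_eq: "M = scS c \<circ> N" by auto
  have "c \<noteq> 0"
  proof
    assume "c = 0"
    then have "M x = M y" for x y by (simp add: M_eq)
    then have "x = y" for x y :: 's using bij(1) by (auto simp: bij_def inj_def)
    then show False using modelD(7)[OF assms(1)] by blast
  qed
  then show ?thesis using M_eq by (auto simp: S.red_eq_iff)
qed

text \<open>Existence and uniqueness of intertwiners remove the choice in \<open>sigma_S\<close>;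
  membership in the fibre product becomes the intertwining relation itself.\<close>

lemma sigma_eq_red_iff:
  assumes "model scS \<rho>" "g \<in> carrier (Sp scW \<omega>)" "M \<in> carrier (GL scS)"
  shows "sigma_S scS \<rho> g = red scS M \<longleftrightarrow> intertwines \<rho> g M"
proof -
  interpret S: vector_space scS by (rule modelD(1)[OF assms(1)])
  define N where "N = (SOME M. M \<in> carrier (GL scS) \<and> intertwines \<rho> g M)"
  have N: "N \<in> carrier (GL scS)" "intertwines \<rho> g N"
    using someI_ex[of "\<lambda>M. M \<in> carrier (GL scS) \<and> intertwines \<rho> g M"]
      intertwiner_exists[OF assms(1,2)] by (auto simp: N_def)
  have "sigma_S scS \<rho> g = red scS N" by (simp add: sigma_S_def N_def)
  moreover have "intertwines \<rho> g M" if eq: "red scS N = red scS M"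
  proof -
    obtain c where "c \<noteq> 0" "M = scS c \<circ> N" using eq S.red_eq_iff[of M N] by auto
    then show ?thesis using intertwines_scale[OF assms(1) N] by simp
  qed
  ultimately show ?thesis using intertwiner_unique[OF assms(1) N(1) assms(3) N(2)] by auto
qed

lemma lattice_scale_sum:
  assumes "r > 0" "C > 0" "\<And>i. i \<in> I \<Longrightarrow> v (c i) \<le> C" "\<And>i. i \<in> I \<Longrightarrow> x i \<in> lattice r"
  shows "(\<Sum>i\<in>I. scW (c i) (x i)) \<in> lattice (C * r)"
  unfolding lattice_def
proof (intro CollectI allI impI conjI)
  fix k assume "k < n"
  then show "v (\<omega> (\<Sum>i\<in>I. scW (c i) (x i)) (f k)) < C * r" "v (\<omega> (e k) (\<Sum>i\<in>I. scW (c i) (x i))) < C * r"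
    using assms by (auto simp: omega_sum_left omega_sum_right omega_scale_left omega_scale_right lattice_def
        intro!: v_sum_less v_mult_less)
qed

text \<open>An element of \<open>Sp(W)\<close> close to the identity preserves \<open>(J, eta)\<close>, so its intertwiners preserve
  the line of vacuum vectors; normalised to fix one vacuum vector, an intertwiner also fixes
  the translates of that vector by a prescribed finite set.\<close>

lemma intertwiner_fixing:
  assumes model: "model scS \<rho>" and "finite X"
  shows "\<exists>A r. finite A \<and> r > 0 \<and> (\<forall>g\<in>carrier (Sp scW \<omega>). (\<forall>w\<in>A. g w - w \<in> lattice r) \<longrightarrow>
    (\<exists>M\<in>carrier (GL scS). intertwines \<rho> g M \<and> (\<forall>x\<in>X. M x = x)))"
proof -
  obtain s\<^sub>0 where "vacuum_rep beta J eta scS (\<lambda>w. \<rho> (w, 0)) s\<^sub>0"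
    using model_vacuum[OF model] by blast
  then interpret P: vacuum_rep beta J eta scS "\<lambda>w. \<rho> (w, 0)" s\<^sub>0 .
  let ?P = "\<lambda>w. \<rho> (w, 0)"
  obtain A\<^sub>0 where A0: "finite A\<^sub>0" "X \<subseteq> P.span ((\<lambda>w. ?P w s\<^sub>0) ` A\<^sub>0)"
  proof -
    \<comment> \<open>Each vector of \<open>X\<close> is a finite combination of translates of the
      vacuum vector, so it is enough to fix those translates.\<close>
    have "\<exists>A. finite A \<and> X \<subseteq> P.span ((\<lambda>w. ?P w s\<^sub>0) ` A)"
      using \<open>finite X\<close>
    proof (induction X rule: finite_induct)
      case (insert x X)
      then obtain A where A: "finite A" "X \<subseteq> P.span ((\<lambda>w. ?P w s\<^sub>0) ` A)" by blast
      obtain T where T: "finite T" "T \<subseteq> range (\<lambda>w. ?P w s\<^sub>0)" "x \<in> P.span T"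
        using P.span_finite_subset[of x "range (\<lambda>w. ?P w s\<^sub>0)"] P.span_orbit[OF P.s0_nonzero] by auto
      obtain B where B: "finite B" "T = (\<lambda>w. ?P w s\<^sub>0) ` B"
        using finite_subset_image[OF T(1,2)] by blast
      have "insert x X \<subseteq> P.span ((\<lambda>w. ?P w s\<^sub>0) ` (A \<union> B))"
        using A(2) T(3) B(2) P.span_mono[of T "(\<lambda>w. ?P w s\<^sub>0) ` (A \<union> B)"]
          P.span_mono[of "(\<lambda>w. ?P w s\<^sub>0) ` A" "(\<lambda>w. ?P w s\<^sub>0) ` (A \<union> B)"] by auto
      then show ?case using A(1) B(1) by blast
    qed auto
    then show ?thesis using that by blast
  qed
  \<comment> \<open>A common bound for all coordinates of elements of \<open>J\<close>.\<close>
  define C where "C = max (v a) 1"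
  have C: "C \<ge> 1" "v a \<le> C" by (simp_all add: C_def)
  \<comment> \<open>For a displacement \<open>l\<close> of size \<open>s\<close>,
    \<open>s \<le> small_radius\<close> gives \<open>l \<in> J\<close> and \<open>eta l = 1\<close>,
    and \<open>C * s \<le> v a * v 2\<close> gives \<open>beta j l = 1\<close> for every
    \<open>j\<close> in \<open>J\<close>.\<close>
  define s where "s = min small_radius (v a * v 2 / C)"
  have s: "s > 0" "s \<le> small_radius" "C * s \<le> v a * v 2"
    using small_radius_pos va_pos v2_pos C(1) by (auto simp: s_def min_def field_simps)
  have beta_one: "beta w l = 1" if "v (\<omega> w l) < v a * v 2" for w l
    unfolding beta_def by (rule psi_small) (use that v2_pos in \<open>simp add: v_divide field_simps\<close>)
  obtain r\<^sub>2 where r2: "r\<^sub>2 > 0" "\<And>w l. w \<in> A\<^sub>0 \<Longrightarrow> l \<in> lattice r\<^sub>2 \<Longrightarrow> v (\<omega> w l) < v a * v 2"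
  proof -
    \<comment> \<open>The elements of \<open>A\<^sub>0\<close> need not have coordinates bounded by
      \<open>C\<close>, but there are finitely many of them, so one box serves for all.\<close>
    have "\<exists>r>0. \<forall>w\<in>A\<^sub>0. \<forall>l\<in>lattice r. v (\<omega> w l) < v a * v 2"
      using A0(1)
    proof (induction A\<^sub>0 rule: finite_induct)
      case empty
      show ?case by (intro exI[of _ 1]) auto
    next
      case (insert x A)
      then obtain r where "r > 0" "\<forall>w\<in>A. \<forall>l\<in>lattice r. v (\<omega> w l) < v a * v 2" by blast
      moreover obtain r' where "r' > 0" "\<forall>l\<in>lattice r'. v (\<omega> x l) < v a * v 2"
        using linear_form_small[OF linear_right, of "v a * v 2" x] va_pos v2_pos by auto
      ultimately show ?case
        using lattice_mono[of "min r r'" r] lattice_mono[of "min r r'" r']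
        by (intro exI[of _ "min r r'"]) auto
    qed
    then show ?thesis using that by blast
  qed
  define r where "r = min (s / C) (min r\<^sub>2 small_radius)"
  have r: "r > 0" "r \<le> r\<^sub>2" "r \<le> small_radius" "C * r \<le> s"
  proof -
    show "r > 0" "r \<le> r\<^sub>2" "r \<le> small_radius" using s C r2(1) small_radius_pos by (auto simp: r_def)
    have "r \<le> s / C" by (simp add: r_def)
    then show "C * r \<le> s" using C(1) by (simp add: field_simps)
  qed
  \<comment> \<open>The basis vectors control \<open>g\<close> on all of \<open>J\<close>: the
    displacement of \<open>j\<close> is a combination of theirs with coefficients bounded by
    \<open>C\<close>, hence lies in the box of radius \<open>C * r \<le> s\<close>.\<close>
  let ?A = "A\<^sub>0 \<union> e ` {..<n} \<union> f ` {..<n}"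
  have fixing: "\<exists>M\<in>carrier (GL scS). intertwines \<rho> g M \<and> (\<forall>x\<in>X. M x = x)"
    if g: "g \<in> carrier (Sp scW \<omega>)" and close: "\<forall>w\<in>?A. g w - w \<in> lattice r" for g
  proof -
    have bij_g: "bij g" using g by (simp add: carrier_Sp)
    interpret g: Vector_Spaces.linear scW scW g using g by (simp add: carrier_Sp)
    have move_J: "g j - j \<in> lattice s" if j: "j \<in> J" for j
    proof -
      have "g j - j = (\<Sum>i<n. scW (\<omega> j (f i)) (g (e i) - e i)) + (\<Sum>i<n. scW (\<omega> (e i) j) (g (f i) - f i))"
      proof -
        have "g j = (\<Sum>i<n. scW (\<omega> j (f i)) (g (e i)) + scW (\<omega> (e i) j) (g (f i)))"
          by (subst expansion[of j]) (simp add: g.sum g.add g.scale)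
        moreover have "j = (\<Sum>i<n. scW (\<omega> j (f i)) (e i) + scW (\<omega> (e i) j) (f i))"
          by (rule expansion)
        ultimately have "g j - j = (\<Sum>i<n. scW (\<omega> j (f i)) (g (e i)) + scW (\<omega> (e i) j) (g (f i))) -
          (\<Sum>i<n. scW (\<omega> j (f i)) (e i) + scW (\<omega> (e i) j) (f i))" by simp
        then show ?thesis
          by (simp add: sum_subtractf[symmetric] sum.distrib[symmetric] scale_right_diff_distrib algebra_simps)
      qed
      also have "\<dots> \<in> lattice (C * r)"
      proof (intro lattice_add lattice_scale_sum r(1))
        fix i assume i: "i \<in> {..<n}"
        show "v (\<omega> j (f i)) \<le> C" "v (\<omega> (e i) j) \<le> C" using i j C by (force simp: J_def)+
        show "g (e i) - e i \<in> lattice r" "g (f i) - f i \<in> lattice r" using i close by blast+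
      qed (use C in simp_all)
      finally show ?thesis using lattice_mono[OF r(4)] by blast
    qed
    \<comment> \<open>Both scalar factors in \<open>P_translate\<close> are 1 for this displacement,
      so the translates by \<open>g j\<close> and \<open>j\<close> agree as vectors and not only up
      to a scalar.\<close>
    have fix_J: "?P (g j) s\<^sub>0 = ?P j s\<^sub>0" if j: "j \<in> J" for j
    proof -
      let ?l = "g j - j"
      have l: "?l \<in> lattice s" by (rule move_J[OF j])
      have "v (\<omega> j ?l) < C * s"
        unfolding omega_expansion[of j ?l]
      proof (rule v_sum_less, use C s in simp, rule v_diff_less)
        fix i assume i: "i \<in> {..<n}"
        show "v (\<omega> j (f i) * \<omega> (e i) ?l) < C * s" "v (\<omega> (e i) j * \<omega> ?l (f i)) < C * s"
          by (intro v_mult_less; use i j l C in \<open>force simp: J_def lattice_def\<close>)+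
      qed
      then have "beta j ?l = 1" using s(3) by (intro beta_one) simp
      moreover have "eta ?l = 1" by (rule eta_lattice[OF s(2) l])
      moreover have "?l \<in> J" using lattice_J[OF s(2)] l by blast
      ultimately show ?thesis using P.P_translate[of ?l j] by simp
    qed
    have fix_A: "?P (g w) s\<^sub>0 = ?P w s\<^sub>0" if w: "w \<in> A\<^sub>0" for w
    proof -
      let ?l = "g w - w"
      have l: "?l \<in> lattice r" using close w by blast
      then have "beta w ?l = 1" using r2(2)[OF w] lattice_mono[OF r(2)] by (intro beta_one) blast
      moreover have "eta ?l = 1" by (rule eta_lattice[OF r(3) l])
      moreover have "?l \<in> J" using lattice_J[OF r(3)] l by blast
      ultimately show ?thesis using P.P_translate[of ?l w] by simp
    qed
    obtain M\<^sub>0 where M0: "M\<^sub>0 \<in> carrier (GL scS)" "intertwines \<rho> g M\<^sub>0"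
      using intertwiner_exists[OF model g] by blast
    have M0_P: "?P w (M\<^sub>0 x) = M\<^sub>0 (?P (g w) x)" for w x
      using M0 bij_comp_inv_into(4)[OF bij_g, of w] by (simp add: carrier_GL intertwines_iff)
    have M0_0: "M\<^sub>0 s\<^sub>0 \<noteq> 0"
    proof -
      have "inj M\<^sub>0" "M\<^sub>0 0 = 0"
        using M0(1) P.GL_scale[OF M0(1), of 0 s\<^sub>0] by (simp_all add: carrier_GL bij_def)
      then show ?thesis using P.s0_nonzero by (auto simp: inj_def)
    qed
    \<comment> \<open>Moving the operator of \<open>j\<close> through \<open>M\<^sub>0\<close> turns
      it into the operator of \<open>g j\<close>, which acts on the vacuum vector as that of
      \<open>j\<close> does by \<open>fix_J\<close>.\<close>
    have "vacuum_rep beta J eta scS ?P (M\<^sub>0 s\<^sub>0)"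
    proof unfold_locales
      show "M\<^sub>0 s\<^sub>0 \<noteq> 0" by (rule M0_0)
      show "?P j (M\<^sub>0 s\<^sub>0) = scS (eta j) (M\<^sub>0 s\<^sub>0)" if "j \<in> J" for j
        using fix_J[OF that] P.P_s0[OF that] P.GL_scale[OF M0(1)] by (simp add: M0_P)
    qed
    \<comment> \<open>Vacuum vectors form a line: the automorphism carrying one to another commutes
      with the representation, hence is a scalar.\<close>
    then obtain \<phi> where phi: "Vector_Spaces.linear scS scS \<phi>" "\<phi> s\<^sub>0 = M\<^sub>0 s\<^sub>0"
      "\<And>w. \<phi> \<circ> ?P w = ?P w \<circ> \<phi>"
      using vacuum_rep_iso[OF P.vacuum_rep_axioms] by blast
    then obtain c where "\<phi> = scS c"
      using P.commutant_scalar[OF phi(1)] by (auto simp: fun_eq_iff)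
    then have c: "M\<^sub>0 s\<^sub>0 = scS c s\<^sub>0" "c \<noteq> 0" using phi(2) M0_0 by auto
    define M where "M = scS (1 / c) \<circ> M\<^sub>0"
    have M: "M \<in> carrier (GL scS)" "intertwines \<rho> g M"
      using P.GL_comp P.scale_GL M0 intertwines_scale[OF model M0] c(2) by (auto simp: M_def)
    have M_P: "?P w (M x) = M (?P (g w) x)" for w x
      using M bij_comp_inv_into(4)[OF bij_g, of w] by (simp add: carrier_GL intertwines_iff)
    have M_s0: "M s\<^sub>0 = s\<^sub>0" using c by (simp add: M_def)
    have M_fix: "M (?P w s\<^sub>0) = ?P w s\<^sub>0" if "w \<in> A\<^sub>0" for w
      using M_P[of w s\<^sub>0] by (simp add: fix_A[OF that] M_s0)
    have "M x = x" if "x \<in> X" for x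
    proof -
      interpret pair: vector_space_pair scS scS ..
      have "M x = id x"
        by (rule pair.linear_eq_on[of M id x "(\<lambda>w. ?P w s\<^sub>0) ` A\<^sub>0"])
          (use M(1) P.linear_id A0(2) that M_fix in \<open>auto simp: carrier_GL\<close>)
      then show ?thesis by simp
    qed
    then show ?thesis using M by blast
  qed
  show ?thesis
    by (rule exI[of _ ?A], rule exI[of _ r]) (use A0(1) r(1) fixing in simp)
qed

end

section \<open>Topological groups\<close>

lemma topological_groupD:
  assumes "topological_group G T"
  shows "group G" "topspace T = carrier G"
    "continuous_map (prod_topology T T) T (\<lambda>(x, y). x \<otimes>\<^bsub>G\<^esub> y)" "continuous_map T T (\<lambda>x. inv\<^bsub>G\<^esub> x)"
  using assms by (auto simp: topological_group_def)

lemma continuous_map_group_mult: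
  assumes "topological_group G T" "continuous_map X T f" "continuous_map X T g"
  shows "continuous_map X T (\<lambda>x. f x \<otimes>\<^bsub>G\<^esub> g x)"
proof -
  have "continuous_map X (prod_topology T T) (\<lambda>x. (f x, g x))"
    using assms(2,3) by (rule continuous_map_pairedI)
  from continuous_map_compose[OF this topological_groupD(3)[OF assms(1)]]
  show ?thesis by (simp add: comp_def)
qed

lemma continuous_map_group_inv:
  assumes "topological_group G T" "continuous_map X T f"
  shows "continuous_map X T (\<lambda>x. inv\<^bsub>G\<^esub> f x)"
  using continuous_map_compose[OF assms(2) topological_groupD(4)[OF assms(1)]] by (simp add: comp_def)

lemma topological_groupI:
  assumes "group G" "topspace T = carrier G"
    "continuous_map (prod_topology T T) T (\<lambda>p. fst p \<otimes>\<^bsub>G\<^esub> snd p)" "continuous_map T T (\<lambda>x. inv\<^bsub>G\<^esub> x)"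
  shows "topological_group G T"
  using assms by (simp add: topological_group_def case_prod_unfold)

lemma topological_group_DirProd:
  assumes "topological_group G TG" "topological_group H TH"
  shows "topological_group (G \<times>\<times> H) (prod_topology TG TH)"
proof (rule topological_groupI)
  let ?T = "prod_topology TG TH"
  note G = topological_groupD[OF assms(1)] and H = topological_groupD[OF assms(2)]
  show "group (G \<times>\<times> H)" using G(1) H(1) by (rule DirProd_group)
  show top: "topspace ?T = carrier (G \<times>\<times> H)" using G(2) H(2) by simp
  have c: "continuous_map (prod_topology ?T ?T) TG (\<lambda>p. fst (fst p))"
    "continuous_map (prod_topology ?T ?T) TG (\<lambda>p. fst (snd p))"
    "continuous_map (prod_topology ?T ?T) TH (\<lambda>p. snd (fst p))"
    "continuous_map (prod_topology ?T ?T) TH (\<lambda>p. snd (snd p))"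
    by (intro continuous_map_compose[OF continuous_map_fst continuous_map_fst, unfolded comp_def]
        continuous_map_compose[OF continuous_map_snd continuous_map_fst, unfolded comp_def]
        continuous_map_compose[OF continuous_map_fst continuous_map_snd, unfolded comp_def]
        continuous_map_compose[OF continuous_map_snd continuous_map_snd, unfolded comp_def])+
  show "continuous_map (prod_topology ?T ?T) ?T (\<lambda>p. fst p \<otimes>\<^bsub>G \<times>\<times> H\<^esub> snd p)"
    unfolding mult_DirProd'
    by (intro continuous_map_pairedI continuous_map_group_mult[OF assms(1)]
        continuous_map_group_mult[OF assms(2)] c)
  have "continuous_map ?T ?T (\<lambda>p. (inv\<^bsub>G\<^esub> fst p, inv\<^bsub>H\<^esub> snd p))"
    by (intro continuous_map_pairedI continuous_map_group_inv[OF assms(1)]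
        continuous_map_group_inv[OF assms(2)] continuous_map_fst continuous_map_snd)
  then show "continuous_map ?T ?T (\<lambda>x. inv\<^bsub>G \<times>\<times> H\<^esub> x)"
    by (rule continuous_map_eq) (use G H in auto)
qed

lemma topological_subgroup_subtopology:
  assumes G: "topological_group G T" and S: "subgroup S G"
  shows "topological_subgroup (G\<lparr>carrier := S\<rparr>) (subtopology T S) G T"
proof -
  note GD = topological_groupD[OF G]
  let ?H = "G\<lparr>carrier := S\<rparr>" and ?T = "subtopology T S"
  have sub: "S \<subseteq> carrier G" using S by (rule subgroup.subset)
  have "topological_group ?H ?T"
  proof (rule topological_groupI)
    show "group ?H" using subgroup.subgroup_is_group[OF S GD(1)] .
    show top: "topspace ?T = carrier ?H" using GD(2) sub by auto
    have proj: "continuous_map (prod_topology ?T ?T) T fst" "continuous_map (prod_topology ?T ?T) T snd"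
      using continuous_map_fst[of ?T ?T] continuous_map_snd[of ?T ?T]
      by (simp_all add: continuous_map_in_subtopology)
    have "continuous_map (prod_topology ?T ?T) T (\<lambda>p. fst p \<otimes>\<^bsub>G\<^esub> snd p)"
      by (rule continuous_map_group_mult[OF G proj])
    then show "continuous_map (prod_topology ?T ?T) ?T (\<lambda>p. fst p \<otimes>\<^bsub>?H\<^esub> snd p)"
      using top subgroup.m_closed[OF S] by (auto simp: continuous_map_in_subtopology)
    have "continuous_map ?T T (\<lambda>x. inv\<^bsub>G\<^esub> x)"
      using GD(4) by (rule continuous_map_from_subtopology)
    then have "continuous_map ?T ?T (\<lambda>x. inv\<^bsub>G\<^esub> x)"
      using top subgroup.m_inv_closed[OF S] by (auto simp: continuous_map_in_subtopology)
    then show "continuous_map ?T ?T (\<lambda>x. inv\<^bsub>?H\<^esub> x)"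
      by (rule continuous_map_eq) (use top group.m_inv_consistent[OF GD(1) S] in auto)
  qed
  then show ?thesis using G S by (simp add: topological_subgroup_def)
qed

lemma fibre_product_subgroup:
  assumes "group G\<^sub>1" "group G\<^sub>2" "group G\<^sub>0" "f\<^sub>1 \<in> hom G\<^sub>1 G\<^sub>0" "f\<^sub>2 \<in> hom G\<^sub>2 G\<^sub>0"
  shows "subgroup {(x, y). x \<in> carrier G\<^sub>1 \<and> y \<in> carrier G\<^sub>2 \<and> f\<^sub>1 x = f\<^sub>2 y} (G\<^sub>1 \<times>\<times> G\<^sub>2)"
proof -
  interpret f1: group_hom G\<^sub>1 G\<^sub>0 f\<^sub>1 using assms by (simp add: group_hom_def group_hom_axioms_def)
  interpret f2: group_hom G\<^sub>2 G\<^sub>0 f\<^sub>2 using assms by (simp add: group_hom_def group_hom_axioms_def)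
  interpret P: group "G\<^sub>1 \<times>\<times> G\<^sub>2" using assms by (intro DirProd_group)
  show ?thesis
    by (rule P.subgroupI) (use assms(1,2) in \<open>auto intro!: exI[of _ "\<one>\<^bsub>G\<^sub>1\<^esub>"] exI[of _ "\<one>\<^bsub>G\<^sub>2\<^esub>"]\<close>)
qed

lemma fibre_product_is_fibre_product:
  assumes G1: "topological_group G\<^sub>1 T\<^sub>1" and G2: "topological_group G\<^sub>2 T\<^sub>2"
    and G0: "topological_group G\<^sub>0 T\<^sub>0"
    and f1: "continuous_hom G\<^sub>1 T\<^sub>1 G\<^sub>0 T\<^sub>0 f\<^sub>1" and f2: "continuous_hom G\<^sub>2 T\<^sub>2 G\<^sub>0 T\<^sub>0 f\<^sub>2"
  defines "C \<equiv> {(x, y). x \<in> carrier G\<^sub>1 \<and> y \<in> carrier G\<^sub>2 \<and> f\<^sub>1 x = f\<^sub>2 y}"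
  shows "is_fibre_product TYPE('k) ((G\<^sub>1 \<times>\<times> G\<^sub>2)\<lparr>carrier := C\<rparr>) (subtopology (prod_topology T\<^sub>1 T\<^sub>2) C)
      fst snd G\<^sub>1 T\<^sub>1 G\<^sub>2 T\<^sub>2 G\<^sub>0 T\<^sub>0 f\<^sub>1 f\<^sub>2"
proof -
  let ?P = "(G\<^sub>1 \<times>\<times> G\<^sub>2)\<lparr>carrier := C\<rparr>" and ?T = "subtopology (prod_topology T\<^sub>1 T\<^sub>2) C"
  have "subgroup C (G\<^sub>1 \<times>\<times> G\<^sub>2)"
    unfolding C_def using assms(1-5)
    by (intro fibre_product_subgroup) (auto simp: topological_group_def continuous_hom_def)
  then have P: "topological_group ?P ?T"
    using topological_subgroup_subtopology[OF topological_group_DirProd[OF G1 G2]]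
    by (simp add: topological_subgroup_def)
  have fst: "continuous_hom ?P ?T G\<^sub>1 T\<^sub>1 fst" and snd: "continuous_hom ?P ?T G\<^sub>2 T\<^sub>2 snd"
    by (auto simp: continuous_hom_def hom_def C_def mult_DirProd'
        intro!: continuous_map_from_subtopology continuous_map_fst continuous_map_snd)
  have univ: "\<exists>u. continuous_hom K TK ?P ?T u \<and>
             (\<forall>x\<in>carrier K. fst (u x) = a x \<and> snd (u x) = b x) \<and>
             (\<forall>u'. continuous_hom K TK ?P ?T u' \<and>
                   (\<forall>x\<in>carrier K. fst (u' x) = a x \<and> snd (u' x) = b x) \<longrightarrow>
                   (\<forall>x\<in>carrier K. u' x = u x))"
    if K: "topological_group K TK" and a: "continuous_hom K TK G\<^sub>1 T\<^sub>1 a"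
      and b: "continuous_hom K TK G\<^sub>2 T\<^sub>2 b" and ab: "\<forall>x\<in>carrier K. f\<^sub>1 (a x) = f\<^sub>2 (b x)"
    for K :: "'k monoid" and TK a b
  proof (rule exI[of _ "\<lambda>x. (a x, b x)"], intro conjI allI impI)
    have "(\<lambda>x. (a x, b x)) \<in> hom K ?P"
      using a b ab by (auto simp: continuous_hom_def hom_def C_def)
    moreover have "continuous_map TK ?T (\<lambda>x. (a x, b x))"
      using a b ab topological_groupD(2)[OF K]
      by (auto simp: continuous_hom_def hom_def C_def continuous_map_in_subtopology
          intro!: continuous_map_pairedI)
    ultimately show "continuous_hom K TK ?P ?T (\<lambda>x. (a x, b x))"
      by (simp add: continuous_hom_def)
  qed (auto simp: prod_eq_iff)
  show ?thesis
    unfolding is_fibre_product_def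
  proof (intro conjI allI impI G1 G2 G0 f1 f2 P fst snd)
    show "\<forall>x\<in>carrier ?P. f\<^sub>1 (fst x) = f\<^sub>2 (snd x)"
    proof
      fix x assume "x \<in> carrier ?P"
      then have "x \<in> C" by simp
      then show "f\<^sub>1 (fst x) = f\<^sub>2 (snd x)" unfolding C_def by force
    qed
  qed (elim conjE, rule univ)
qed

text \<open>Open maps are stable under base change: around a point of the fibre product, the first
  coordinates lifted by a box \<open>A \<times> B\<close> are those \<open>z\<close> in
  \<open>A\<close> with \<open>f\<^sub>1 z\<close> in the open set \<open>f\<^sub>2\<close> applied
  to \<open>B\<close>.\<close>

lemma fibre_product_open_fst:
  assumes f1: "continuous_map T\<^sub>1 T\<^sub>0 f\<^sub>1" and open2: "open_map T\<^sub>2 T\<^sub>0 f\<^sub>2"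
  shows "open_map (subtopology (prod_topology T\<^sub>1 T\<^sub>2)
      {(x, y). x \<in> topspace T\<^sub>1 \<and> y \<in> topspace T\<^sub>2 \<and> f\<^sub>1 x = f\<^sub>2 y}) T\<^sub>1 fst"
  unfolding open_map_def
proof (intro allI impI)
  let ?C = "{(x, y). x \<in> topspace T\<^sub>1 \<and> y \<in> topspace T\<^sub>2 \<and> f\<^sub>1 x = f\<^sub>2 y}"
  fix U assume "openin (subtopology (prod_topology T\<^sub>1 T\<^sub>2) ?C) U"
  then obtain W where W: "openin (prod_topology T\<^sub>1 T\<^sub>2) W" "U = W \<inter> ?C"
    by (auto simp: openin_subtopology)
  show "openin T\<^sub>1 (fst ` U)"
  proof (subst openin_subopen, intro ballI)
    fix x assume "x \<in> fst ` U"
    then obtain y where xy: "(x, y) \<in> W" "(x, y) \<in> ?C" by (auto simp: W(2))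
    from W(1)[unfolded openin_prod_topology_alt, rule_format, OF xy(1)]
    obtain A B where AB: "openin T\<^sub>1 A" "openin T\<^sub>2 B" "x \<in> A" "y \<in> B" "A \<times> B \<subseteq> W"
      by (elim exE conjE)
    let ?N = "A \<inter> {z \<in> topspace T\<^sub>1. f\<^sub>1 z \<in> f\<^sub>2 ` B}"
    have "openin T\<^sub>1 ?N"
      using AB f1 open2 by (intro openin_Int openin_continuous_map_preimage[OF f1]) (auto simp: open_map_def)
    moreover have "x \<in> ?N" using AB xy(2) by auto
    moreover have "?N \<subseteq> fst ` U"
    proof
      fix z assume "z \<in> ?N"
      then obtain y' where "z \<in> A" "z \<in> topspace T\<^sub>1" "y' \<in> B" "f\<^sub>1 z = f\<^sub>2 y'" by auto
      then have "(z, y') \<in> U" using AB(2,5) openin_subset by (auto simp: W(2))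
      then show "z \<in> fst ` U" by force
    qed
    ultimately show "\<exists>N. openin T\<^sub>1 N \<and> x \<in> N \<and> N \<subseteq> fst ` U" by blast
  qed
qed

section \<open>Quotients of topological groups\<close>

definition quotient_group_topology :: "'a monoid \<Rightarrow> 'a set \<Rightarrow> 'a topology \<Rightarrow> 'a set topology" where
  "quotient_group_topology G N T =
     topology (\<lambda>U. U \<subseteq> carrier (G Mod N) \<and> openin T {x \<in> carrier G. N #>\<^bsub>G\<^esub> x \<in> U})"

context
  fixes G (structure) and N :: "'a set" and T :: "'a topology"
  assumes G: "topological_group G T" and N: "N \<lhd> G"
begin

interpretation normal N G by (rule N)

lemma openin_quotient_group:
  "openin (quotient_group_topology G N T) U \<longleftrightarrow>
    U \<subseteq> carrier (G Mod N) \<and> openin T {x \<in> carrier G. N #> x \<in> U}"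
proof -
  have eq: "{x \<in> carrier G. N #> x \<in> A \<inter> B} =
      {x \<in> carrier G. N #> x \<in> A} \<inter> {x \<in> carrier G. N #> x \<in> B}" for A B
    by auto
  have Eq: "{x \<in> carrier G. N #> x \<in> \<Union>\<K>} = (\<Union>A\<in>\<K>. {x \<in> carrier G. N #> x \<in> A})" for \<K>
    by auto
  have "istopology (\<lambda>U. U \<subseteq> carrier (G Mod N) \<and> openin T {x \<in> carrier G. N #> x \<in> U})"
    unfolding istopology_def eq Eq by (auto intro!: openin_Int openin_Union)
  then show ?thesis by (simp add: quotient_group_topology_def topology_inverse')
qed

lemma coset_in_quotient: "x \<in> carrier G \<Longrightarrow> N #> x \<in> carrier (G Mod N)"
  by (auto simp: carrier_FactGroup)

lemma topspace_quotient_group: "topspace (quotient_group_topology G N T) = carrier (G Mod N)"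
proof -
  have "{x \<in> carrier G. N #> x \<in> carrier (G Mod N)} = topspace T"
    using coset_in_quotient topological_groupD(2)[OF G] by auto
  then have "openin (quotient_group_topology G N T) (carrier (G Mod N))"
    by (simp add: openin_quotient_group)
  then show ?thesis
    using openin_subset openin_quotient_group[of "topspace (quotient_group_topology G N T)"] by blast
qed

lemma continuous_coset_map: "continuous_map T (quotient_group_topology G N T) ((#>) N)"
  unfolding continuous_map_def topspace_quotient_group
  using topological_groupD(2)[OF G] coset_in_quotient by (auto simp: openin_quotient_group)

text \<open>The saturation of an open set is a union of its preimages under left multiplications by
  elements of \<open>N\<close>, each of which is continuous.\<close>

lemma open_coset_map: "open_map T (quotient_group_topology G N T) ((#>) N)"
  unfolding open_map_def
proof (intro allI impI)
  fix U assume U: "openin T U"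
  have sub: "U \<subseteq> carrier G" using openin_subset[OF U] topological_groupD(2)[OF G] by simp
  have eq: "{x \<in> carrier G. N #> x \<in> (#>) N ` U} = (\<Union>h\<in>N. {x \<in> topspace T. h \<otimes> x \<in> U})"
  proof (intro equalityI subsetI)
    fix x assume "x \<in> {x \<in> carrier G. N #> x \<in> (#>) N ` U}"
    then obtain u where u: "x \<in> carrier G" "u \<in> U" "N #> x = N #> u" by auto
    then have "u \<in> N #> x" using rcos_self[of u] sub subgroup_axioms by auto
    then obtain h where "h \<in> N" "u = h \<otimes> x" by (auto simp: r_coset_def)
    then show "x \<in> (\<Union>h\<in>N. {x \<in> topspace T. h \<otimes> x \<in> U})"
      using u topological_groupD(2)[OF G] by auto
  next
    fix x assume "x \<in> (\<Union>h\<in>N. {x \<in> topspace T. h \<otimes> x \<in> U})"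
    then obtain h where h: "h \<in> N" "x \<in> carrier G" "h \<otimes> x \<in> U"
      using topological_groupD(2)[OF G] by auto
    then have "N #> x = N #> (h \<otimes> x)"
      by (intro repr_independence[of _ N x] subgroup_axioms) (auto simp: r_coset_def)
    then show "x \<in> {x \<in> carrier G. N #> x \<in> (#>) N ` U}" using h by auto
  qed
  have "openin T {x \<in> topspace T. h \<otimes> x \<in> U}" if "h \<in> N" for h
  proof (rule openin_continuous_map_preimage[OF _ U])
    show "continuous_map T T (\<lambda>x. h \<otimes> x)"
      using that topological_groupD(2)[OF G] by (intro continuous_map_group_mult[OF G]) auto
  qed
  then have "openin T (\<Union>h\<in>N. {x \<in> topspace T. h \<otimes> x \<in> U})" by blast
  then show "openin (quotient_group_topology G N T) ((#>) N ` U)"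
    using sub coset_in_quotient by (auto simp: openin_quotient_group eq)
qed

text \<open>A product of quotient maps need not be a quotient map, so continuity of multiplication
  cannot just be read off upstairs. Openness of the coset map makes up for this: boxes found in the
  group are pushed forward to boxes in the quotient.\<close>

lemma topological_group_quotient: "topological_group (G Mod N) (quotient_group_topology G N T)"
proof (rule topological_groupI)
  let ?Q = "quotient_group_topology G N T" and ?\<pi> = "(#>) N"
  note GD = topological_groupD[OF G]
  show "group (G Mod N)" by (rule factorgroup_is_group)
  show top: "topspace ?Q = carrier (G Mod N)" by (rule topspace_quotient_group)
  have hom: "?\<pi> x \<otimes>\<^bsub>G Mod N\<^esub> ?\<pi> y = ?\<pi> (x \<otimes> y)" if "x \<in> carrier G" "y \<in> carrier G" for x y
    using rcos_sum[OF that] by simp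
  show "continuous_map (prod_topology ?Q ?Q) ?Q (\<lambda>p. fst p \<otimes>\<^bsub>G Mod N\<^esub> snd p)"
    unfolding continuous_map_def
  proof (intro conjI allI impI)
    show "(\<lambda>p. fst p \<otimes>\<^bsub>G Mod N\<^esub> snd p) \<in> topspace (prod_topology ?Q ?Q) \<rightarrow> topspace ?Q"
      using group.is_monoid[OF factorgroup_is_group] monoid.m_closed by (fastforce simp: top)
    fix U assume U: "openin ?Q U"
    let ?V = "{p \<in> topspace (prod_topology ?Q ?Q). fst p \<otimes>\<^bsub>G Mod N\<^esub> snd p \<in> U}"
    show "openin (prod_topology ?Q ?Q) ?V"
      unfolding openin_prod_topology_alt
    proof (intro allI impI)
      fix a b assume ab: "(a, b) \<in> ?V"
      then obtain x y where xy: "x \<in> carrier G" "y \<in> carrier G" "a = ?\<pi> x" "b = ?\<pi> y"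
        by (auto simp: top carrier_FactGroup)
      let ?W = "{p \<in> topspace (prod_topology T T). fst p \<otimes> snd p \<in> {z \<in> carrier G. ?\<pi> z \<in> U}}"
      have W: "openin (prod_topology T T) ?W"
        using GD(3) U by (intro openin_continuous_map_preimage) (auto simp: case_prod_unfold openin_quotient_group)
      have "(x, y) \<in> ?W" using xy ab hom GD(2) by auto
      from W[unfolded openin_prod_topology_alt, rule_format, OF this]
      obtain A B where AB: "openin T A" "openin T B" "x \<in> A" "y \<in> B" "A \<times> B \<subseteq> ?W"
        by (elim exE conjE)
      have sub: "A \<subseteq> carrier G" "B \<subseteq> carrier G"
        using openin_subset[OF AB(1)] openin_subset[OF AB(2)] GD(2) by auto
      have "?\<pi> ` A \<times> ?\<pi> ` B \<subseteq> ?V"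
      proof
        fix p assume "p \<in> ?\<pi> ` A \<times> ?\<pi> ` B"
        then obtain u w where uw: "u \<in> A" "w \<in> B" and p: "p = (?\<pi> u, ?\<pi> w)" by auto
        then have "(u, w) \<in> ?W" using AB(5) by blast
        moreover have "u \<in> carrier G" "w \<in> carrier G" using uw sub by auto
        ultimately show "p \<in> ?V"
          by (simp add: p top coset_in_quotient hom del: mult_FactGroup)
      qed
      moreover have "openin ?Q (?\<pi> ` A)" "openin ?Q (?\<pi> ` B)"
        using AB open_coset_map by (auto simp: open_map_def)
      ultimately show "\<exists>A B. openin ?Q A \<and> openin ?Q B \<and> a \<in> A \<and> b \<in> B \<and> A \<times> B \<subseteq> ?V"
        using AB xy by blast
    qed
  qed
  show "continuous_map ?Q ?Q (\<lambda>x. inv\<^bsub>G Mod N\<^esub> x)"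
    unfolding continuous_map_def
  proof (intro conjI allI impI)
    show "(\<lambda>x. inv\<^bsub>G Mod N\<^esub> x) \<in> topspace ?Q \<rightarrow> topspace ?Q"
      using group.inv_closed[OF factorgroup_is_group] by (auto simp: top)
    fix U assume U: "openin ?Q U"
    let ?V = "{x \<in> topspace ?Q. inv\<^bsub>G Mod N\<^esub> x \<in> U}"
    interpret \<pi>: group_hom G "G Mod N" ?\<pi>
      using r_coset_hom_Mod factorgroup_is_group GD(1) by (simp add: group_hom_def group_hom_axioms_def)
    have "{x \<in> carrier G. ?\<pi> x \<in> ?V} = {x \<in> topspace T. inv x \<in> {z \<in> carrier G. ?\<pi> z \<in> U}}"
      using coset_in_quotient by (auto simp: top GD(2))
    moreover have "openin T \<dots>"
      using GD(4) U by (intro openin_continuous_map_preimage) (auto simp: openin_quotient_group)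
    ultimately show "openin ?Q ?V"
      by (auto simp: openin_quotient_group top)
  qed
qed

lemma coset_map_continuous_hom:
  "continuous_hom G T (G Mod N) (quotient_group_topology G N T) ((#>) N)"
  using r_coset_hom_Mod continuous_coset_map by (simp add: continuous_hom_def)

end

section \<open>The topologies of \<open>GL(S)\<close> and \<open>PGL(S)\<close>\<close>

context vector_space
begin

lemma topspace_GL: "topspace (GL_topology scale) = carrier (GL scale)"
proof -
  have "carrier (GL scale) \<subseteq> {M \<in> carrier (GL scale). M 0 = 0}"
    using GL_scale[of _ 0 0] by auto
  then show ?thesis unfolding GL_topology_def topology_generated_by_topspace by blast
qed

lemma openin_GL_eval: "openin (GL_topology scale) {M \<in> carrier (GL scale). M x = y}"
  unfolding GL_topology_def by (rule topology_generated_by_Basis) blast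

lemma openin_GL_nbhd:
  assumes "openin (GL_topology scale) U" "M \<in> U"
  shows "\<exists>X. finite X \<and> (\<forall>N\<in>carrier (GL scale). (\<forall>x\<in>X. N x = M x) \<longrightarrow> N \<in> U)"
proof -
  have "generate_topology_on {{M \<in> carrier (GL scale). M s = s'} |s s'. True} U"
    using assms(1) unfolding GL_topology_def by (rule openin_topology_generated_by)
  then show ?thesis using assms(2)
  proof induction
    case (Int a b)
    then obtain X Y where "finite X" "\<forall>N\<in>carrier (GL scale). (\<forall>x\<in>X. N x = M x) \<longrightarrow> N \<in> a"
      "finite Y" "\<forall>N\<in>carrier (GL scale). (\<forall>x\<in>Y. N x = M x) \<longrightarrow> N \<in> b" by auto
    then show ?case by (intro exI[of _ "X \<union> Y"]) auto
  next
    case (UN K)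
    then obtain k where k: "k \<in> K" "M \<in> k" by blast
    from UN.IH[OF k] show ?case using k(1) by (auto intro: exI)
  next
    case (Basis S)
    then obtain s s' where "S = {M \<in> carrier (GL scale). M s = s'}" by blast
    then show ?case using Basis by (intro exI[of _ "{s}"]) auto
  qed auto
qed

lemma continuous_map_GL:
  assumes "f ` topspace X \<subseteq> carrier (GL scale)" "\<And>x y. openin X {z \<in> topspace X. f z x = y}"
  shows "continuous_map X (GL_topology scale) f"
  unfolding GL_topology_def
proof (rule continuous_on_generated_topo)
  fix U assume "U \<in> {{M \<in> carrier (GL scale). M s = s'} |s s'. True}"
  then obtain s s' where "U = {M \<in> carrier (GL scale). M s = s'}" by blast
  then have "f -` U \<inter> topspace X = {z \<in> topspace X. f z s = s'}" using assms(1) by auto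
  then show "openin X (f -` U \<inter> topspace X)" using assms(2) by simp
next
  show "f ` topspace X \<subseteq> \<Union> {{M \<in> carrier (GL scale). M s = s'} |s s'. True}"
    using assms(1) topspace_GL unfolding GL_topology_def topology_generated_by_topspace by simp
qed

lemma topological_group_GL: "topological_group (GL scale) (GL_topology scale)"
proof (rule topological_groupI)
  let ?T = "GL_topology scale"
  show "group (GL scale)" by (rule group_GL)
  show "topspace ?T = carrier (GL scale)" by (rule topspace_GL)
  have "continuous_map (prod_topology ?T ?T) ?T (\<lambda>p. fst p \<circ> snd p)"
  proof (rule continuous_map_GL)
    show "(\<lambda>p. fst p \<circ> snd p) ` topspace (prod_topology ?T ?T) \<subseteq> carrier (GL scale)"
      by (auto simp: topspace_GL GL_comp)
    fix x y
    \<comment> \<open>Split according to the intermediate value \<open>z\<close> of the inner map at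
      \<open>x\<close>.\<close>
    have "{p \<in> topspace (prod_topology ?T ?T). (fst p \<circ> snd p) x = y} =
        (\<Union>z. {M \<in> carrier (GL scale). M z = y} \<times> {M \<in> carrier (GL scale). M x = z})"
      by (auto simp: topspace_GL)
    also have "openin (prod_topology ?T ?T) \<dots>"
      by (auto intro!: openin_Union simp: openin_prod_Times_iff openin_GL_eval)
    finally show "openin (prod_topology ?T ?T) {p \<in> topspace (prod_topology ?T ?T). (fst p \<circ> snd p) x = y}" .
  qed
  then show "continuous_map (prod_topology ?T ?T) ?T (\<lambda>p. fst p \<otimes>\<^bsub>GL scale\<^esub> snd p)" by simp
  have "continuous_map ?T ?T (inv_into UNIV)"
  proof (rule continuous_map_GL)
    show "inv_into UNIV ` topspace ?T \<subseteq> carrier (GL scale)" by (auto simp: topspace_GL GL_inv)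
    fix x y
    have "{M \<in> topspace ?T. inv_into UNIV M x = y} = {M \<in> carrier (GL scale). M y = x}"
      by (auto simp: topspace_GL carrier_GL bij_comp_inv_into)
    then show "openin ?T {M \<in> topspace ?T. inv_into UNIV M x = y}"
      by (simp add: openin_GL_eval)
  qed
  then show "continuous_map ?T ?T (\<lambda>M. inv\<^bsub>GL scale\<^esub> M)"
    by (rule continuous_map_eq) (simp add: topspace_GL inv_GL)
qed

lemma scalars_normal: "scalars scale \<lhd> GL scale"
proof -
  interpret GL: group "GL scale" by (rule group_GL)
  have "subgroup (scalars scale) (GL scale)"
  proof (rule GL.subgroupI)
    show "scalars scale \<subseteq> carrier (GL scale)" using scale_GL by (auto simp: scalars_def)
    show "scalars scale \<noteq> {}" by (auto simp: scalars_def intro!: exI[of _ 1])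
    fix M assume "M \<in> scalars scale"
    then obtain c where c: "c \<noteq> 0" "M = scale c" by (auto simp: scalars_def)
    have "inv\<^bsub>GL scale\<^esub> M = scale (inverse c)"
      by (rule GL.inv_equality) (use c scale_GL in \<open>simp_all, simp add: fun_eq_iff\<close>)
    then show "inv\<^bsub>GL scale\<^esub> M \<in> scalars scale" using c by (auto simp: scalars_def intro!: exI[of _ "inverse c"])
    fix N assume "N \<in> scalars scale"
    then obtain d where d: "d \<noteq> 0" "N = scale d" by (auto simp: scalars_def)
    have "M \<circ> N = scale (c * d)" using c d by (auto simp: fun_eq_iff)
    then show "M \<otimes>\<^bsub>GL scale\<^esub> N \<in> scalars scale" using c d by (auto simp: scalars_def)
  qed
  moreover have "M \<otimes>\<^bsub>GL scale\<^esub> h \<otimes>\<^bsub>GL scale\<^esub> inv\<^bsub>GL scale\<^esub> M \<in> scalars scale"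
    if M: "M \<in> carrier (GL scale)" and h: "h \<in> scalars scale" for M h
  proof -
    obtain c where c: "c \<noteq> 0" "h = scale c" using h by (auto simp: scalars_def)
    have "M \<circ> h \<circ> inv_into UNIV M = h"
      using GL_scale[OF M] M by (auto simp: c carrier_GL bij_comp_inv_into fun_eq_iff)
    then show ?thesis using h M by (simp add: inv_GL)
  qed
  ultimately show ?thesis by (simp add: GL.normal_inv_iff)
qed

text \<open>Both topologies are given by the same formula, so the general facts on quotient groups
  apply after unfolding.\<close>

lemma PGL_topology_eq: "PGL_topology scale = quotient_group_topology (GL scale) (scalars scale) (GL_topology scale)"
  by (simp add: PGL_topology_def quotient_group_topology_def PGL_def red_def)

lemma red_eq_coset: "red scale = (#>\<^bsub>GL scale\<^esub>) (scalars scale)"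
  by (simp add: red_def fun_eq_iff)

lemma topological_group_PGL: "topological_group (PGL scale) (PGL_topology scale)"
  unfolding PGL_def PGL_topology_eq by (rule topological_group_quotient[OF topological_group_GL scalars_normal])

lemma red_continuous_hom: "continuous_hom (GL scale) (GL_topology scale) (PGL scale) (PGL_topology scale) (red scale)"
  unfolding PGL_def PGL_topology_eq red_eq_coset
  by (rule coset_map_continuous_hom[OF topological_group_GL scalars_normal])

lemma red_open: "open_map (GL_topology scale) (PGL_topology scale) (red scale)"
  unfolding PGL_topology_eq red_eq_coset
  by (rule open_coset_map[OF topological_group_GL scalars_normal])

end

section \<open>The topology of \<open>Sp(W)\<close>\<close>

context symplectic_coordinates
begin

abbreviation TSp where "TSp \<equiv> Sp_topology TF scW \<omega>"

lemma topspace_TSp: "topspace TSp = carrier (Sp scW \<omega>)"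
  by (simp add: Sp_topology_def)

lemma continuous_Sp_eval:
  assumes "continuous_map X TSp h" "Vector_Spaces.linear scW (*) l"
  shows "continuous_map X TF (\<lambda>x. l (h x w))"
proof -
  have "continuous_map X TW (\<lambda>x. h x w)"
    using assms(1) by (simp add: Sp_topology_def continuous_map_in_subtopology continuous_map_componentwise_UNIV)
  from continuous_map_compose[OF this continuous_linear_form[OF assms(2)]]
  show ?thesis by (simp add: comp_def)
qed

lemma continuous_map_TSp:
  assumes "h ` topspace X \<subseteq> carrier (Sp scW \<omega>)"
    "\<And>l w. Vector_Spaces.linear scW (*) l \<Longrightarrow> continuous_map X TF (\<lambda>x. l (h x w))"
  shows "continuous_map X TSp h"
  using assms unfolding Sp_topology_def continuous_map_in_subtopology continuous_map_componentwise_UNIV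
  by (auto intro: continuous_map_TW)

lemma topological_group_Sp: "topological_group (Sp scW \<omega>) TSp"
proof (rule topological_groupI)
  show "group (Sp scW \<omega>)" by (rule group_Sp)
  show "topspace TSp = carrier (Sp scW \<omega>)" by (rule topspace_TSp)
  have "continuous_map (prod_topology TSp TSp) TSp (\<lambda>p. snd p \<circ> fst p)"
  proof (rule continuous_map_TSp)
    show "(\<lambda>p. snd p \<circ> fst p) ` topspace (prod_topology TSp TSp) \<subseteq> carrier (Sp scW \<omega>)"
      using group.is_monoid[OF group_Sp] monoid.m_closed by (fastforce simp: topspace_TSp)
    fix l w assume l: "Vector_Spaces.linear scW (*) l"
    \<comment> \<open>Pointwise convergence does not directly handle the moving argument
      \<open>fst p w\<close>. Expanding it in the basis leaves only evaluations at fixed vectors,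
      combined by sums and products in \<open>F\<close>.\<close>
    let ?F = "\<lambda>p :: ('w \<Rightarrow> 'w) \<times> ('w \<Rightarrow> 'w). \<Sum>i<n. \<omega> (fst p w) (f i) * l (snd p (e i)) + \<omega> (e i) (fst p w) * l (snd p (f i))"
    have "continuous_map (prod_topology TSp TSp) TF ?F"
      by (intro continuous_map_v_sum continuous_map_v_add continuous_map_v_mult
          continuous_Sp_eval[OF continuous_map_fst] continuous_Sp_eval[OF continuous_map_snd]
          l linear_left linear_right)
    then show "continuous_map (prod_topology TSp TSp) TF (\<lambda>p. l ((snd p \<circ> fst p) w))"
    proof (rule continuous_map_eq)
      fix p assume "p \<in> topspace (prod_topology TSp TSp)"
      then have "Vector_Spaces.linear scW scW (snd p)" by (auto simp: topspace_TSp carrier_Sp)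
      from linear_form_expansion[OF Vector_Spaces.linear_compose[OF this l], of "fst p w"]
      show "?F p = l ((snd p \<circ> fst p) w)" by simp
    qed
  qed
  then show "continuous_map (prod_topology TSp TSp) TSp (\<lambda>p. fst p \<otimes>\<^bsub>Sp scW \<omega>\<^esub> snd p)" by simp
  have "continuous_map TSp TSp (inv_into UNIV)"
  proof (rule continuous_map_TSp)
    show "inv_into UNIV ` topspace TSp \<subseteq> carrier (Sp scW \<omega>)" by (auto simp: topspace_TSp Sp_inv)
    fix l w assume l: "Vector_Spaces.linear scW (*) l"
    \<comment> \<open>Invariance of the form moves the inverse to the other side: the coordinates of
      the inverse image of \<open>w\<close> are pairings of \<open>w\<close> with the images of the
      basis under \<open>g\<close>.\<close>
    let ?F = "\<lambda>g. \<Sum>i<n. \<omega> w (g (f i)) * l (e i) + \<omega> (g (e i)) w * l (f i)"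
    have "continuous_map TSp TSp (\<lambda>g. g)" by simp
    then have "continuous_map TSp TF ?F"
      by (intro continuous_map_v_sum continuous_map_v_add continuous_map_v_mult
          continuous_map_v_const continuous_Sp_eval linear_left linear_right)
    then show "continuous_map TSp TF (\<lambda>g. l (inv_into UNIV g w))"
    proof (rule continuous_map_eq)
      fix g assume g: "g \<in> topspace TSp"
      have g_eq: "\<omega> (g x) (g y) = \<omega> x y" "g (inv_into UNIV g w) = w" for x y
        using g by (auto simp: topspace_TSp carrier_Sp bij_comp_inv_into)
      have "\<omega> w (g x) = \<omega> (inv_into UNIV g w) x" "\<omega> (g x) w = \<omega> x (inv_into UNIV g w)" for x
        using g_eq(1)[of "inv_into UNIV g w" x] g_eq(1)[of x "inv_into UNIV g w"] g_eq(2) by auto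
      then show "?F g = l (inv_into UNIV g w)"
        by (simp add: linear_form_expansion[OF l, of "inv_into UNIV g w"])
    qed
  qed
  then show "continuous_map TSp TSp (\<lambda>g. inv\<^bsub>Sp scW \<omega>\<^esub> g)"
    by (rule continuous_map_eq) (simp add: topspace_TSp inv_Sp)
qed

lemma openin_Sp_close:
  assumes "finite A"
  shows "openin TSp {g \<in> carrier (Sp scW \<omega>). \<forall>w\<in>A. g w - w \<in> lattice r}"
proof -
  have "continuous_map TSp TW (\<lambda>g. g w)" for w
    using continuous_map_id[of TSp] unfolding Sp_topology_def
    by (auto simp: continuous_map_in_subtopology continuous_map_componentwise_UNIV id_def
        intro!: continuous_map_from_subtopology continuous_map_product_projection)
  then have "openin TSp {g \<in> topspace TSp. g w \<in> {y. y - w \<in> lattice r}}" for w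
    by (rule openin_continuous_map_preimage) (rule openin_translate_lattice)
  then have "openin TSp ((\<Inter>w\<in>A. {g \<in> topspace TSp. g w \<in> {y. y - w \<in> lattice r}}) \<inter> topspace TSp)"
    using assms by (intro openin_INT) auto
  also have "(\<Inter>w\<in>A. {g \<in> topspace TSp. g w \<in> {y. y - w \<in> lattice r}}) \<inter> topspace TSp =
      {g \<in> carrier (Sp scW \<omega>). \<forall>w\<in>A. g w - w \<in> lattice r}"
    by (auto simp: topspace_TSp)
  finally show ?thesis .
qed

end

section \<open>The metaplectic extension\<close>

lemma rep_iso_inv:
  assumes "rep_iso scS \<rho> scS' \<rho>' \<phi>"
  shows "rep_iso scS' \<rho>' scS \<rho> (inv_into UNIV \<phi>)"
proof -
  have phi: "Vector_Spaces.linear scS scS' \<phi>" "bij \<phi>" "\<And>h s. \<phi> (\<rho> h s) = \<rho>' h (\<phi> s)"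
    using assms by (auto simp: rep_iso_def fun_eq_iff)
  have "inv_into UNIV \<phi> (\<rho>' h u) = \<rho> h (inv_into UNIV \<phi> u)" for h u
    using phi(3)[of h "inv_into UNIV \<phi> u"] bij_comp_inv_into(3,4)[OF phi(2)] by metis
  then show ?thesis
    using phi by (auto simp: rep_iso_def linear_inv_into bij_imp_bij_inv fun_eq_iff)
qed

lemma conj_by_inverse:
  assumes "bij \<phi>"
  shows "conj_by (inv_into UNIV \<phi>) (conj_by \<phi> x) = x"
  using assms
  by (cases x) (simp add: conj_by_def fun_eq_iff inv_inv_eq bij_comp_inv_into)

context heisenberg_data
begin

lemma sigma_red:
  assumes "model scS \<rho>" "g \<in> carrier (Sp scW \<omega>)"
  obtains M where "M \<in> carrier (GL scS)" "intertwines \<rho> g M" "sigma_S scS \<rho> g = red scS M"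
  using intertwiner_exists[OF assms] sigma_eq_red_iff[OF assms] by blast

lemma sigma_mult:
  assumes model: "model scS \<rho>" and g: "g \<in> carrier (Sp scW \<omega>)" and h: "h \<in> carrier (Sp scW \<omega>)"
    and M: "M \<in> carrier (GL scS)" "intertwines \<rho> g M" and N: "N \<in> carrier (GL scS)" "intertwines \<rho> h N"
  shows "sigma_S scS \<rho> (g \<otimes>\<^bsub>Sp scW \<omega>\<^esub> h) = red scS (M \<circ> N)"
proof -
  interpret S: vector_space scS by (rule modelD(1)[OF model])
  have "g \<otimes>\<^bsub>Sp scW \<omega>\<^esub> h \<in> carrier (Sp scW \<omega>)"
    using group.is_monoid[OF group_Sp] g h by (rule monoid.m_closed)
  moreover have "intertwines \<rho> (h \<circ> g) (M \<circ> N)"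
    using g h M N by (intro intertwines_comp) (auto simp: carrier_Sp carrier_GL)
  ultimately show ?thesis
    using sigma_eq_red_iff[OF model] S.GL_comp[OF M(1) N(1)] by simp
qed

lemma sigma_hom:
  assumes model: "model scS \<rho>"
  shows "sigma_S scS \<rho> \<in> hom (Sp scW \<omega>) (PGL scS)"
proof (rule homI)
  interpret S: vector_space scS by (rule modelD(1)[OF model])
  have red: "red scS \<in> hom (GL scS) (PGL scS)"
    using S.red_continuous_hom by (simp add: continuous_hom_def)
  fix g assume g: "g \<in> carrier (Sp scW \<omega>)"
  obtain M where M: "M \<in> carrier (GL scS)" "intertwines \<rho> g M" "sigma_S scS \<rho> g = red scS M"
    using sigma_red[OF model g] .
  then show "sigma_S scS \<rho> g \<in> carrier (PGL scS)" using red by (auto simp: hom_def)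
  fix h assume h: "h \<in> carrier (Sp scW \<omega>)"
  obtain N where N: "N \<in> carrier (GL scS)" "intertwines \<rho> h N" "sigma_S scS \<rho> h = red scS N"
    using sigma_red[OF model h] .
  show "sigma_S scS \<rho> (g \<otimes>\<^bsub>Sp scW \<omega>\<^esub> h) = sigma_S scS \<rho> g \<otimes>\<^bsub>PGL scS\<^esub> sigma_S scS \<rho> h"
    using sigma_mult[OF model g h M(1,2) N(1,2)] hom_mult[OF red M(1) N(1)] M(3) N(3) by simp
qed

text \<open>Translation reduces the claim to a neighbourhood of the identity: if \<open>k\<close>
  has an intertwiner \<open>M\<close> close to the identity, the product of \<open>k\<close> and
  \<open>g\<^sub>0\<close> has the intertwiner \<open>M \<circ> M\<^sub>0\<close>, close to
  \<open>M\<^sub>0\<close>.\<close>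

lemma sigma_continuous:
  assumes model: "model scS \<rho>"
  shows "continuous_map TSp (PGL_topology scS) (sigma_S scS \<rho>)"
  unfolding continuous_map_def
proof (intro conjI allI impI)
  interpret S: vector_space scS by (rule modelD(1)[OF model])
  interpret Sp: group "Sp scW \<omega>" by (rule group_Sp)
  note PGL = topological_groupD[OF S.topological_group_PGL]
  show "sigma_S scS \<rho> \<in> topspace TSp \<rightarrow> topspace (PGL_topology scS)"
    using sigma_hom[OF model] by (auto simp: hom_def topspace_TSp PGL(2))
  fix U assume U: "openin (PGL_topology scS) U"
  show "openin TSp {g \<in> topspace TSp. sigma_S scS \<rho> g \<in> U}"
  proof (subst openin_subopen, intro ballI)
    fix g\<^sub>0 assume "g\<^sub>0 \<in> {g \<in> topspace TSp. sigma_S scS \<rho> g \<in> U}"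
    then have g0: "g\<^sub>0 \<in> carrier (Sp scW \<omega>)" "sigma_S scS \<rho> g\<^sub>0 \<in> U" by (simp_all add: topspace_TSp)
    obtain M\<^sub>0 where M0: "M\<^sub>0 \<in> carrier (GL scS)" "intertwines \<rho> g\<^sub>0 M\<^sub>0" "sigma_S scS \<rho> g\<^sub>0 = red scS M\<^sub>0"
      using sigma_red[OF model g0(1)] .
    have open_U: "openin (GL_topology scS) {M \<in> topspace (GL_topology scS). red scS M \<in> U}"
      using S.red_continuous_hom U by (intro openin_continuous_map_preimage) (auto simp: continuous_hom_def)
    have "M\<^sub>0 \<in> {M \<in> topspace (GL_topology scS). red scS M \<in> U}"
      using M0 g0 by (simp add: S.topspace_GL)
    from S.openin_GL_nbhd[OF open_U this] obtain X where X: "finite X"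
      "\<And>N. N \<in> carrier (GL scS) \<Longrightarrow> \<forall>x\<in>X. N x = M\<^sub>0 x \<Longrightarrow> red scS N \<in> U"
      by auto
    \<comment> \<open>The vectors to be fixed are those of the image of \<open>X\<close> under
      \<open>M\<^sub>0\<close>, so that \<open>M \<circ> M\<^sub>0\<close> agrees with
      \<open>M\<^sub>0\<close> on \<open>X\<close>.\<close>
    from intertwiner_fixing[OF model finite_imageI[OF X(1), of M\<^sub>0]]
    obtain A r where A: "finite A" "r > 0" and fixing: "\<forall>g\<in>carrier (Sp scW \<omega>).
        (\<forall>w\<in>A. g w - w \<in> lattice r) \<longrightarrow>
        (\<exists>M\<in>carrier (GL scS). intertwines \<rho> g M \<and> (\<forall>x\<in>M\<^sub>0 ` X. M x = x))"
      by (elim exE conjE)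
    let ?V = "{g \<in> carrier (Sp scW \<omega>). \<forall>w\<in>A. g w - w \<in> lattice r}"
    let ?N = "{g \<in> topspace TSp. g \<otimes>\<^bsub>Sp scW \<omega>\<^esub> inv\<^bsub>Sp scW \<omega>\<^esub> g\<^sub>0 \<in> ?V}"
    have "continuous_map TSp TSp (\<lambda>g. g \<otimes>\<^bsub>Sp scW \<omega>\<^esub> inv\<^bsub>Sp scW \<omega>\<^esub> g\<^sub>0)"
      by (rule continuous_map_group_mult[OF topological_group_Sp])
        (use Sp.inv_closed[OF g0(1)] in \<open>simp_all add: topspace_TSp\<close>)
    then have "openin TSp ?N"
      using openin_Sp_close[OF A(1)] by (rule openin_continuous_map_preimage)
    moreover have "g\<^sub>0 \<in> ?N"
    proof -
      have "g\<^sub>0 \<otimes>\<^bsub>Sp scW \<omega>\<^esub> inv\<^bsub>Sp scW \<omega>\<^esub> g\<^sub>0 = \<one>\<^bsub>Sp scW \<omega>\<^esub>" by (rule Sp.r_inv[OF g0(1)])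
      moreover have "\<one>\<^bsub>Sp scW \<omega>\<^esub> \<in> ?V"
        using Sp.one_closed lattice_zero[OF A(2)] by simp
      ultimately show ?thesis using g0(1) by (simp only: mem_Collect_eq topspace_TSp simp_thms) (elim conjE)
    qed
    moreover have "?N \<subseteq> {g \<in> topspace TSp. sigma_S scS \<rho> g \<in> U}"
    proof
      fix h assume h: "h \<in> ?N"
      let ?k = "h \<otimes>\<^bsub>Sp scW \<omega>\<^esub> inv\<^bsub>Sp scW \<omega>\<^esub> g\<^sub>0"
      have hk: "h \<in> carrier (Sp scW \<omega>)" "?k \<in> carrier (Sp scW \<omega>)" "\<forall>w\<in>A. ?k w - w \<in> lattice r"
        using h by (auto simp: topspace_TSp)
      obtain M where M: "M \<in> carrier (GL scS)" "intertwines \<rho> ?k M" "\<forall>x\<in>M\<^sub>0 ` X. M x = x"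
        using fixing[rule_format, OF hk(2)] hk(3) by blast
      have "?k \<otimes>\<^bsub>Sp scW \<omega>\<^esub> g\<^sub>0 = h"
        using Sp.inv_solve_right[OF hk(2,1) g0(1)] by simp
      then have "sigma_S scS \<rho> h = red scS (M \<circ> M\<^sub>0)"
        using sigma_mult[OF model hk(2) g0(1) M(1,2) M0(1,2)] by simp
      also have "\<dots> \<in> U"
        by (rule X(2)) (use M M0 S.GL_comp in auto)
      finally show "h \<in> {g \<in> topspace TSp. sigma_S scS \<rho> g \<in> U}"
        using hk(1) by (simp add: topspace_TSp)
    qed
    ultimately show "\<exists>N. openin TSp N \<and> g\<^sub>0 \<in> N \<and> N \<subseteq> {g \<in> topspace TSp. sigma_S scS \<rho> g \<in> U}"
      by blast
  qed
qed

lemma sigma_continuous_hom: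
  "model scS \<rho> \<Longrightarrow> continuous_hom (Sp scW \<omega>) TSp (PGL scS) (PGL_topology scS) (sigma_S scS \<rho>)"
  by (simp add: continuous_hom_def sigma_hom sigma_continuous)

section \<open>The fibre product as a central extension\<close>

lemma Mp_fibre_product:
  assumes model: "model scS \<rho>"
  shows "is_fibre_product TYPE('k) (Mp scW \<omega> scS \<rho>) (Mp_topology TF scW \<omega> scS \<rho>) Mp_proj snd
      (Sp scW \<omega>) TSp (GL scS) (GL_topology scS) (PGL scS) (PGL_topology scS) (sigma_S scS \<rho>) (red scS)"
proof -
  interpret S: vector_space scS by (rule modelD(1)[OF model])
  show ?thesis
    using fibre_product_is_fibre_product[OF topological_group_Sp S.topological_group_GL
        S.topological_group_PGL sigma_continuous_hom[OF model] S.red_continuous_hom]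
    by (simp add: Mp_def Mp_topology_def Mp_proj_def)
qed

lemma Mp_topological_subgroup:
  assumes model: "model scS \<rho>"
  shows "topological_subgroup (Mp scW \<omega> scS \<rho>) (Mp_topology TF scW \<omega> scS \<rho>)
      (Sp scW \<omega> \<times>\<times> GL scS) (prod_topology TSp (GL_topology scS))"
proof -
  interpret S: vector_space scS by (rule modelD(1)[OF model])
  have "red scS \<in> hom (GL scS) (PGL scS)"
    using S.red_continuous_hom by (simp add: continuous_hom_def)
  from fibre_product_subgroup[OF group_Sp S.group_GL topological_groupD(1)[OF S.topological_group_PGL]
      sigma_hom[OF model] this]
  show ?thesis
    using topological_subgroup_subtopology[OF topological_group_DirProd[OF topological_group_Sp
          S.topological_group_GL]]
    by (simp add: Mp_def Mp_topology_def)
qed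

lemma topspace_Mp:
  assumes "model scS \<rho>"
  shows "topspace (Mp_topology TF scW \<omega> scS \<rho>) = carrier (Mp scW \<omega> scS \<rho>)"
  using Mp_topological_subgroup[OF assms] unfolding topological_subgroup_def
  by (intro topological_groupD(2)) (elim conjE)

lemma carrier_Mp:
  assumes "model scS \<rho>"
  shows "(g, M) \<in> carrier (Mp scW \<omega> scS \<rho>) \<longleftrightarrow>
    g \<in> carrier (Sp scW \<omega>) \<and> M \<in> carrier (GL scS) \<and> intertwines \<rho> g M"
  using sigma_eq_red_iff[OF assms] by (auto simp: Mp_def)

lemma Mp_mult [simp]: "(g, M) \<otimes>\<^bsub>Mp scW \<omega> scS \<rho>\<^esub> (h, N) = (h \<circ> g, M \<circ> N)"
  by (simp add: Mp_def)

lemma continuous_Mp: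
  "continuous_map (Mp_topology TF scW \<omega> scS \<rho>) TSp fst"
  "continuous_map (Mp_topology TF scW \<omega> scS \<rho>) (GL_topology scS) snd"
  by (simp_all add: Mp_topology_def continuous_map_from_subtopology continuous_map_fst continuous_map_snd)

lemma id_Sp: "id \<in> carrier (Sp scW \<omega>)"
  using group.is_monoid[OF group_Sp] monoid.one_closed by fastforce

text \<open>The identity intertwines itself, so uniqueness up to scalars determines the fibre over
  the identity, which is the kernel of the projection.\<close>

lemma intertwines_id_iff:
  assumes "model scS \<rho>" "M \<in> carrier (GL scS)"
  shows "intertwines \<rho> id M \<longleftrightarrow> (\<exists>c. c \<noteq> 0 \<and> M = scS c)"
proof -
  interpret S: vector_space scS by (rule modelD(1)[OF assms(1)])
  have id: "id \<in> carrier (GL scS)" by (simp add: carrier_GL S.linear_id)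
  have "intertwines \<rho> id id" by (simp add: intertwines_def)
  then have "sigma_S scS \<rho> id = red scS id"
    using sigma_eq_red_iff[OF assms(1) id_Sp id] by simp
  then show ?thesis
    using sigma_eq_red_iff[OF assms(1) id_Sp assms(2)] S.red_eq_iff[of M id] by auto
qed

lemma Mp_incl_carrier:
  assumes "model scS \<rho>" "c \<noteq> 0"
  shows "Mp_incl scS c \<in> carrier (Mp scW \<omega> scS \<rho>)"
proof -
  interpret S: vector_space scS by (rule modelD(1)[OF assms(1)])
  show ?thesis
    using id_Sp S.scale_GL[OF assms(2)] intertwines_id_iff[OF assms(1) S.scale_GL[OF assms(2)]] assms(2)
    by (auto simp: Mp_incl_def carrier_Mp[OF assms(1)])
qed

text \<open>Evaluation at a nonzero vector separates scalars, so a subbasic open set of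
  \<open>GL(S)\<close> isolates each of them: the induced topology is discrete.\<close>

lemma Mp_incl_embedding:
  fixes scS :: "'r \<Rightarrow> 's::ab_group_add \<Rightarrow> 's"
  assumes model: "model scS \<rho>"
  shows "embedding_map (discrete_topology {c. c \<noteq> 0}) (Mp_topology TF scW \<omega> scS \<rho>) (Mp_incl scS)"
proof -
  interpret S: vector_space scS by (rule modelD(1)[OF model])
  let ?T = "Mp_topology TF scW \<omega> scS \<rho>" and ?I = "Mp_incl scS ` {c. c \<noteq> 0}"
  obtain s :: 's where s: "s \<noteq> 0" using modelD(7)[OF model] by blast
  have sub: "?I \<subseteq> topspace ?T"
    using Mp_incl_carrier[OF model] by (auto simp: topspace_Mp[OF model])
  have single: "{Mp_incl scS c} = {x \<in> topspace ?T. snd x \<in> {M \<in> carrier (GL scS). M s = scS c s}} \<inter> ?I"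
    if "c \<noteq> 0" for c
    using sub that s S.scale_GL by (auto simp: Mp_incl_def)
  have open_single: "openin (subtopology ?T ?I) {Mp_incl scS c}" if "c \<noteq> 0" for c
    unfolding openin_subtopology
    using openin_continuous_map_preimage[OF continuous_Mp(2) S.openin_GL_eval] single[OF that] by blast
  have "homeomorphic_map (discrete_topology {c. c \<noteq> 0}) (subtopology ?T ?I) (Mp_incl scS)"
  proof (rule bijective_open_imp_homeomorphic_map)
    show "continuous_map (discrete_topology {c. c \<noteq> 0}) (subtopology ?T ?I) (Mp_incl scS)"
      using sub by auto
    show "open_map (discrete_topology {c. c \<noteq> 0}) (subtopology ?T ?I) (Mp_incl scS)"
      unfolding open_map_def
    proof (intro allI impI)
      fix U :: "'r set" assume "openin (discrete_topology {c. c \<noteq> 0}) U"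
      then have U: "U \<subseteq> {c. c \<noteq> 0}" by simp
      have "Mp_incl scS ` U = (\<Union>c\<in>U. {Mp_incl scS c})" by auto
      also have "openin (subtopology ?T ?I) \<dots>" using U open_single by blast
      finally show "openin (subtopology ?T ?I) (Mp_incl scS ` U)" .
    qed
    show "Mp_incl scS ` topspace (discrete_topology {c. c \<noteq> 0}) = topspace (subtopology ?T ?I)"
      using sub by auto
    show "inj_on (Mp_incl scS) (topspace (discrete_topology {c. c \<noteq> 0}))"
      using s by (auto simp: inj_on_def Mp_incl_def fun_eq_iff)
  qed
  then show ?thesis by (simp add: embedding_map_def)
qed

text \<open>The projection is the base change of the open map \<open>red\<close> along
  \<open>sigma_S\<close>, hence open; it is onto because every symplectic automorphism has an
  intertwiner.\<close>

lemma Mp_proj_quotient: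
  assumes model: "model scS \<rho>"
  shows "quotient_map (Mp_topology TF scW \<omega> scS \<rho>) TSp Mp_proj"
proof (rule continuous_open_imp_quotient_map)
  interpret S: vector_space scS by (rule modelD(1)[OF model])
  show "continuous_map (Mp_topology TF scW \<omega> scS \<rho>) TSp Mp_proj"
    unfolding Mp_proj_def by (rule continuous_Mp)
  show "open_map (Mp_topology TF scW \<omega> scS \<rho>) TSp Mp_proj"
    using fibre_product_open_fst[OF sigma_continuous[OF model] S.red_open]
    by (simp add: Mp_topology_def Mp_def Mp_proj_def topspace_TSp S.topspace_GL)
  show "Mp_proj ` topspace (Mp_topology TF scW \<omega> scS \<rho>) = topspace TSp"
    unfolding topspace_Mp[OF model] topspace_TSp Mp_proj_def
  proof (intro equalityI subsetI)
    fix g assume "g \<in> fst ` carrier (Mp scW \<omega> scS \<rho>)"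
    then show "g \<in> carrier (Sp scW \<omega>)" using carrier_Mp[OF model] by auto
  next
    fix g assume g: "g \<in> carrier (Sp scW \<omega>)"
    then obtain M where "M \<in> carrier (GL scS)" "intertwines \<rho> g M"
      using intertwiner_exists[OF model] by blast
    then show "g \<in> fst ` carrier (Mp scW \<omega> scS \<rho>)"
      using g carrier_Mp[OF model] by (intro image_eqI[of _ _ "(g, M)"]) simp_all
  qed
qed

lemma topological_group_multiplicative:
  "topological_group (multiplicative_group :: 'r monoid) (discrete_topology (carrier multiplicative_group))"
proof (rule topological_groupI)
  show group: "group (multiplicative_group :: 'r monoid)"
  proof (rule groupI)
    fix c :: 'r assume "c \<in> carrier multiplicative_group"
    then show "\<exists>d\<in>carrier multiplicative_group. d \<otimes>\<^bsub>multiplicative_group\<^esub> c = \<one>\<^bsub>multiplicative_group\<^esub>"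
      by (intro bexI[of _ "inverse c"]) (simp_all add: multiplicative_group_def)
  qed (auto simp: multiplicative_group_def)
  show "continuous_map (discrete_topology (carrier multiplicative_group))
      (discrete_topology (carrier (multiplicative_group :: 'r monoid))) (m_inv multiplicative_group)"
    using group.inv_closed[OF group] by auto
qed (auto simp: multiplicative_group_def simp flip: prod_topology_discrete_topology)

lemma Mp_central_extension:
  assumes model: "model scS \<rho>"
  shows "topological_central_extension
      multiplicative_group (discrete_topology (carrier multiplicative_group)) (Mp_incl scS)
      (Mp scW \<omega> scS \<rho>) (Mp_topology TF scW \<omega> scS \<rho>) Mp_proj (Sp scW \<omega>) TSp"
proof -
  interpret S: vector_space scS by (rule modelD(1)[OF model])
  have carrier: "carrier (multiplicative_group :: 'r monoid) = {c. c \<noteq> 0}"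
    by (simp add: multiplicative_group_def)
  have incl_hom: "Mp_incl scS \<in> hom multiplicative_group (Mp scW \<omega> scS \<rho>)"
    using Mp_incl_carrier[OF model]
    by (auto simp: hom_def multiplicative_group_def) (auto simp: Mp_incl_def fun_eq_iff)
  have incl_cont: "continuous_map (discrete_topology {c. c \<noteq> 0}) (Mp_topology TF scW \<omega> scS \<rho>) (Mp_incl scS)"
    using Mp_incl_carrier[OF model] by (auto simp: topspace_Mp[OF model])
  have proj_hom: "Mp_proj \<in> hom (Mp scW \<omega> scS \<rho>) (Sp scW \<omega>)"
    by (auto simp: hom_def Mp_def Mp_proj_def)
  have kernel: "Mp_incl scS ` {c. c \<noteq> 0} = {x \<in> carrier (Mp scW \<omega> scS \<rho>). Mp_proj x = \<one>\<^bsub>Sp scW \<omega>\<^esub>}"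
  proof (intro equalityI subsetI)
    fix x assume "x \<in> {x \<in> carrier (Mp scW \<omega> scS \<rho>). Mp_proj x = \<one>\<^bsub>Sp scW \<omega>\<^esub>}"
    then obtain M where "x = (id, M)" "M \<in> carrier (GL scS)" "intertwines \<rho> id M"
      by (cases x) (auto simp: Mp_proj_def carrier_Mp[OF model])
    then show "x \<in> Mp_incl scS ` {c. c \<noteq> 0}"
      using intertwines_id_iff[OF model] by (auto simp: Mp_incl_def)
  qed (use Mp_incl_carrier[OF model] in \<open>auto simp: Mp_proj_def Mp_incl_def\<close>)
  have central: "Mp_incl scS c \<otimes>\<^bsub>Mp scW \<omega> scS \<rho>\<^esub> x = x \<otimes>\<^bsub>Mp scW \<omega> scS \<rho>\<^esub> Mp_incl scS c"
    if "x \<in> carrier (Mp scW \<omega> scS \<rho>)" for c x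
    using that S.GL_scale by (cases x) (auto simp: Mp_incl_def carrier_Mp[OF model] fun_eq_iff)
  have Mp_group: "topological_group (Mp scW \<omega> scS \<rho>) (Mp_topology TF scW \<omega> scS \<rho>)"
    using Mp_topological_subgroup[OF model] unfolding topological_subgroup_def by (elim conjE)
  show ?thesis
    unfolding topological_central_extension_def continuous_hom_def carrier
    by (intro conjI ballI topological_group_multiplicative[unfolded carrier] Mp_group topological_group_Sp
        incl_hom incl_cont proj_hom quotient_imp_continuous_map Mp_proj_quotient[OF model]
        Mp_incl_embedding[OF model] kernel central)
qed

section \<open>Change of model\<close>

lemma conj_by_carrier:
  assumes 1: "model scS \<rho>" and 2: "model scS' \<rho>'" and iso: "rep_iso scS \<rho> scS' \<rho>' \<phi>"
    and x: "x \<in> carrier (Mp scW \<omega> scS \<rho>)"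
  shows "conj_by \<phi> x \<in> carrier (Mp scW \<omega> scS' \<rho>')"
proof -
  obtain g M where gM: "x = (g, M)" "g \<in> carrier (Sp scW \<omega>)" "M \<in> carrier (GL scS)" "intertwines \<rho> g M"
    using x carrier_Mp[OF 1] by (cases x) auto
  have phi: "Vector_Spaces.linear scS scS' \<phi>" "bij \<phi>" "\<And>h s. \<phi> (\<rho> h s) = \<rho>' h (\<phi> s)"
    using iso by (auto simp: rep_iso_def fun_eq_iff)
  have inv: "Vector_Spaces.linear scS' scS (inv_into UNIV \<phi>)" "bij (inv_into UNIV \<phi>)"
    "\<And>h s. inv_into UNIV \<phi> (\<rho>' h s) = \<rho> h (inv_into UNIV \<phi> s)"
    using rep_iso_inv[OF iso] by (auto simp: rep_iso_def fun_eq_iff)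
  let ?M = "\<phi> \<circ> M \<circ> inv_into UNIV \<phi>"
  have M: "Vector_Spaces.linear scS scS M" "bij M" using gM by (auto simp: carrier_GL)
  have "?M \<in> carrier (GL scS')"
    unfolding carrier_GL
    by (intro conjI bij_comp Vector_Spaces.linear_compose[OF inv(1)]
        Vector_Spaces.linear_compose[OF M(1)] phi inv M)
  moreover have "intertwines \<rho>' g ?M"
    using gM(4) M(2) phi inv by (simp add: intertwines_iff bij_comp)
  ultimately show ?thesis
    using gM(2) by (simp add: gM(1) conj_by_def carrier_Mp[OF 2])
qed

lemma conj_by_continuous:
  assumes 1: "model scS \<rho>" and 2: "model scS' \<rho>'" and iso: "rep_iso scS \<rho> scS' \<rho>' \<phi>"
  shows "continuous_map (Mp_topology TF scW \<omega> scS \<rho>) (Mp_topology TF scW \<omega> scS' \<rho>') (conj_by \<phi>)"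
proof -
  interpret S: vector_space scS by (rule modelD(1)[OF 1])
  interpret S': vector_space scS' by (rule modelD(1)[OF 2])
  let ?T = "Mp_topology TF scW \<omega> scS \<rho>"
  have bij: "bij \<phi>" using iso by (simp add: rep_iso_def)
  have carrier: "conj_by \<phi> x \<in> carrier (Mp scW \<omega> scS' \<rho>')" if "x \<in> topspace ?T" for x
    using conj_by_carrier[OF 1 2 iso] that by (simp add: topspace_Mp[OF 1])
  have "continuous_map ?T (GL_topology scS') (\<lambda>x. \<phi> \<circ> snd x \<circ> inv_into UNIV \<phi>)"
  proof (rule S'.continuous_map_GL)
    show "(\<lambda>x. \<phi> \<circ> snd x \<circ> inv_into UNIV \<phi>) ` topspace ?T \<subseteq> carrier (GL scS')"
      using carrier by (force simp: conj_by_def carrier_Mp[OF 2])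
    fix y z
    \<comment> \<open>Conjugation pulls subbasic sets back to subbasic sets, with both vectors moved
      through the inverse of \<open>\<phi>\<close>.\<close>
    have "{x \<in> topspace ?T. (\<phi> \<circ> snd x \<circ> inv_into UNIV \<phi>) y = z} =
        {x \<in> topspace ?T. snd x \<in> {M \<in> carrier (GL scS). M (inv_into UNIV \<phi> y) = inv_into UNIV \<phi> z}}"
      using bij by (auto simp: topspace_Mp[OF 1] carrier_Mp[OF 1] bij_comp_inv_into)
    also have "openin ?T \<dots>"
      by (rule openin_continuous_map_preimage[OF continuous_Mp(2) S.openin_GL_eval])
    finally show "openin ?T {x \<in> topspace ?T. (\<phi> \<circ> snd x \<circ> inv_into UNIV \<phi>) y = z}" .
  qed
  then have "continuous_map ?T (prod_topology TSp (GL_topology scS')) (conj_by \<phi>)"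
    unfolding conj_by_def case_prod_unfold by (intro continuous_map_pairedI continuous_Mp)
  then show ?thesis
    unfolding Mp_topology_def[of _ _ _ scS'] using carrier by (auto simp: continuous_map_in_subtopology)
qed

lemma conj_by_extension_iso:
  assumes 1: "model scS \<rho>" and 2: "model scS' \<rho>'" and iso: "rep_iso scS \<rho> scS' \<rho>' \<phi>"
  shows "topological_extension_iso multiplicative_group
      (Mp_incl scS) (Mp scW \<omega> scS \<rho>) (Mp_topology TF scW \<omega> scS \<rho>) Mp_proj
      (Mp_incl scS') (Mp scW \<omega> scS' \<rho>') (Mp_topology TF scW \<omega> scS' \<rho>') Mp_proj (conj_by \<phi>)"
proof -
  note inv = rep_iso_inv[OF iso]
  have bij: "bij \<phi>" and lin: "\<And>c s. \<phi> (scS c s) = scS' c (\<phi> s)"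
    using iso by (auto simp: rep_iso_def linear_iff_additive)
  have inv1: "conj_by (inv_into UNIV \<phi>) (conj_by \<phi> x) = x" for x :: "('w \<Rightarrow> 'w) \<times> _"
    by (rule conj_by_inverse[OF bij])
  have inv2: "conj_by \<phi> (conj_by (inv_into UNIV \<phi>) x) = x" for x :: "('w \<Rightarrow> 'w) \<times> _"
    using conj_by_inverse[OF bij_imp_bij_inv[OF bij], of x] inv_inv_eq[OF bij] by simp
  have "bij_betw (conj_by \<phi>) (carrier (Mp scW \<omega> scS \<rho>)) (carrier (Mp scW \<omega> scS' \<rho>'))"
    by (rule bij_betwI[where g = "conj_by (inv_into UNIV \<phi>)"])
      (use conj_by_carrier[OF 1 2 iso] conj_by_carrier[OF 2 1 inv] inv1 inv2 in auto)
  moreover have "conj_by \<phi> (x \<otimes>\<^bsub>Mp scW \<omega> scS \<rho>\<^esub> y) = conj_by \<phi> x \<otimes>\<^bsub>Mp scW \<omega> scS' \<rho>'\<^esub> conj_by \<phi> y" for x y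
    using bij by (cases x; cases y) (simp add: conj_by_def fun_eq_iff bij_comp_inv_into)
  ultimately have "conj_by \<phi> \<in> iso (Mp scW \<omega> scS \<rho>) (Mp scW \<omega> scS' \<rho>')"
    using conj_by_carrier[OF 1 2 iso] by (auto simp: iso_def hom_def)
  moreover have "homeomorphic_map (Mp_topology TF scW \<omega> scS \<rho>) (Mp_topology TF scW \<omega> scS' \<rho>') (conj_by \<phi>)"
    unfolding homeomorphic_map_maps
    using conj_by_continuous[OF 1 2 iso] conj_by_continuous[OF 2 1 inv] inv1 inv2
    by (intro exI[of _ "conj_by (inv_into UNIV \<phi>)"]) (simp add: homeomorphic_maps_def)
  moreover have "Mp_proj (conj_by \<phi> x) = Mp_proj x" for x :: "('w \<Rightarrow> 'w) \<times> _"
    by (cases x) (simp add: conj_by_def Mp_proj_def)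
  moreover have "conj_by \<phi> (Mp_incl scS c) = (Mp_incl scS' c :: ('w \<Rightarrow> 'w) \<times> _)" for c
    using bij lin by (simp add: conj_by_def Mp_incl_def fun_eq_iff bij_comp_inv_into)
  ultimately show ?thesis by (simp add: topological_extension_iso_def)
qed

text \<open>By Schur two isomorphisms of models differ by a scalar, which cancels in the
  conjugation.\<close>

lemma conj_by_unique:
  assumes 1: "model scS \<rho>" and \<phi>: "rep_iso scS \<rho> scS' \<rho>' \<phi>" and \<theta>: "rep_iso scS \<rho> scS' \<rho>' \<theta>"
    and x: "x \<in> carrier (Mp scW \<omega> scS \<rho>)"
  shows "conj_by \<theta> x = conj_by \<phi> x"
proof -
  interpret S: vector_space scS by (rule modelD(1)[OF 1])
  obtain g M where gM: "x = (g, M)" "M \<in> carrier (GL scS)"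
    using x carrier_Mp[OF 1] by (cases x) auto
  note inv = rep_iso_inv[OF \<phi>]
  have bij: "bij \<phi>" "bij \<theta>" using \<phi> \<theta> by (simp_all add: rep_iso_def)
  have "Vector_Spaces.linear scS scS (inv_into UNIV \<phi> \<circ> \<theta>)"
    using \<theta> inv by (auto simp: rep_iso_def intro: Vector_Spaces.linear_compose)
  moreover have "(inv_into UNIV \<phi> \<circ> \<theta>) (\<rho> h s) = \<rho> h ((inv_into UNIV \<phi> \<circ> \<theta>) s)" for h s
    using \<theta> inv by (cases h) (simp add: rep_iso_def fun_eq_iff)
  ultimately obtain c where c: "inv_into UNIV \<phi> \<circ> \<theta> = scS c"
    using model_schur[OF 1, of "inv_into UNIV \<phi> \<circ> \<theta>"] by blast
  have c': "inv_into UNIV \<phi> (\<theta> s) = scS c s" for s using c by (simp add: fun_eq_iff)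
  have \<theta>_eq: "\<theta> s = \<phi> (scS c s)" for s
    using c'[of s] bij_comp_inv_into(3)[OF bij(1), of "\<theta> s"] by simp
  have "\<theta> (M (inv_into UNIV \<theta> y)) = \<phi> (M (inv_into UNIV \<phi> y))" for y
    using c'[of "inv_into UNIV \<theta> y"] bij_comp_inv_into(3)[OF bij(2), of y] S.GL_scale[OF gM(2)]
    by (simp add: \<theta>_eq[of "M _"])
  then show ?thesis by (simp add: gM(1) conj_by_def fun_eq_iff)
qed

lemma Mp_change_model_eq:
  assumes 1: "model scS \<rho>" and 2: "model scS' \<rho>'"
  obtains \<theta> where "rep_iso scS \<rho> scS' \<rho>' \<theta>" "Mp_change_model scS \<rho> scS' \<rho>' = conj_by \<theta>"
  using someI_ex[OF model_iso[OF 1 2]] that by (auto simp: Mp_change_model_def)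

end

lemma char_not_2_two_nonzero:
  assumes "CHAR('f::field) \<noteq> 2"
  shows "(2::'f) \<noteq> 0"
proof
  assume "(2::'f) = 0"
  then have "CHAR('f) dvd 2" using of_nat_eq_0_iff_char_dvd[of 2, where 'a = 'f] by simp
  moreover have "CHAR('f) \<noteq> 1"
    using of_nat_eq_0_iff_char_dvd[of 1, where 'a = 'f] by auto
  ultimately show False
    using assms prime_nat_iff[of 2] two_is_prime_nat by blast
qed

theorem proposition3p5:
  fixes TF :: "'f::field topology" and p :: nat
    and scW :: "'f \<Rightarrow> 'w::ab_group_add \<Rightarrow> 'w" and \<omega> :: "'w \<Rightarrow> 'w \<Rightarrow> 'f"
    and \<psi> :: "'f \<Rightarrow> 'r::field"
    and scS :: "'r \<Rightarrow> 's::ab_group_add \<Rightarrow> 's" and \<rho> :: "'w \<times> 'f \<Rightarrow> 's \<Rightarrow> 's"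
    and scS' :: "'r \<Rightarrow> 'u::ab_group_add \<Rightarrow> 'u" and \<rho>' :: "'w \<times> 'f \<Rightarrow> 'u \<Rightarrow> 'u"
  assumes "finite_or_nonarch_local_field TF p" and "CHAR('f) \<noteq> 2"
    and "symplectic_space scW \<omega>"
    and "smooth_character TF \<psi>" and "\<exists>t. \<psi> t \<noteq> 1"
    and "Heisenberg_model TF scW \<omega> \<psi> scS \<rho>"
    and "Heisenberg_model TF scW \<omega> \<psi> scS' \<rho>'"
  shows
    "is_fibre_product TYPE('k)
       (Mp scW \<omega> scS \<rho>) (Mp_topology TF scW \<omega> scS \<rho>) Mp_proj snd
       (Sp scW \<omega>) (Sp_topology TF scW \<omega>) (GL scS) (GL_topology scS)
       (PGL scS) (PGL_topology scS) (sigma_S scS \<rho>) (red scS)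
     \<and> topological_subgroup (Mp scW \<omega> scS \<rho>) (Mp_topology TF scW \<omega> scS \<rho>)
         (Sp scW \<omega> \<times>\<times> GL scS) (prod_topology (Sp_topology TF scW \<omega>) (GL_topology scS))
     \<and> topological_central_extension
         multiplicative_group (discrete_topology (carrier multiplicative_group)) (Mp_incl scS)
         (Mp scW \<omega> scS \<rho>) (Mp_topology TF scW \<omega> scS \<rho>) Mp_proj
         (Sp scW \<omega>) (Sp_topology TF scW \<omega>)
     \<and> topological_extension_iso multiplicative_group
         (Mp_incl scS) (Mp scW \<omega> scS \<rho>) (Mp_topology TF scW \<omega> scS \<rho>) Mp_proj
         (Mp_incl scS') (Mp scW \<omega> scS' \<rho>') (Mp_topology TF scW \<omega> scS' \<rho>') Mp_proj
         (Mp_change_model scS \<rho> scS' \<rho>')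
     \<and> (\<forall>\<phi>. rep_iso scS \<rho> scS' \<rho>' \<phi> \<longrightarrow>
          (\<forall>x\<in>carrier (Mp scW \<omega> scS \<rho>). Mp_change_model scS \<rho> scS' \<rho>' x = conj_by \<phi> x))"
proof -
  obtain v where v: "ultrametric_field v" "TF = absolute_value_topology v"
    using finite_or_nonarch_local_field_ultrametric[OF assms(1)] .
  obtain n e f where sympl: "symplectic scW \<omega>" "symplectic.symplectic_family \<omega> n e f"
    "\<forall>w. w = (\<Sum>i<n. scW (\<omega> w (f i)) (e i) + scW (\<omega> (e i) w) (f i))"
    using symplectic_space_basis[OF assms(3)] .
  have \<psi>: "\<psi> x \<noteq> 0" "\<psi> (x + y) = \<psi> x * \<psi> y" "openin (absolute_value_topology v) {x. \<psi> x = 1}" for x y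
    using assms(4) by (auto simp: smooth_character_def v(2))
  obtain t where "\<psi> t \<noteq> 1" using assms(5) by blast
  then obtain a where a: "\<psi> a \<noteq> 1" "\<And>x. v x < v a \<Longrightarrow> \<psi> x = 1"
    using ultrametric_field.conductor[OF v(1) \<psi>(2,1,3)] by blast
  \<comment> \<open>The absolute value, the basis and the element \<open>a\<close> are auxiliary
    choices; the objects in the conclusion depend on none of them.\<close>
  interpret heisenberg_data v scW \<omega> n e f \<psi> a
    by (intro heisenberg_data.intro symplectic_coordinates.intro v(1) sympl(1)
        symplectic_coordinates_axioms.intro heisenberg_data_axioms.intro sympl(2) sympl(3)[rule_format] \<psi> a
        char_not_2_two_nonzero assms(2))
  note models = assms(6,7)[unfolded v(2)]
  obtain \<theta> where \<theta>: "rep_iso scS \<rho> scS' \<rho>' \<theta>" "Mp_change_model scS \<rho> scS' \<rho>' = conj_by \<theta>"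
    using Mp_change_model_eq[OF models] .
  show ?thesis
    unfolding v(2)
    by (intro conjI Mp_fibre_product Mp_topological_subgroup Mp_central_extension models)
      (use conj_by_extension_iso[OF models \<theta>(1)] conj_by_unique[OF models(1) _ \<theta>(1)] in \<open>simp_all add: \<theta>(2)\<close>)
qed

end
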